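(* Let $\epsilon\in(0,1/2)$ and let $n\ge 2$ and $m$ be positive integers with $\frac{1}{\epsilon^2}\ln(n^2)\le m\le n$. Then there exist linear-time algorithms $\mathrm{Enc}:\{0,1\}^{n^2-1}\to\{0,1\}^{n^2}$ (outputs regarded as $n\times n$ binary arrays) and $\mathrm{Dec}:\mathrm{Bal}_{\mathrm S}(n,m;\epsilon)\to\{0,1\}^{n^2-1}$ such that for every $x\in\{0,1\}^{n^2-1}$, writing $A=\mathrm{Enc}(x)$, every window $w$ of $m$ consecutive bits in any row $A_i$ ($1\le i\le n$) satisfies $\mathrm{wt}(w)\in[(1/2-\epsilon)m,(1/2+\epsilon)m]$. In particular $A\in\mathrm{Bal}_{\mathrm S}(n,m;\epsilon)$. Furthermore $\mathrm{Dec}(\mathrm{Enc}(x))=x$ for all $x\in\{0,1\}^{n^2-1}$.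
   Context: The weight $\mathrm{wt}(\cdot)$ of a binary sequence or array is its number of ones. $\mathrm{Bal}_{\mathrm S}(n,m;\epsilon)$ is the set of all $n\times n$ binary arrays in which every $m\times m$ subarray (formed by $m$ consecutive rows and $m$ consecutive columns) has weight in $[(1/2-\epsilon)m^2,(1/2+\epsilon)m^2]$. An $n\times n$ array is identified with the binary sequence of length $n^2$ obtained by reading it row by row; $A_i$ denotes its $i$th row. Linear time means linear in the sequence length $n^2$, for fixed $\epsilon$. *)

theory Defs
  imports Complex_Main "HOL-Library.FuncSet"
begin

section \<open>Binary sequences and arrays\<close>

definition bits :: "nat \<Rightarrow> bool list set" where
  "bits N = {x. length x = N}"

definition wt :: "bool list \<Rightarrow> nat" where
  "wt x = count_list x True"

text \<open>
  An n-by-n array is a sequence of length \<open>n\<^sup>2\<close>, read row by row.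
  Rows, columns and positions are counted from 0.
\<close>

definition row :: "nat \<Rightarrow> bool list \<Rightarrow> nat \<Rightarrow> bool list" where
  "row n A i = take n (drop (i * n) A)"

definition window :: "nat \<Rightarrow> bool list \<Rightarrow> nat \<Rightarrow> bool list" where
  "window m x j = take m (drop j x)"

definition subarray :: "nat \<Rightarrow> nat \<Rightarrow> bool list \<Rightarrow> nat \<Rightarrow> nat \<Rightarrow> bool list" where
  "subarray n m A a b = concat (map (\<lambda>i. window m (row n A i) b) [a..<a + m])"

definition Bal_S :: "nat \<Rightarrow> nat \<Rightarrow> real \<Rightarrow> bool list set" where
  "Bal_S n m \<epsilon> =
    {A \<in> bits (n\<^sup>2). \<forall>a b. a + m \<le> n \<longrightarrow> b + m \<le> n \<longrightarrow>
       real (wt (subarray n m A a b)) \<in> {(1/2 - \<epsilon>) * real (m\<^sup>2) .. (1/2 + \<epsilon>) * real (m\<^sup>2)}}"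


section \<open>Running time: a word RAM\<close>

text \<open>
  Algorithms are programs of a while-language with scalar and array variables, whose
  values are machine words of \<open>w\<close> bits.  Arithmetic is modulo \<open>2\<^sup>w\<close>, except that
  subtraction is cut off at 0.  Every memory access and every arithmetic operation costs one unit.
\<close>

type_synonym vname = string

datatype binop = Plus | Minus | Times | Div | Mod | Less | Equal

datatype expr =
    Const nat
  | Var vname
  | Get vname expr
  | Op binop expr expr

datatype com =
    Skip
  | Assign vname expr
  | Store vname expr expr
  | Seq com com
  | If expr com com
  | While expr com

record state =
  scal :: "vname \<Rightarrow> nat"
  arr :: "vname \<Rightarrow> nat \<Rightarrow> nat"

fun binop_val :: "binop \<Rightarrow> nat \<Rightarrow> nat \<Rightarrow> nat" where
  "binop_val Plus a b = a + b"
| "binop_val Minus a b = a - b"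
| "binop_val Times a b = a * b"
| "binop_val Div a b = a div b"
| "binop_val Mod a b = a mod b"
| "binop_val Less a b = of_bool (a < b)"
| "binop_val Equal a b = of_bool (a = b)"

fun val :: "nat \<Rightarrow> expr \<Rightarrow> state \<Rightarrow> nat" where
  "val w (Const k) s = k mod 2 ^ w"
| "val w (Var x) s = scal s x"
| "val w (Get x e) s = arr s x (val w e s)"
| "val w (Op f e1 e2) s = binop_val f (val w e1 s) (val w e2 s) mod 2 ^ w"

fun cost :: "expr \<Rightarrow> nat" where
  "cost (Const k) = 1"
| "cost (Var x) = 1"
| "cost (Get x e) = 1 + cost e"
| "cost (Op f e1 e2) = 1 + cost e1 + cost e2"

text \<open>\<open>exec w c s t s'\<close>: started in \<open>s\<close>, \<open>c\<close> halts in \<open>s'\<close> after exactly \<open>t\<close> steps.\<close>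

inductive exec :: "nat \<Rightarrow> com \<Rightarrow> state \<Rightarrow> nat \<Rightarrow> state \<Rightarrow> bool" for w :: nat where
  Skip: "exec w Skip s 1 s"
| Assign: "exec w (Assign x e) s (1 + cost e) (s\<lparr>scal := (scal s)(x := val w e s)\<rparr>)"
| Store: "exec w (Store x e1 e2) s (1 + cost e1 + cost e2)
    (s\<lparr>arr := (arr s)(x := (arr s x)(val w e1 s := val w e2 s))\<rparr>)"
| Seq: "exec w c1 s t1 s1 \<Longrightarrow> exec w c2 s1 t2 s2 \<Longrightarrow> exec w (Seq c1 c2) s (t1 + t2) s2"
| IfTrue: "val w e s \<noteq> 0 \<Longrightarrow> exec w c1 s t s1 \<Longrightarrow> exec w (If e c1 c2) s (1 + cost e + t) s1"
| IfFalse: "val w e s = 0 \<Longrightarrow> exec w c2 s t s1 \<Longrightarrow> exec w (If e c1 c2) s (1 + cost e + t) s1"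
| WhileFalse: "val w e s = 0 \<Longrightarrow> exec w (While e c) s (1 + cost e) s"
| WhileTrue: "val w e s \<noteq> 0 \<Longrightarrow> exec w c s t1 s1 \<Longrightarrow> exec w (While e c) s1 t2 s2 \<Longrightarrow>
    exec w (While e c) s (1 + cost e + t1 + t2) s2"

inductive_cases exec_elims:
  "exec w Skip s t s'" "exec w (Assign x e) s t s'" "exec w (Store x e1 e2) s t s'"
  "exec w (Seq c1 c2) s t s'" "exec w (If e c1 c2) s t s'" "exec w (While e c) s t s'"

lemma exec_deterministic:
  "exec w c s t s1 \<Longrightarrow> exec w c s t' s2 \<Longrightarrow> t = t' \<and> s1 = s2"
proof (induction arbitrary: t' s2 rule: exec.induct)
  case (Seq c1 s t1 s1 c2 t2 s2')
  from Seq.prems obtain u1 r u2 where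
    "t' = u1 + u2" "exec w c1 s u1 r" "exec w c2 r u2 s2" by (rule exec_elims(4)) simp
  with Seq.IH show ?case by metis
next
  case (IfTrue e s c1 t s1 c2)
  obtain u where
    "t' = 1 + cost e + u" "exec w c1 s u s2" by (rule exec_elims(5)[OF IfTrue.prems]) (use IfTrue.hyps in auto)
  with IfTrue.IH show ?case by metis
next
  case (IfFalse e s c2 t s1 c1)
  obtain u where
    "t' = 1 + cost e + u" "exec w c2 s u s2" by (rule exec_elims(5)[OF IfFalse.prems]) (use IfFalse.hyps in auto)
  with IfFalse.IH show ?case by metis
next
  case (WhileFalse e s c)
  show ?case by (rule exec_elims(6)[OF WhileFalse.prems]) (use WhileFalse.hyps in simp_all)
next
  case (WhileTrue e s c t1 s1 t2 s2')
  obtain u1 r u2 where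
    "t' = 1 + cost e + u1 + u2" "exec w c s u1 r" "exec w (While e c) r u2 s2"
    by (rule exec_elims(6)[OF WhileTrue.prems]) (use WhileTrue.hyps in auto)
  with WhileTrue.IH show ?case by metis
qed (auto elim: exec_elims(1-3))

definition init :: "nat \<Rightarrow> nat \<Rightarrow> bool list \<Rightarrow> state" where
  "init n m x =
    \<lparr>scal = (\<lambda>_. 0)(''n'' := n, ''m'' := m),
     arr = (\<lambda>_ _. 0)(''in'' := (\<lambda>i. if i < length x then of_bool (x ! i) else 0))\<rparr>"

text \<open>
  Program \<open>p\<close>, given the parameters \<open>n\<close> and \<open>m\<close>, computes \<open>f\<close> on the domain \<open>D\<close>
  with \<open>w\<close>-bit words in at most \<open>T\<close> steps.
\<close>

definition computes_within ::
  "nat \<Rightarrow> nat \<Rightarrow> com \<Rightarrow> nat \<Rightarrow> nat \<Rightarrow> bool list set \<Rightarrow> (bool list \<Rightarrow> bool list) \<Rightarrow> bool" where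
  "computes_within w T p n m D f \<longleftrightarrow>
    (\<forall>x\<in>D. \<exists>t s. t \<le> T \<and> exec w p (init n m x) t s \<and>
      (\<forall>i < length (f x). arr s ''out'' i = of_bool (f x ! i)))"

text \<open>Word length for inputs of size \<open>N\<close>: a constant multiple \<open>k\<close> of \<open>log N\<close>.\<close>

definition word_len :: "nat \<Rightarrow> nat \<Rightarrow> nat" where
  "word_len k N = k * nat \<lceil>log 2 (real N)\<rceil>"

end

theory Submission
  imports Defs
begin

text \<open>
  Sequence replacement in the row-by-row sequence of length \<open>N = n\<^sup>2\<close>.  Every \<open>m\<close> is a sum of numbers \<open>b\<close>
  and \<open>b + 1\<close> with \<open>b = \<Theta>(log N)\<close>, so it suffices that no window of \<open>K = b + 1\<close> bits has more than
  \<open>(1/2 + \<epsilon>) b\<close> ones or zeros.  The encoder appends a 0 to \<open>x\<close> and moves the bits one by one from a queue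
  to a stack; as soon as the last \<open>K\<close> bits of the stack are unbalanced, they are popped, and a code of their
  position and of their rank among the unbalanced words is appended to the queue.  By Hoeffding's bound
  this rank is short enough for every replacement to save a multiple of \<open>log N\<close> bits.  So there are
  \<open>O(N / log N)\<close> replacements, and as a window fits into \<open>O(1)\<close> machine words, each of them costs \<open>O(log N)\<close>.
  Extending the result with period \<open>K\<close> up to length \<open>N\<close> leaves the weights of the windows unchanged.
  The decoder undoes the replacements in reverse order.
  For the finitely many small \<open>n\<close> a code exists by counting, and the programs look it up.
\<close>

section \<open>Word RAM programs with a step budget\<close>

text \<open>The length \<open>K\<close> is kept at \<open>O(log N)\<close> for the sake of the
  machine: ranks and codes stay below \<open>2 ^ K\<close> and fit into one word, and the table of
  binomial tails stays small. With \<open>L\<close> the rounded-up logarithm of \<open>N\<close>,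
  the choice \<open>K > 0.85 * L * ln 2 / \<epsilon>^2\<close> and nine tenths of
  \<open>\<epsilon>\<close> in Hoeffding's bound make a rank save about \<open>1.37 * L\<close>
  bits. The position takes \<open>L\<close> of them; the rest covers the flags and leaves a net
  gain.

  Two obstacles shape the construction. The stack may be shorter than \<open>K\<close>, both when
  its end is tested and when padding of period \<open>K\<close> begins; a virtual alternating word
  in front of it removes these special cases. And the decoder has to halt in linear time on every
  array of \<open>Bal_S\<close>, while its loops are understood only on codewords; hence its core
  runs with a fuel counter.

  All time bounds are amortised: each step consumes credits, and an invariant compares the credits
  left with a potential made of the bits still to be moved and the bits that replacements can still
  save.\<close>

definition wp :: "nat \<Rightarrow> com \<Rightarrow> (state \<Rightarrow> nat \<Rightarrow> bool) \<Rightarrow> state \<Rightarrow> nat \<Rightarrow> bool" where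
  "wp w c Q s a \<longleftrightarrow> (\<exists>t s'. exec w c s t s' \<and> t \<le> a \<and> Q s' (a - t))"

text \<open>The credits that \<open>c1\<close> leaves over are the budget of \<open>c2\<close>, so
  an invariant can relate credits to a potential of the state.\<close>

lemma wp_Seq: "wp w c1 (wp w c2 Q) s a \<Longrightarrow> wp w (Seq c1 c2) Q s a"
proof -
  assume "wp w c1 (wp w c2 Q) s a"
  then obtain t1 s1 t2 s2 where "exec w c1 s t1 s1" "t1 \<le> a" "exec w c2 s1 t2 s2" "t2 \<le> a - t1"
    "Q s2 (a - t1 - t2)"
    unfolding wp_def by blast
  then show ?thesis
    unfolding wp_def by (intro exI[of _ "t1 + t2"] exI[of _ s2]) (auto intro: exec.Seq)
qed

lemma wp_If:
  assumes "1 + cost e \<le> a"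
    and "val w e s \<noteq> 0 \<Longrightarrow> wp w c1 Q s (a - (1 + cost e))"
    and "val w e s = 0 \<Longrightarrow> wp w c2 Q s (a - (1 + cost e))"
  shows "wp w (If e c1 c2) Q s a"
proof (cases "val w e s = 0")
  case True
  then obtain t s' where "exec w c2 s t s'" "t \<le> a - (1 + cost e)" "Q s' (a - (1 + cost e) - t)"
    using assms(3) unfolding wp_def by blast
  with True assms(1) show ?thesis
    unfolding wp_def by (intro exI[of _ "1 + cost e + t"] exI[of _ s']) (auto intro: exec.IfFalse[simplified])
next
  case False
  then obtain t s' where "exec w c1 s t s'" "t \<le> a - (1 + cost e)" "Q s' (a - (1 + cost e) - t)"
    using assms(2) unfolding wp_def by blast
  with False assms(1) show ?thesis
    unfolding wp_def by (intro exI[of _ "1 + cost e + t"] exI[of _ s']) (auto intro: exec.IfTrue[simplified])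
qed

text \<open>No variant is needed: every iteration consumes credits.\<close>

lemma wp_While:
  assumes "I s a"
    and body: "\<And>s a. I s a \<Longrightarrow> val w e s \<noteq> 0 \<Longrightarrow> 1 + cost e \<le> a \<and> wp w c I s (a - (1 + cost e))"
    and exit: "\<And>s a. I s a \<Longrightarrow> val w e s = 0 \<Longrightarrow> 1 + cost e \<le> a \<and> Q s (a - (1 + cost e))"
  shows "wp w (While e c) Q s a"
  using assms(1)
proof (induction a arbitrary: s rule: less_induct)
  case (less a)
  show ?case
  proof (cases "val w e s = 0")
    case True
    then show ?thesis
      using exit[OF less.prems] unfolding wp_def
      by (intro exI[of _ "1 + cost e"] exI[of _ s]) (auto intro: exec.WhileFalse[simplified])
  next
    case False
    then obtain t s' where *: "1 + cost e \<le> a" "exec w c s t s'" "t \<le> a - (1 + cost e)"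
      "I s' (a - (1 + cost e) - t)"
      using body[OF less.prems] unfolding wp_def by blast
    then have "wp w (While e c) Q s' (a - (1 + cost e) - t)"
      by (intro less.IH) auto
    then obtain t' s'' where "exec w (While e c) s' t' s''" "t' \<le> a - (1 + cost e) - t"
      "Q s'' (a - (1 + cost e) - t - t')"
      unfolding wp_def by blast
    with False * show ?thesis
      unfolding wp_def
      by (intro exI[of _ "1 + cost e + t + t'"] exI[of _ s'']) (auto intro: exec.WhileTrue[simplified])
  qed
qed

section \<open>Cutting off runs by a fuel counter\<close>

fun assigned :: "com \<Rightarrow> vname set" where
  "assigned Skip = {}"
| "assigned (Assign x e) = {x}"
| "assigned (Store x e1 e2) = {}"
| "assigned (Seq c1 c2) = assigned c1 \<union> assigned c2"
| "assigned (If e c1 c2) = assigned c1 \<union> assigned c2"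
| "assigned (While e c) = assigned c"

fun evars :: "expr \<Rightarrow> vname set" where
  "evars (Const k) = {}"
| "evars (Var x) = {x}"
| "evars (Get x e) = evars e"
| "evars (Op f e1 e2) = evars e1 \<union> evars e2"

fun cvars :: "com \<Rightarrow> vname set" where
  "cvars Skip = {}"
| "cvars (Assign x e) = insert x (evars e)"
| "cvars (Store x e1 e2) = evars e1 \<union> evars e2"
| "cvars (Seq c1 c2) = cvars c1 \<union> cvars c2"
| "cvars (If e c1 c2) = evars e \<union> cvars c1 \<union> cvars c2"
| "cvars (While e c) = evars e \<union> cvars c"

lemma exec_not_assigned: "exec w c s t s' \<Longrightarrow> x \<notin> assigned c \<Longrightarrow> scal s' x = scal s x"
  by (induction rule: exec.induct) auto

text \<open>Every iteration spends one unit of fuel. The comparison \<open>0 < e\<close> turns the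
  guard into 0 or 1; a product with the raw value of \<open>e\<close> could vanish modulo
  \<open>2 ^ w\<close>.\<close>

fun fueled :: "com \<Rightarrow> com" where
  "fueled (Seq c1 c2) = Seq (fueled c1) (fueled c2)"
| "fueled (If e c1 c2) = If e (fueled c1) (fueled c2)"
| "fueled (While e c) =
    While (Op Times (Op Less (Const 0) e) (Op Less (Const 0) (Var ''fuel'')))
      (Seq (Assign ''fuel'' (Op Minus (Var ''fuel'') (Const 1))) (fueled c))"
| "fueled c = c"

text \<open>For a loop, 7 steps besides \<open>cost e\<close> go to the extended guard and 4 to the
  decrement of the fuel.\<close>

fun unit_cost :: "com \<Rightarrow> nat" where
  "unit_cost Skip = 1"
| "unit_cost (Assign x e) = 1 + cost e"
| "unit_cost (Store x e1 e2) = 1 + cost e1 + cost e2"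
| "unit_cost (Seq c1 c2) = unit_cost c1 + unit_cost c2"
| "unit_cost (If e c1 c2) = 1 + cost e + unit_cost c1 + unit_cost c2"
| "unit_cost (While e c) = 11 + cost e + unit_cost c"

lemma evars_val: "x \<notin> evars e \<Longrightarrow> val w e (s\<lparr>scal := (scal s)(x := k)\<rparr>) = val w e s"
  by (induction e) auto

text \<open>Between two decrements of the fuel only straight-line code runs, so the time is at most
  the cost of one pass through the program times one more than the fuel spent.\<close>

lemma fueled_terminates:
  assumes "1 \<le> w" "''fuel'' \<notin> cvars c" "scal s ''fuel'' < 2 ^ w"
  shows "\<exists>t s'. exec w (fueled c) s t s' \<and> scal s' ''fuel'' \<le> scal s ''fuel'' \<and>
    t \<le> unit_cost c * (1 + scal s ''fuel'' - scal s' ''fuel'')"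
  using assms(2,3)
proof (induction c arbitrary: s)
  case Skip
  show ?case by (rule exI[of _ 1], rule exI[of _ s]) (use exec.Skip in auto)
next
  case (Assign x e)
  show ?case
    by (intro exI[of _ "1 + cost e"] exI[of _ "s\<lparr>scal := (scal s)(x := val w e s)\<rparr>"])
      (use Assign exec.Assign[of w x e s] in auto)
next
  case (Store x e1 e2)
  show ?case
    by (intro exI[of _ "1 + cost e1 + cost e2"]
        exI[of _ "s\<lparr>arr := (arr s)(x := (arr s x)(val w e1 s := val w e2 s))\<rparr>"])
      (use Store exec.Store[of w x e1 e2 s] in auto)
next
  case (Seq c1 c2)
  from Seq.IH(1)[of s] Seq.prems
  obtain t1 s1 where 1: "exec w (fueled c1) s t1 s1" "scal s1 ''fuel'' \<le> scal s ''fuel''"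
    "t1 \<le> unit_cost c1 * (1 + scal s ''fuel'' - scal s1 ''fuel'')" by auto
  from Seq.IH(2)[of s1] Seq.prems 1 obtain t2 s2 where 2: "exec w (fueled c2) s1 t2 s2" "scal s2 ''fuel'' \<le> scal s1 ''fuel''"
    "t2 \<le> unit_cost c2 * (1 + scal s1 ''fuel'' - scal s2 ''fuel'')" by auto
  have "unit_cost c1 * (1 + scal s ''fuel'' - scal s1 ''fuel'') \<le> unit_cost c1 * (1 + scal s ''fuel'' - scal s2 ''fuel'')"
    "unit_cost c2 * (1 + scal s1 ''fuel'' - scal s2 ''fuel'') \<le> unit_cost c2 * (1 + scal s ''fuel'' - scal s2 ''fuel'')"
    using 1 2 by (intro mult_le_mono2; simp)+
  with 1(3) 2(3) have "t1 + t2 \<le> (unit_cost c1 + unit_cost c2) * (1 + scal s ''fuel'' - scal s2 ''fuel'')"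
    unfolding add_mult_distrib by linarith
  with 1 2 show ?case
    by (intro exI[of _ "t1 + t2"] exI[of _ s2]) (auto intro: exec.Seq)
next
  case (If e c1 c2)
  show ?case
  proof (cases "val w e s = 0")
    case True
    from If.IH(2)[of s] If.prems obtain t s1 where
      1: "exec w (fueled c2) s t s1" "scal s1 ''fuel'' \<le> scal s ''fuel''"
      "t \<le> unit_cost c2 * (1 + scal s ''fuel'' - scal s1 ''fuel'')" by auto
    have "(1 + cost e) * 1 \<le> (1 + cost e) * (1 + scal s ''fuel'' - scal s1 ''fuel'')"
      using 1 by (intro mult_le_mono2) auto
    with 1 exec.IfFalse[OF True 1(1), of "fueled c1"] show ?thesis
      by (intro exI[of _ "1 + cost e + t"] exI[of _ s1]) (auto simp: add_mult_distrib)
  next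
    case False
    from If.IH(1)[of s] If.prems obtain t s1 where
      1: "exec w (fueled c1) s t s1" "scal s1 ''fuel'' \<le> scal s ''fuel''"
      "t \<le> unit_cost c1 * (1 + scal s ''fuel'' - scal s1 ''fuel'')" by auto
    have "(1 + cost e) * 1 \<le> (1 + cost e) * (1 + scal s ''fuel'' - scal s1 ''fuel'')"
      using 1 by (intro mult_le_mono2) auto
    with 1 exec.IfTrue[OF False 1(1), of "fueled c2"] show ?thesis
      by (intro exI[of _ "1 + cost e + t"] exI[of _ s1]) (auto simp: add_mult_distrib)
  qed
next
  case (While e c)
  define e' where "e' = Op Times (Op Less (Const 0) e) (Op Less (Const 0) (Var ''fuel''))"
  define d where "d = Seq (Assign ''fuel'' (Op Minus (Var ''fuel'') (Const 1))) (fueled c)"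
  define u where "u = 11 + cost e + unit_cost c"
  have ce: "cost e' = cost e + 6" by (simp add: e'_def)
  from While.prems have c: "''fuel'' \<notin> cvars c" by simp
  have "2 ^ 1 \<le> (2::nat) ^ w" using assms(1) by (intro power_increasing) auto
  then have w1: "1 < (2::nat) ^ w" by simp
  have "\<exists>t s'. exec w (While e' d) s t s' \<and> scal s' ''fuel'' \<le> scal s ''fuel'' \<and>
    t \<le> u * (1 + scal s ''fuel'' - scal s' ''fuel'')" if "scal s ''fuel'' < 2 ^ w" for s
    using that
  proof (induction "scal s ''fuel''" arbitrary: s rule: less_induct)
    case less
    show ?case
    proof (cases "val w e' s = 0")
      case True
      show ?thesis
        by (intro exI[of _ "1 + cost e'"] exI[of _ s])
          (use ce exec.WhileFalse[OF True, of d] in \<open>auto simp: u_def\<close>)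
    next
      case False
      then have pos: "0 < scal s ''fuel''" by (auto simp: e'_def of_bool_def split: if_splits)
      define s1 where "s1 = s\<lparr>scal := (scal s)(''fuel'' := scal s ''fuel'' - 1)\<rparr>"
      have v: "val w (Op Minus (Var ''fuel'') (Const 1)) s = scal s ''fuel'' - 1"
        using less.prems w1 assms(1) by simp
      have E1: "exec w (Assign ''fuel'' (Op Minus (Var ''fuel'') (Const 1))) s 4 s1"
        using exec.Assign[of w "''fuel''" "Op Minus (Var ''fuel'') (Const 1)" s]
        unfolding v s1_def by (simp add: numeral_eq_Suc)
      obtain t s2 where 2: "exec w (fueled c) s1 t s2" "scal s2 ''fuel'' \<le> scal s1 ''fuel''"
        "t \<le> unit_cost c * (1 + scal s1 ''fuel'' - scal s2 ''fuel'')"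
        using While.IH[OF c, of s1] less.prems by (auto simp: s1_def less_imp_diff_less)
      have f: "scal s1 ''fuel'' = scal s ''fuel'' - 1" by (simp add: s1_def)
      have E: "exec w d s (4 + t) s2" unfolding d_def by (rule exec.Seq[OF E1 2(1)])
      have "scal s2 ''fuel'' < scal s ''fuel''" "scal s2 ''fuel'' < 2 ^ w"
        using 2(2) f pos less.prems by auto
      from less.hyps[OF this] obtain t' s3 where 3: "exec w (While e' d) s2 t' s3" "scal s3 ''fuel'' \<le> scal s2 ''fuel''"
        "t' \<le> u * (1 + scal s2 ''fuel'' - scal s3 ''fuel'')"
        by blast
      \<comment> \<open>Fuel spent by the first iteration. Its own decrement accounts for the extra
        1 in the bound for the body, so the body costs at most
        \<open>unit_cost c * x\<close>.\<close>
      define x where "x = scal s ''fuel'' - scal s2 ''fuel''"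
      define y where "y = 1 + scal s2 ''fuel'' - scal s3 ''fuel''"
      have x: "1 \<le> x" using 2(2) f pos by (simp add: x_def)
      have xy: "1 + scal s ''fuel'' - scal s3 ''fuel'' = x + y"
        using 2(2) f pos 3(2) by (simp add: x_def y_def)
      have "1 + scal s1 ''fuel'' - scal s2 ''fuel'' = x" using 2(2) f pos by (simp add: x_def)
      with 2(3) have tx: "t \<le> unit_cost c * x" by simp
      have "(11 + cost e) * 1 \<le> (11 + cost e) * x" using x by (intro mult_le_mono2)
      with tx have "11 + cost e + t \<le> u * x" unfolding u_def by (simp add: add_mult_distrib)
      with 3(3) have "1 + cost e' + (4 + t) + t' \<le> u * (x + y)"
        unfolding ce y_def[symmetric] by (simp add: add_mult_distrib2)
      then show ?thesis
        using exec.WhileTrue[OF False E 3(1)] 2(2) 3(2) f xy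
        by (intro exI[of _ "1 + cost e' + (4 + t) + t'"] exI[of _ s3]) auto
    qed
  qed
  then show ?case using While.prems(2) by (simp add: e'_def d_def u_def)
qed

text \<open>Each iteration of the original run costs at least one step, so a run of \<open>t\<close>
  steps spends at most \<open>t\<close> units: with \<open>t \<le> f\<close> the fuel never cuts it
  off.\<close>

lemma fueled_simulates:
  assumes "exec w c s t s'" "1 \<le> w" "''fuel'' \<notin> cvars c" "t \<le> f" "f < 2 ^ w"
  shows "\<exists>t' f'. exec w (fueled c) (s\<lparr>scal := (scal s)(''fuel'' := f)\<rparr>) t'
    (s'\<lparr>scal := (scal s')(''fuel'' := f')\<rparr>) \<and> f \<le> f' + t \<and> f' \<le> f"
  using assms(1,3-5)
proof (induction arbitrary: f rule: exec.induct)
  case (Skip s)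
  then show ?case using exec.Skip by fastforce
next
  case (Assign x e s)
  then have *: "''fuel'' \<noteq> x" "''fuel'' \<notin> evars e" by auto
  show ?case
    using exec.Assign[of w x e "s\<lparr>scal := (scal s)(''fuel'' := f)\<rparr>"]
    by (rule_tac exI[of _ "1 + cost e"], rule_tac exI[of _ f])
      (simp add: evars_val[OF *(2)] fun_upd_twist[OF *(1)] del: fun_upd_apply)
next
  case (Store x e1 e2 s)
  then have *: "''fuel'' \<notin> evars e1" "''fuel'' \<notin> evars e2" by auto
  let ?s = "s\<lparr>scal := (scal s)(''fuel'' := f)\<rparr>"
    and ?u = "\<lambda>s. s\<lparr>arr := (arr s)(x := (arr s x)(val w e1 s := val w e2 s))\<rparr>"
  have "?u ?s = (?u s)\<lparr>scal := (scal (?u s))(''fuel'' := f)\<rparr>"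
    by (simp only: evars_val[OF *(1)] evars_val[OF *(2)]) simp
  with exec.Store[of w x e1 e2 ?s]
  have "exec w (Store x e1 e2) ?s (1 + cost e1 + cost e2) ((?u s)\<lparr>scal := (scal (?u s))(''fuel'' := f)\<rparr>)"
    by (simp only:)
  then show ?case
    by (rule_tac exI[of _ "1 + cost e1 + cost e2"], rule_tac exI[of _ f]) (simp del: fun_upd_apply)
next
  case (Seq c1 s t1 s1 c2 t2 s2)
  from Seq.prems have "''fuel'' \<notin> cvars c1" "t1 \<le> f" by auto
  from Seq.IH(1)[OF this Seq.prems(3)] obtain u1 f1 where
    1: "exec w (fueled c1) (s\<lparr>scal := (scal s)(''fuel'' := f)\<rparr>) u1 (s1\<lparr>scal := (scal s1)(''fuel'' := f1)\<rparr>)"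
      "f \<le> f1 + t1" "f1 \<le> f" by blast
  from Seq.prems 1 have "''fuel'' \<notin> cvars c2" "t2 \<le> f1" "f1 < 2 ^ w" by auto
  from Seq.IH(2)[OF this] obtain u2 f2 where
    2: "exec w (fueled c2) (s1\<lparr>scal := (scal s1)(''fuel'' := f1)\<rparr>) u2 (s2\<lparr>scal := (scal s2)(''fuel'' := f2)\<rparr>)"
      "f1 \<le> f2 + t2" "f2 \<le> f1" by blast
  show ?case
    by (rule exI[of _ "u1 + u2"], rule exI[of _ f2])
      (use exec.Seq[OF 1(1) 2(1)] 1(2,3) 2(2,3) in \<open>simp del: fun_upd_apply\<close>)
next
  case (IfTrue e s c1 t s1 c2)
  from IfTrue.prems have "''fuel'' \<notin> cvars c1" "t \<le> f" by auto
  from IfTrue.IH[OF this IfTrue.prems(3)] obtain u1 f1 where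
    1: "exec w (fueled c1) (s\<lparr>scal := (scal s)(''fuel'' := f)\<rparr>) u1 (s1\<lparr>scal := (scal s1)(''fuel'' := f1)\<rparr>)"
      "f \<le> f1 + t" "f1 \<le> f" by blast
  have "val w e (s\<lparr>scal := (scal s)(''fuel'' := f)\<rparr>) \<noteq> 0"
    using IfTrue.hyps IfTrue.prems by (simp add: evars_val)
  from exec.IfTrue[OF this 1(1), of "fueled c2"] 1(2,3) show ?case
    by (rule_tac exI[of _ "1 + cost e + u1"], rule_tac exI[of _ f1]) (simp del: fun_upd_apply)
next
  case (IfFalse e s c2 t s1 c1)
  from IfFalse.prems have "''fuel'' \<notin> cvars c2" "t \<le> f" by auto
  from IfFalse.IH[OF this IfFalse.prems(3)] obtain u1 f1 where
    1: "exec w (fueled c2) (s\<lparr>scal := (scal s)(''fuel'' := f)\<rparr>) u1 (s1\<lparr>scal := (scal s1)(''fuel'' := f1)\<rparr>)"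
      "f \<le> f1 + t" "f1 \<le> f" by blast
  have "val w e (s\<lparr>scal := (scal s)(''fuel'' := f)\<rparr>) = 0"
    using IfFalse.hyps IfFalse.prems by (simp add: evars_val)
  from exec.IfFalse[OF this 1(1), of "fueled c1"] 1(2,3) show ?case
    by (rule_tac exI[of _ "1 + cost e + u1"], rule_tac exI[of _ f1]) (simp del: fun_upd_apply)
next
  case (WhileFalse e s c)
  have "val w (Op Times (Op Less (Const 0) e) (Op Less (Const 0) (Var ''fuel''))) (s\<lparr>scal := (scal s)(''fuel'' := f)\<rparr>) = 0"
    using WhileFalse by (simp add: evars_val)
  from exec.WhileFalse[OF this] have "exec w (fueled (While e c)) (s\<lparr>scal := (scal s)(''fuel'' := f)\<rparr>)
      (1 + cost (Op Times (Op Less (Const 0) e) (Op Less (Const 0) (Var ''fuel''))))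
      (s\<lparr>scal := (scal s)(''fuel'' := f)\<rparr>)"
    unfolding fueled.simps .
  then show ?case by (rule_tac exI, rule_tac exI[of _ f]) (rule conjI, assumption, simp)
next
  case (WhileTrue e s c t1 s1 t2 s2)
  have "2 ^ 1 \<le> (2::nat) ^ w" using assms(2) by (intro power_increasing) auto
  then have w1: "1 < (2::nat) ^ w" by simp
  let ?f = "f - 1"
  from WhileTrue.prems have "''fuel'' \<notin> cvars c" "t1 \<le> ?f" "?f < 2 ^ w" by auto
  from WhileTrue.IH(1)[OF this] obtain u1 f1 where
    1: "exec w (fueled c) (s\<lparr>scal := (scal s)(''fuel'' := ?f)\<rparr>) u1 (s1\<lparr>scal := (scal s1)(''fuel'' := f1)\<rparr>)"
      "?f \<le> f1 + t1" "f1 \<le> ?f" by blast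
  from WhileTrue.prems 1 have "t2 \<le> f1" "f1 < 2 ^ w" by auto
  from WhileTrue.IH(2)[OF WhileTrue.prems(1) this] obtain u2 f2 where
    2: "exec w (fueled (While e c)) (s1\<lparr>scal := (scal s1)(''fuel'' := f1)\<rparr>) u2 (s2\<lparr>scal := (scal s2)(''fuel'' := f2)\<rparr>)"
      "f1 \<le> f2 + t2" "f2 \<le> f1" by blast
  have v: "val w (Op Times (Op Less (Const 0) e) (Op Less (Const 0) (Var ''fuel''))) (s\<lparr>scal := (scal s)(''fuel'' := f)\<rparr>) \<noteq> 0"
    using WhileTrue.hyps WhileTrue.prems w1 assms(2) by (simp add: evars_val)
  have "exec w (Assign ''fuel'' (Op Minus (Var ''fuel'') (Const 1))) (s\<lparr>scal := (scal s)(''fuel'' := f)\<rparr>) 4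
     (s\<lparr>scal := (scal s)(''fuel'' := ?f)\<rparr>)"
    using exec.Assign[of w "''fuel''" "Op Minus (Var ''fuel'') (Const 1)" "s\<lparr>scal := (scal s)(''fuel'' := f)\<rparr>"]
      w1 WhileTrue.prems assms(2) by (simp add: numeral_eq_Suc)
  from exec.WhileTrue[OF v exec.Seq[OF this 1(1)] 2(1)[unfolded fueled.simps]] 1(2,3) 2(2,3) WhileTrue.prems
  show ?case
    by (rule_tac exI, rule_tac exI[of _ f2]) (unfold fueled.simps, rule conjI, assumption, linarith)
qed

section \<open>Lookup programs for finitely many inputs\<close>

lemma one_less_exp: "1 \<le> w \<Longrightarrow> 1 < (2::nat) ^ w"
  by (metis one_less_numeral_iff one_less_power semiring_norm(76) less_le_trans zero_less_one)

fun match_in :: "nat \<Rightarrow> bool list \<Rightarrow> expr" where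
  "match_in i [] = Const 1"
| "match_in i (b # bs) =
    Op Times (Op Equal (Get ''in'' (Const i)) (Const (of_bool b))) (match_in (Suc i) bs)"

lemma val_match_in:
  "1 \<le> w \<Longrightarrow> i + length bs < 2 ^ w \<Longrightarrow>
    val w (match_in i bs) s = of_bool (\<forall>j<length bs. arr s ''in'' (i + j) = of_bool (bs ! j))"
proof (induction bs arbitrary: i)
  case Nil
  then show ?case using one_less_exp[of w] by simp
next
  case (Cons b bs)
  have "(of_bool b :: nat) mod 2 ^ w = of_bool b" "(1::nat) mod 2 ^ w = 1"
    using one_less_exp[OF Cons.prems(1)] Cons.prems(1) by simp_all
  moreover have "(\<forall>j<Suc (length bs). arr s ''in'' (i + j) = of_bool ((b # bs) ! j)) \<longleftrightarrow>
      arr s ''in'' i = of_bool b \<and> (\<forall>j<length bs. arr s ''in'' (Suc i + j) = of_bool (bs ! j))"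
    by (subst All_less_Suc2) auto
  moreover have "val w (match_in (Suc i) bs) s =
      of_bool (\<forall>j<length bs. arr s ''in'' (Suc i + j) = of_bool (bs ! j))"
    using Cons by simp
  ultimately show ?case
    using Cons.prems(2) by (auto simp: of_bool_def)
qed

fun write_out :: "nat \<Rightarrow> bool list \<Rightarrow> com" where
  "write_out i [] = Skip"
| "write_out i (b # bs) = Seq (Store ''out'' (Const i) (Const (of_bool b))) (write_out (Suc i) bs)"

lemma exec_write_out:
  "1 \<le> w \<Longrightarrow> i + length bs < 2 ^ w \<Longrightarrow>
    \<exists>s'. exec w (write_out i bs) s (1 + 3 * length bs) s' \<and>
      (\<forall>j<i. arr s' ''out'' j = arr s ''out'' j) \<and>
      (\<forall>j<length bs. arr s' ''out'' (i + j) = of_bool (bs ! j))"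
proof (induction bs arbitrary: i s)
  case Nil
  show ?case using exec.Skip by fastforce
next
  case (Cons b bs)
  define s1 where "s1 = s\<lparr>arr := (arr s)(''out'' := (arr s ''out'')(i := of_bool b))\<rparr>"
  have "(of_bool b :: nat) mod 2 ^ w = of_bool b"
    using one_less_exp[OF Cons.prems(1)] by simp
  then have 1: "exec w (Store ''out'' (Const i) (Const (of_bool b))) s 3 s1"
    using exec.Store[of w "''out''" "Const i" "Const (of_bool b)" s] Cons.prems
    by (simp add: s1_def numeral_eq_Suc)
  from Cons.IH[of "Suc i" s1] Cons.prems obtain s2 where
    2: "exec w (write_out (Suc i) bs) s1 (1 + 3 * length bs) s2"
      "\<forall>j<Suc i. arr s2 ''out'' j = arr s1 ''out'' j"
      "\<forall>j<length bs. arr s2 ''out'' (Suc i + j) = of_bool (bs ! j)" by auto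
  have "exec w (write_out i (b # bs)) s (1 + 3 * length (b # bs)) s2"
    using exec.Seq[OF 1 2(1)] by (simp add: numeral_eq_Suc)
  moreover have "\<forall>j<i. arr s2 ''out'' j = arr s ''out'' j"
    using 2(2) by (simp add: s1_def)
  moreover have "arr s2 ''out'' (i + j) = of_bool ((b # bs) ! j)" if "j < length (b # bs)" for j
    using 2(2,3) that by (cases j) (auto simp: s1_def)
  ultimately show ?case by blast
qed

definition outputs :: "nat \<Rightarrow> nat \<Rightarrow> com \<Rightarrow> nat \<Rightarrow> nat \<Rightarrow> bool list \<Rightarrow> bool list \<Rightarrow> bool" where
  "outputs w T p n m x y \<longleftrightarrow> (\<exists>t s. t \<le> T \<and> exec w p (init n m x) t s \<and>
    (\<forall>i<length y. arr s ''out'' i = of_bool (y ! i)))"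

text \<open>A chain of tests, one per input. A program does not see the length of its input, since
  the cells behind it read 0; comparing the first bits identifies the input because the length is a
  function of \<open>n\<close>.\<close>

lemma finite_lookup_program:
  fixes f :: "nat \<Rightarrow> nat \<Rightarrow> bool list \<Rightarrow> bool list"
  assumes "finite D" "\<And>n m x. (n, m, x) \<in> D \<Longrightarrow> length x = len n"
  shows "\<exists>p T W. \<forall>w\<ge>W. \<forall>(n, m, x)\<in>D. outputs w T p n m x (f n m x)"
  using assms
proof (induction D rule: finite_induct)
  case empty
  then show ?case by simp
next
  case (insert d D)
  obtain n m x where d: "d = (n, m, x)" by (cases d)
  obtain p T W where IH: "\<And>w n m x. w \<ge> W \<Longrightarrow> (n, m, x) \<in> D \<Longrightarrow> outputs w T p n m x (f n m x)"
    using insert.IH insert.prems by blast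
  let ?y = "f n m x"
  define e where "e = Op Times (Op Equal (Var ''n'') (Const n))
    (Op Times (Op Equal (Var ''m'') (Const m)) (match_in 0 x))"
  define q where "q = If e (write_out 0 ?y) p"
  \<comment> \<open>Constants are reduced modulo \<open>2 ^ w\<close>; from this word length on all
    constants of the new test and of the written output are exact.\<close>
  define W' where "W' = W + n + m + length x + length ?y + 1"
  define T' where "T' = 1 + cost e + (T + 1 + 3 * length ?y)"
  have val: "val w e (init n' m' x') \<noteq> 0 \<longleftrightarrow> n' = n \<and> m' = m \<and>
      (\<forall>j<length x. (if j < length x' then of_bool (x' ! j) else 0) = (of_bool (x ! j) :: nat))"
    if "w \<ge> W'" for w n' m' x'
  proof -
    have "k < 2 ^ w" if "k \<le> W'" for k :: nat
      using that \<open>w \<ge> W'\<close> by (meson le_less_trans less_exp order.trans)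
    then have "n < 2 ^ w" "m < 2 ^ w" "length x < 2 ^ w" "Suc 0 < 2 ^ w" "1 \<le> w"
      using that one_less_exp[of w] by (auto simp: W'_def)
    then show ?thesis
      by (simp add: e_def init_def val_match_in of_bool_def)
  qed
  have "outputs w T' q n' m' x' (f n' m' x')" if w: "w \<ge> W'" and "(n', m', x') \<in> insert d D" for w n' m' x'
  proof (cases "val w e (init n' m' x') = 0")
    case True
    then have "(n', m', x') \<noteq> d" unfolding d using val[OF w, of n' m' x'] by auto
    then have "(n', m', x') \<in> D" using that by blast
    then obtain t s where "t \<le> T" "exec w p (init n' m' x') t s"
      "\<forall>i<length (f n' m' x'). arr s ''out'' i = of_bool (f n' m' x' ! i)"
      using IH[of w n' m' x'] w unfolding outputs_def W'_def by auto
    then show ?thesis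
      unfolding outputs_def
      by (intro exI[of _ "1 + cost e + t"] exI[of _ s])
        (use exec.IfFalse[OF True, of p t s "write_out 0 ?y"] in \<open>auto simp: q_def T'_def\<close>)
  next
    case False
    note * = False[unfolded val[OF w]]
    then have *: "n' = n" "m' = m"
      "\<forall>j<length x. (if j < length x' then of_bool (x' ! j) else 0) = (of_bool (x ! j) :: nat)" by simp_all
    moreover have "length x' = length x"
      using insert.prems[of n' m' x'] insert.prems[of n m x] that(2) *(1) by (simp add: d)
    ultimately have "x' = x" by (intro nth_equalityI) (simp_all add: of_bool_eq_iff)
    have "length ?y \<le> w" using w by (simp add: W'_def)
    then have "length ?y < 2 ^ w" by (rule le_less_trans[OF _ less_exp])
    then obtain s where s: "exec w (write_out 0 ?y) (init n m x) (1 + 3 * length ?y) s"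
      "\<forall>j<length ?y. arr s ''out'' j = of_bool (?y ! j)"
      using exec_write_out[of w 0 ?y "init n m x"] w by (auto simp: W'_def)
    show ?thesis
      unfolding outputs_def
      by (rule exI[of _ "1 + cost e + (1 + 3 * length ?y)"], rule exI[of _ s])
        (use exec.IfTrue[OF False[unfolded * \<open>x' = x\<close>] s(1), of p] s(2) * \<open>x' = x\<close> in
          \<open>auto simp: q_def T'_def\<close>)
  qed
  then have "\<forall>w\<ge>W'. \<forall>(n, m, x)\<in>insert d D. outputs w T' q n m x (f n m x)"
    by (simp del: insert_iff add: Ball_def)
  then show ?case by blast
qed

section \<open>Unbalanced words\<close>

lemma count_bool_sum: "count_list xs True + count_list xs False = length xs"
  by (induction xs) auto

lemma count_list_take_drop:
  "count_list xs f = count_list (take k xs) f + count_list (drop k xs) f"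
  by (metis append_take_drop_id count_list_append)

text \<open>The binomial tail: the number of words of length \<open>j\<close> with at least
  \<open>t\<close> ones, split by one bit. The truncated \<open>t - 1\<close> is right also for
  \<open>t = 0\<close>, where every word counts. The programs fill their table by the same
  recursion.\<close>

fun tails :: "nat \<Rightarrow> nat \<Rightarrow> nat" where
  "tails 0 t = of_bool (t = 0)"
| "tails (Suc j) t = tails j t + tails j (t - 1)"

lemma bits_0: "bits 0 = {[]}"
  by (auto simp: bits_def)

lemma bits_Suc: "bits (Suc j) = (#) True ` bits j \<union> (#) False ` bits j"
  by (auto simp: bits_def length_Suc_conv image_iff)

lemma finite_bits [simp]: "finite (bits j)"
  by (induction j) (auto simp: bits_0 bits_Suc)

lemma card_bits: "card (bits j) = 2 ^ j"
proof (induction j)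
  case (Suc j)
  have "card (bits (Suc j)) = card ((#) True ` bits j) + card ((#) False ` bits j)"
    unfolding bits_Suc by (rule card_Un_disjoint) auto
  then show ?case using Suc by (simp add: card_image)
qed (simp add: bits_0)

lemma card_tails: "card {x \<in> bits j. t \<le> count_list x f} = tails j t"
proof (induction j arbitrary: t)
  case 0
  have "{x \<in> bits 0. t \<le> count_list x f} = (if t = 0 then {[]} else {})"
    by (auto simp: bits_0)
  then show ?case by simp
next
  case (Suc j)
  have "{x \<in> bits (Suc j). t \<le> count_list x f} =
      (#) f ` {x \<in> bits j. t - 1 \<le> count_list x f} \<union> (#) (\<not> f) ` {x \<in> bits j. t \<le> count_list x f}"
    unfolding bits_Suc by (cases f) auto
  also have "card \<dots> = card ((#) f ` {x \<in> bits j. t - 1 \<le> count_list x f}) +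
      card ((#) (\<not> f) ` {x \<in> bits j. t \<le> count_list x f})"
    by (rule card_Un_disjoint) auto
  finally show ?case using Suc by (simp add: card_image)
qed

section \<open>Chernoff and Hoeffding bounds for binomial tails\<close>

lemma tails_le: "tails j t \<le> 2 ^ j"
  by (induction j arbitrary: t) (auto simp: mult_2 add_mono)

text \<open>Markov's inequality for the weight \<open>\<theta> ^ (number of ones)\<close>, whose sum
  over all words of length \<open>j\<close> is \<open>(1 + \<theta>) ^ j\<close>.\<close>

lemma tails_Chernoff:
  assumes "1 \<le> (\<theta>::real)"
  shows "real (tails j t) * \<theta> ^ t \<le> (1 + \<theta>) ^ j"
proof (induction j arbitrary: t)
  case (Suc j)
  have "\<theta> ^ t \<le> \<theta> * \<theta> ^ (t - 1)"
    using assms by (cases t) auto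
  then have "real (tails j (t - 1)) * \<theta> ^ t \<le> real (tails j (t - 1)) * (\<theta> * \<theta> ^ (t - 1))"
    by (intro mult_left_mono) auto
  also have "\<dots> \<le> \<theta> * (1 + \<theta>) ^ j"
    using mult_left_mono[OF Suc[of "t - 1"], of \<theta>] assms by (simp add: mult_ac)
  finally show ?case using Suc[of t] by (simp add: algebra_simps)
qed auto

text \<open>The bound on the moment generating function of a fair sign, proved through two monotone
  functions instead of power series.\<close>

lemma cosh_le_exp_half_square:
  fixes y :: real
  assumes "0 \<le> y"
  shows "exp y + exp (- y) \<le> 2 * exp (y\<^sup>2 / 2)"
proof -
  have "(1 - y) * exp y \<le> (1 + y) * exp (- y)" if "0 \<le> y" for y :: real
  proof -
    define k where "k = (\<lambda>y::real. (1 + y) * exp (- y) - (1 - y) * exp y)"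
    have "k 0 \<le> k y"
    proof (rule DERIV_nonneg_imp_nondecreasing[OF that])
      fix x :: real assume "0 \<le> x"
      then have "0 \<le> x * (exp x - exp (- x))" by simp
      moreover have "(k has_real_derivative x * (exp x - exp (- x))) (at x)"
        unfolding k_def by (auto intro!: derivative_eq_intros simp: algebra_simps)
      ultimately show "\<exists>l. (k has_real_derivative l) (at x) \<and> 0 \<le> l" by blast
    qed
    then show ?thesis by (simp add: k_def)
  qed
  note k = this
  \<comment> \<open>The quotient of the two sides, up to a constant. The inequality \<open>k\<close>
    says that its derivative is not positive, so it never exceeds its value 2 at 0.\<close>
  define h where "h = (\<lambda>y::real. exp (- (y * y / 2)) * (exp y + exp (- y)))"
  have "h y \<le> h 0"
  proof (rule DERIV_nonpos_imp_nonincreasing[OF assms])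
    fix x :: real assume "0 \<le> x"
    with k have "exp (- (x * x / 2)) * ((1 - x) * exp x - (1 + x) * exp (- x)) \<le> 0"
      by (simp add: mult_le_0_iff)
    moreover have "(h has_real_derivative
        exp (- (x * x / 2)) * ((1 - x) * exp x - (1 + x) * exp (- x))) (at x)"
      unfolding h_def by (auto intro!: derivative_eq_intros simp: algebra_simps)
    ultimately show "\<exists>l. (h has_real_derivative l) (at x) \<and> l \<le> 0" by blast
  qed
  then have "exp (y\<^sup>2 / 2) * h y \<le> exp (y\<^sup>2 / 2) * 2"
    by (intro mult_left_mono) (auto simp: h_def)
  then show ?thesis
    by (simp add: h_def power2_eq_square flip: mult.assoc exp_add)
qed

text \<open>The deviation is measured by \<open>k\<close> although only \<open>j\<close> bits are
  random: at the start of the sequence just \<open>j\<close> bits of a window of length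
  \<open>k\<close> are free, the others belong to the fixed virtual prefix.\<close>

lemma tails_Hoeffding:
  assumes "0 \<le> d" and t: "real j / 2 + d * real k \<le> real t" and "j \<le> k"
  shows "real (tails j t) \<le> 2 ^ j * exp (- 2 * d\<^sup>2 * real k)"
proof -
  \<comment> \<open>The minimiser of the exponent \<open>k * y^2 / 2 - 2 * d * k * y\<close> that
    remains at the end.\<close>
  define y where "y = 2 * d"
  have y: "0 \<le> y" using assms(1) by (simp add: y_def)
  have "1 + exp (2 * y) = exp y * (exp y + exp (- y))"
    by (simp add: algebra_simps flip: exp_add)
  also have "\<dots> \<le> exp y * (2 * exp (y\<^sup>2 / 2))"
    using cosh_le_exp_half_square[OF y] by simp
  also have "\<dots> = 2 * exp (y + y\<^sup>2 / 2)"
    by (simp add: exp_add)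
  finally have "(1 + exp (2 * y)) ^ j \<le> (2 * exp (y + y\<^sup>2 / 2)) ^ j"
    by (intro power_mono) (auto simp: add_nonneg_nonneg)
  also have "\<dots> = 2 ^ j * exp (real j * (y + y\<^sup>2 / 2))"
    by (simp add: power_mult_distrib exp_of_nat_mult)
  finally have "real (tails j t) * exp (real t * (2 * y)) \<le> 2 ^ j * exp (real j * (y + y\<^sup>2 / 2))"
    using tails_Chernoff[of "exp (2 * y)" j t] y by (simp add: exp_of_nat_mult)
  then have "real (tails j t) \<le> 2 ^ j * exp (real j * (y + y\<^sup>2 / 2)) / exp (real t * (2 * y))"
    by (simp add: field_simps)
  also have "\<dots> = 2 ^ j * exp (real j * (y + y\<^sup>2 / 2) - real t * (2 * y))"
    by (simp add: exp_diff)
  also have "\<dots> \<le> 2 ^ j * exp (- 2 * d\<^sup>2 * real k)"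
  proof -
    have "(real j / 2 + d * real k) * (2 * y) \<le> real t * (2 * y)"
      using t y by (intro mult_right_mono) auto
    moreover have "real j * (y\<^sup>2 / 2) \<le> real k * (y\<^sup>2 / 2)"
      using assms(3) by (intro mult_right_mono) auto
    ultimately show ?thesis
      by (simp add: y_def algebra_simps power2_eq_square)
  qed
  finally show ?thesis .
qed

section \<open>Enumerative coding of words with many ones\<close>

fun rank :: "bool list \<Rightarrow> nat \<Rightarrow> nat" where
  "rank [] t = 0"
| "rank (b # xs) t = (if b then tails (length xs) t + rank xs (t - 1) else rank xs t)"

fun unrank :: "nat \<Rightarrow> nat \<Rightarrow> nat \<Rightarrow> bool list" where
  "unrank 0 t z = []"
| "unrank (Suc j) t z =
    (if z < tails j t then False # unrank j t z else True # unrank j (t - 1) (z - tails j t))"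

text \<open>In lexicographic order a word with first bit 1 comes after the
  \<open>tails (length xs) t\<close> admissible words with first bit 0, and its remainder needs one
  1 less. So \<open>rank\<close> is the index of a word among those of its length with at least
  \<open>t\<close> ones.\<close>

lemma rank_less: "t \<le> count_list xs True \<Longrightarrow> rank xs t < tails (length xs) t"
  by (induction xs arbitrary: t) (auto simp: trans_less_add1)

lemma unrank_rank: "t \<le> count_list xs True \<Longrightarrow> unrank (length xs) t (rank xs t) = xs"
proof (induction xs arbitrary: t)
  case (Cons b xs)
  then show ?case using rank_less[of t xs] by auto
qed simp

fun nbits :: "nat \<Rightarrow> nat \<Rightarrow> bool list" where
  "nbits 0 v = []"
| "nbits (Suc n) v = odd v # nbits n (v div 2)"

fun num :: "bool list \<Rightarrow> nat" where
  "num [] = 0"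
| "num (b # bs) = of_bool b + 2 * num bs"

lemma length_nbits [simp]: "length (nbits n v) = n"
  by (induction n arbitrary: v) auto

lemma num_nbits: "v < 2 ^ n \<Longrightarrow> num (nbits n v) = v"
proof (induction n arbitrary: v)
  case (Suc n)
  then have "v div 2 < 2 ^ n" by auto
  with Suc.IH[of "v div 2"] show ?case by (auto simp: of_bool_def)
qed simp

lemma nbits_append: "v < 2 ^ a \<Longrightarrow> nbits (a + b) (v + 2 ^ a * u) = nbits a v @ nbits b u"
proof (induction a arbitrary: v)
  case (Suc a)
  then have "v div 2 < 2 ^ a" by auto
  moreover have "(v + 2 ^ Suc a * u) div 2 = v div 2 + 2 ^ a * u" by simp
  ultimately show ?case using Suc.IH[of "v div 2"] by simp
qed simp

lemma nth_nbits: "i < n \<Longrightarrow> nbits n v ! i = odd (v div 2 ^ i)"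
proof (induction n arbitrary: v i)
  case (Suc n)
  then show ?case by (cases i) (auto simp: div_mult2_eq)
qed simp

lemma num_less: "num xs < 2 ^ length xs"
  by (induction xs) auto

text \<open>An upper bound for zeros is a lower bound for ones, so one inequality for both letters
  stands for the two ends of an interval symmetric about half the length.\<close>

definition windows_le :: "nat \<Rightarrow> real \<Rightarrow> bool list \<Rightarrow> bool" where
  "windows_le m h x \<longleftrightarrow> (\<forall>i f. i + m \<le> length x \<longrightarrow> real (count_list (window m x i) f) \<le> h)"

lemma length_window: "i + m \<le> length x \<Longrightarrow> length (window m x i) = m"
  by (simp add: window_def)

lemma windows_le_real_iff:
  "windows_le m ((1/2 + \<epsilon>) * real m) x \<longleftrightarrow> (\<forall>i. i + m \<le> length x \<longrightarrow>
    real (wt (window m x i)) \<in> {(1/2 - \<epsilon>) * real m .. (1/2 + \<epsilon>) * real m})"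
proof -
  have "(\<forall>f. real (count_list (window m x i) f) \<le> (1/2 + \<epsilon>) * real m) \<longleftrightarrow>
      real (wt (window m x i)) \<in> {(1/2 - \<epsilon>) * real m .. (1/2 + \<epsilon>) * real m}"
    if "i + m \<le> length x" for i
  proof -
    have "count_list (window m x i) True + count_list (window m x i) False = m"
      using count_bool_sum[of "window m x i"] length_window[OF that] by simp
    then have "real (count_list (window m x i) False) = real m - real (count_list (window m x i) True)"
      by linarith
    then show ?thesis by (auto simp: all_bool_eq wt_def algebra_simps)
  qed
  then show ?thesis unfolding windows_le_def by blast
qed

section \<open>From the row-by-row sequence to rows and subarrays\<close>

lemma row_window:
  assumes "length A = n\<^sup>2" "i < n" "j + m \<le> n"
  shows "window m (row n A i) j = window m A (i * n + j)" "i * n + j + m \<le> n\<^sup>2"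
proof -
  have "take m (drop j (take n (drop (i * n) A))) = take m (drop (i * n + j) A)"
    using assms(3) by (simp add: drop_take min_def add.commute)
  then show "window m (row n A i) j = window m A (i * n + j)"
    by (simp add: window_def row_def)
  have "(i + 1) * n \<le> n * n" using assms(2) by (intro mult_le_mono1) simp
  with assms(3) show "i * n + j + m \<le> n\<^sup>2" by (simp add: power2_eq_square)
qed

lemma subarray_weight:
  assumes "\<And>i. i < n \<Longrightarrow> real (wt (window m (row n A i) b)) \<in> {lo .. hi}" and "a + k \<le> n"
  shows "real (wt (concat (map (\<lambda>i. window m (row n A i) b) [a..<a + k]))) \<in> {lo * real k .. hi * real k}"
  using assms(2)
proof (induction k)
  case 0
  then show ?case by (simp add: wt_def)
next
  case (Suc k)
  then have "real (wt (concat (map (\<lambda>i. window m (row n A i) b) [a..<a + k]))) \<in> {lo * real k .. hi * real k}"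
    by simp
  moreover have "real (wt (window m (row n A (a + k)) b)) \<in> {lo .. hi}"
    using assms(1)[of "a + k"] Suc.prems by simp
  ultimately show ?case by (auto simp: wt_def algebra_simps)
qed

text \<open>A window of a row is a window of the whole sequence, and a subarray consists of
  \<open>m\<close> such windows, so the interval for \<open>m\<close> bits scales to
  \<open>m^2\<close>.\<close>

lemma windows_le_balanced:
  assumes A: "A \<in> bits (n\<^sup>2)" and "windows_le m ((1/2 + \<epsilon>) * real m) A"
  shows "\<forall>i<n. \<forall>j. j + m \<le> n \<longrightarrow>
      real (wt (window m (row n A i) j)) \<in> {(1/2 - \<epsilon>) * real m .. (1/2 + \<epsilon>) * real m}"
    and "A \<in> Bal_S n m \<epsilon>"
proof -
  have len: "length A = n\<^sup>2" using A by (simp add: bits_def)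
  show *: "\<forall>i<n. \<forall>j. j + m \<le> n \<longrightarrow>
      real (wt (window m (row n A i) j)) \<in> {(1/2 - \<epsilon>) * real m .. (1/2 + \<epsilon>) * real m}"
    using assms(2) row_window[OF len] unfolding windows_le_real_iff by (simp add: len)
  show "A \<in> Bal_S n m \<epsilon>"
    unfolding Bal_S_def subarray_def
  proof (safe intro!: A)
    fix a b assume "a + m \<le> n" "b + m \<le> n"
    then have "real (wt (concat (map (\<lambda>i. window m (row n A i) b) [a..<a + m])))
        \<in> {(1/2 - \<epsilon>) * real m * real m .. (1/2 + \<epsilon>) * real m * real m}"
      using * by (intro subarray_weight[of n]) auto
    then show "real (wt (concat (map (\<lambda>i. window m (row n A i) b) [a..<a + m])))
        \<in> {(1/2 - \<epsilon>) * real (m\<^sup>2) .. (1/2 + \<epsilon>) * real (m\<^sup>2)}"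
      by (simp add: power2_eq_square mult.assoc)
  qed
qed

section \<open>Windows whose length is a sum of shorter lengths\<close>

lemma windows_le_append:
  assumes "windows_le a (r * real a) x" "windows_le b (r * real b) x"
  shows "windows_le (a + b) (r * real (a + b)) x"
  unfolding windows_le_def
proof (intro allI impI)
  fix i f assume i: "i + (a + b) \<le> length x"
  have "window (a + b) x i = window a x i @ window b x (i + a)"
    by (simp add: window_def take_add add.commute)
  moreover have "real (count_list (window a x i) f) \<le> r * real a"
    "real (count_list (window b x (i + a)) f) \<le> r * real b"
    using assms i unfolding windows_le_def by simp_all
  ultimately show "real (count_list (window (a + b) x i) f) \<le> r * real (a + b)"
    by (simp add: algebra_simps)
qed

lemma windows_le_mult:
  assumes "windows_le a (r * real a) x"
  shows "windows_le (k * a) (r * real (k * a)) x"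
proof (induction k)
  case (Suc k)
  then show ?case using windows_le_append[OF assms Suc] by simp
qed (simp add: windows_le_def window_def)

lemma windows_le_shorter:
  assumes "windows_le m h x" "k \<le> m" "m \<le> length x"
  shows "windows_le k h x"
  unfolding windows_le_def
proof (intro allI impI)
  fix i f assume i: "i + k \<le> length x"
  \<comment> \<open>Near the end of \<open>x\<close> the enclosing long window has to start further
    left.\<close>
  define i' where "i' = min i (length x - m)"
  have i': "i' \<le> i" "i' + m \<le> length x" "i - i' + k \<le> m"
    using i assms by (auto simp: i'_def)
  have "window k x i = take k (drop (i - i') (window m x i'))"
    using i' by (simp add: window_def drop_take min_def)
  then have "count_list (window k x i) f \<le> count_list (window m x i') f"
    using count_list_take_drop[of "window m x i'" f "i - i'"]
      count_list_take_drop[of "drop (i - i') (window m x i')" f k] by simp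
  moreover have "real (count_list (window m x i') f) \<le> h"
    using assms(1) i'(2) unfolding windows_le_def by blast
  ultimately show "real (count_list (window k x i) f) \<le> h" by linarith
qed

text \<open>\<open>m\<close> is a sum of \<open>q\<close> summands, each of them \<open>m div q\<close> or \<open>m div q + 1\<close>.\<close>

lemma windows_le_of_div:
  assumes "windows_le (m div q + 1) (r * real (m div q)) x" "0 \<le> r" "0 < q" "m div q + 1 \<le> length x"
  shows "windows_le m (r * real m) x"
proof -
  let ?b = "m div q"
  \<comment> \<open>One threshold serves both lengths: it passes to windows of length
    \<open>b\<close> by inclusion, and for length \<open>b + 1\<close> it is below the proportional
    bound.\<close>
  have b: "windows_le ?b (r * real ?b) x"
    by (rule windows_le_shorter[OF assms(1)]) (use assms in auto)
  have "r * real ?b \<le> r * real (?b + 1)"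
    using assms(2) by (intro mult_left_mono) auto
  with assms(1) have b1: "windows_le (?b + 1) (r * real (?b + 1)) x"
    unfolding windows_le_def by (meson order.trans)
  have "(q - m mod q) * ?b + m mod q * (?b + 1) = q * ?b + m mod q"
    using mod_less_divisor[OF assms(3), of m] by (simp add: diff_mult_distrib)
  then have "m = (q - m mod q) * ?b + m mod q * (?b + 1)" by simp
  then show ?thesis
    using windows_le_append[OF windows_le_mult[OF b, of "q - m mod q"] windows_le_mult[OF b1, of "m mod q"]]
    by simp
qed

section \<open>Counting sequences all of whose windows are balanced\<close>

lemma card_bad_window:
  assumes "s + m \<le> N"
  shows "card {x \<in> bits N. t \<le> count_list (window m x s) f} \<le> 2 ^ (N - m) * tails m t"
proof -
  let ?S = "{x \<in> bits N. t \<le> count_list (window m x s) f}"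
  let ?g = "\<lambda>x. (take s x @ drop (s + m) x, window m x s)"
  have "inj_on ?g ?S"
  proof (rule inj_onI)
    fix x y assume *: "x \<in> ?S" "y \<in> ?S" "?g x = ?g y"
    then have "length x = N" "length y = N" by (auto simp: bits_def)
    with * assms have "take s x = take s y" "drop (s + m) x = drop (s + m) y" "window m x s = window m y s"
      by (auto simp: append_eq_append_conv)
    moreover have "z = take s z @ window m z s @ drop (s + m) z" for z :: "bool list"
      unfolding window_def by (metis append_take_drop_id drop_drop add.commute)
    ultimately show "x = y" by metis
  qed
  moreover have "?g ` ?S \<subseteq> bits (N - m) \<times> {x \<in> bits m. t \<le> count_list x f}"
    using assms by (auto simp: bits_def window_def)
  ultimately have "card ?S \<le> card (bits (N - m) \<times> {x \<in> bits m. t \<le> count_list x f})"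
    by (intro card_inj_on_le) auto
  then show ?thesis by (simp add: card_cartesian_product card_bits card_tails)
qed

text \<open>Union bound over the windows; this settles the small sizes, where no algorithm is needed.\<close>

lemma card_windows_le:
  fixes \<epsilon> :: real
  assumes "0 < \<epsilon>" "n \<ge> 2" "m \<le> n\<^sup>2" "1 \<le> m" "1 / \<epsilon>\<^sup>2 * ln (real (n\<^sup>2)) \<le> real m"
  shows "2 ^ (n\<^sup>2 - 1) \<le> card {x \<in> bits (n\<^sup>2). windows_le m ((1/2 + \<epsilon>) * real m) x}"
proof -
  define N where "N = n\<^sup>2"
  have "2\<^sup>2 \<le> n\<^sup>2" using assms(2) by (intro power_mono) auto
  then have N: "4 \<le> N" by (simp add: N_def)
  define t where "t = nat \<lceil>(1/2 + \<epsilon>) * real m\<rceil>"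
  have t: "(1/2 + \<epsilon>) * real m \<le> real t" unfolding t_def by linarith
  \<comment> \<open>Hoeffding's bound for a full window; the assumption on \<open>m\<close> makes
    its exponent at least \<open>2 * ln N\<close>, so an excess of one letter has probability at
    most \<open>1 / N^2\<close>.\<close>
  have "real (tails m t) \<le> 2 ^ m * exp (- 2 * \<epsilon>\<^sup>2 * real m)"
    by (rule tails_Hoeffding) (use assms t in \<open>auto simp: algebra_simps\<close>)
  also have "\<dots> \<le> 2 ^ m * exp (- 2 * ln (real N))"
    using assms(1,5) by (simp add: N_def field_simps)
  also have "exp (- 2 * ln (real N)) = 1 / (real N)\<^sup>2"
  proof -
    have "exp (- 2 * ln (real N)) = exp (- (ln (real N) + ln (real N)))" by simp
    also have "\<dots> = 1 / (real N)\<^sup>2"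
      using N unfolding exp_minus exp_add by (simp add: power2_eq_square inverse_eq_divide)
    finally show ?thesis .
  qed
  finally have tails: "real (tails m t) \<le> 2 ^ m / (real N)\<^sup>2" by simp
  let ?G = "{x \<in> bits N. windows_le m ((1/2 + \<epsilon>) * real m) x}"
  let ?B = "\<lambda>(s, f). {x \<in> bits N. t \<le> count_list (window m x s) f}"
  let ?I = "{s. s + m \<le> N} \<times> (UNIV :: bool set)"
  have fin: "finite {s. s + m \<le> N}" by (rule finite_subset[of _ "{..N}"]) auto
  have cardI: "card {s. s + m \<le> N} \<le> N"
  proof -
    have "{s. s + m \<le> N} \<subseteq> {..<N}" using assms(4) by auto
    from card_mono[OF _ this] show ?thesis by simp
  qed
  have cover: "bits N \<subseteq> ?G \<union> (\<Union>i\<in>?I. ?B i)"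
  proof
    fix x assume x: "x \<in> bits N"
    show "x \<in> ?G \<union> (\<Union>i\<in>?I. ?B i)"
    proof (cases "windows_le m ((1/2 + \<epsilon>) * real m) x")
      case False
      then obtain s f where "s + m \<le> length x" "(1/2 + \<epsilon>) * real m < real (count_list (window m x s) f)"
        unfolding windows_le_def by (auto simp: not_le)
      moreover from this have "t \<le> count_list (window m x s) f" unfolding t_def by linarith
      ultimately show ?thesis using x by (auto simp: bits_def)
    qed (use x in auto)
  qed
  have finI: "finite ?I" using fin by simp
  have "finite (\<Union>i\<in>?I. ?B i)"
    by (rule finite_UN_I[OF finI]) (simp add: case_prod_unfold)
  then have "finite (?G \<union> (\<Union>i\<in>?I. ?B i))"
    by (intro finite_UnI) simp_all
  from card_mono[OF this cover] have "card (bits N) \<le> card (?G \<union> (\<Union>i\<in>?I. ?B i))" .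
  also have "\<dots> \<le> card ?G + (\<Sum>i\<in>?I. card (?B i))"
    by (rule order.trans[OF card_Un_le add_left_mono[OF card_UN_le[OF finI]]])
  also have "(\<Sum>i\<in>?I. card (?B i)) \<le> (\<Sum>i\<in>?I. 2 ^ (N - m) * tails m t)"
    by (rule sum_mono) (auto simp: card_bad_window)
  also have "\<dots> \<le> N * 2 * (2 ^ (N - m) * tails m t)"
    using cardI by (simp add: card_cartesian_product)
  finally have "2 ^ N \<le> card ?G + N * 2 * (2 ^ (N - m) * tails m t)"
    by (simp add: card_bits)
  then have "real (2 ^ N) \<le> real (card ?G + N * 2 * (2 ^ (N - m) * tails m t))"
    by (simp only: of_nat_le_iff)
  then have 1: "2 ^ N \<le> real (card ?G) + real N * 2 * (2 ^ (N - m) * real (tails m t))"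
    by (simp only: of_nat_add of_nat_mult of_nat_power of_nat_numeral)
  \<comment> \<open>At most \<open>N\<close> windows and two letters lose a fraction
    \<open>2 / N \<le> 1/2\<close> of all sequences. The half that remains is what a single
    redundant bit requires.\<close>
  have "real N * 2 * (2 ^ (N - m) * real (tails m t)) \<le> real N * 2 * (2 ^ (N - m) * (2 ^ m / (real N)\<^sup>2))"
    using tails by (intro mult_left_mono) auto
  also have "\<dots> = 2 * (2 ^ (N - m) * 2 ^ m) / real N"
    using N by (simp add: power2_eq_square)
  also have "(2::real) ^ (N - m) * 2 ^ m = 2 ^ N"
    using assms(3) by (simp add: N_def flip: power_add)
  also have "2 * 2 ^ N / real N \<le> 2 * 2 ^ N / 4"
    using N by (intro divide_left_mono) auto
  finally have "2 ^ N / 2 \<le> real (card ?G)" using 1 by simp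
  moreover have "(2::real) ^ N = 2 * 2 ^ (N - 1)" using N by (cases N) auto
  ultimately have "real (2 ^ (N - 1)) \<le> real (card ?G)" by simp
  then show ?thesis unfolding N_def[symmetric] by (simp only: of_nat_le_iff)
qed

section \<open>Sequence replacement\<close>

lemma count_list_map_eq: "count_list (map (\<lambda>b. b = f) xs) True = count_list xs f"
  by (induction xs) auto

lemma count_list_slide:
  assumes "i + K < length X"
  shows "count_list (take K (drop (Suc i) X)) f + of_bool (X ! i = f) =
    count_list (take K (drop i X)) f + of_bool (X ! (i + K) = f)"
proof -
  have "drop i X = X ! i # drop (Suc i) X"
    using assms by (simp add: Cons_nth_drop_Suc)
  then have "count_list (take (Suc K) (drop i X)) f = count_list (take K (drop (Suc i) X)) f + of_bool (X ! i = f)"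
    by simp
  moreover have "take (Suc K) (drop i X) = take K (drop i X) @ [X ! (i + K)]"
    using assms by (simp add: take_Suc_conv_app_nth)
  ultimately show ?thesis by (simp add: of_bool_def split: if_splits)
qed

text \<open>The virtual prefix: every suffix of it is balanced up to rounding, so the part of a
  window that lies in it can hardly contribute to an excess.\<close>

definition alternating :: "nat \<Rightarrow> bool list" where
  "alternating K = map odd [0..<K]"

lemma length_alternating [simp]: "length (alternating K) = K"
  by (simp add: alternating_def)

lemma drop_alternating: "drop p (alternating K) = map odd [p..<K]"
  by (simp add: alternating_def drop_map)

lemma count_alternating: "count_list (drop p (alternating K)) f \<le> (K - p + 1) div 2"
proof (induction "K - p" arbitrary: p rule: less_induct)
  case less
  consider "K \<le> p" | "K = Suc p" | "Suc p < K" by linarith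
  then show ?case
  proof cases
    case 2
    then show ?thesis by (simp add: drop_alternating)
  next
    case 3
    then have "[p..<K] = p # Suc p # [Suc (Suc p)..<K]" by (simp add: upt_conv_Cons)
    then have "drop p (alternating K) = odd p # odd (Suc p) # drop (Suc (Suc p)) (alternating K)"
      unfolding drop_alternating by simp
    moreover have "(K - p + 1) div 2 = (K - Suc (Suc p) + 1) div 2 + 1" using 3 by linarith
    ultimately show ?thesis
      using less[of "Suc (Suc p)"] 3 by (cases f; cases "odd p") auto
  qed (simp add: alternating_def)
qed

text \<open>\<open>tails_bound\<close> is the counting condition. If \<open>j\<close> bits of a
  window lie in the stack, the virtual prefix supplies at most \<open>(K - j + 1) div 2\<close>
  copies of a letter, so more than \<open>h\<close> copies force many among the \<open>j\<close>
  bits; words like that must be numbered with \<open>L + 3 + g\<close> bits less than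
  \<open>j\<close>. \<open>g_ge_2\<close> excludes padding of a single bit, which would have to mark
  both the start and the end of the padding.\<close>

locale codec =
  fixes N K h L g :: nat
  assumes K_pos: "0 < K"
    and K_le_N: "K \<le> N"
    and N_le: "N \<le> 2 ^ L"
    and g_ge_2: "2 \<le> g"
    and half_le_h: "(K + 1) div 2 \<le> h"
    and h_less_K: "h < K"
    and tails_bound: "\<And>j t. j \<le> K \<Longrightarrow> h + 1 \<le> t + (K - j + 1) div 2 \<Longrightarrow>
      tails j t * 2 ^ (L + 3 + g) \<le> 2 ^ j"
begin

text \<open>The rank saves \<open>gain\<close> bits, of which the position and two flags take \<open>L + 3\<close>.\<close>

abbreviation gain :: nat where "gain \<equiv> L + 3 + g"

abbreviation V :: "bool list" where "V \<equiv> alternating K"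

text \<open>
  \<open>P\<close> is read as if it were preceded by \<open>V\<close>, so that it always ends in a window of length \<open>K\<close>.
\<close>

definition bad :: "bool \<Rightarrow> bool list \<Rightarrow> bool" where
  "bad f P \<longleftrightarrow> h < count_list (drop (length P) (V @ P)) f"

text \<open>The copies of \<open>f\<close> that the stack itself must provide for an excess, after
  those in the virtual part of the window.\<close>

definition need :: "bool \<Rightarrow> nat \<Rightarrow> nat" where
  "need f p = h + 1 - count_list (drop p V) f"

text \<open>Comparing every bit with \<open>f\<close> reduces an excess of zeros to an excess of
  ones.\<close>

definition tail_rank :: "bool \<Rightarrow> bool list \<Rightarrow> nat" where
  "tail_rank f P = rank (map (\<lambda>b. b = f) (drop (length P - K) P)) (need f (length P))"

text \<open>Reversed, so that reading the sequence from its end meets the flag, the letter and the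
  position first; the position determines the length of the rank field. A position may equal
  \<open>2 ^ L\<close>, hence \<open>L + 1\<close> bits. The flag 1 distinguishes a code from the 0
  appended to \<open>x\<close>.\<close>

definition code :: "bool \<Rightarrow> bool list \<Rightarrow> bool list" where
  "code f P = rev (True # f # nbits (L + 1) (length P) @
    nbits (min (length P) K - gain) (tail_rank f P))"

lemma count_window:
  "count_list (drop (length P) (V @ P)) f =
    count_list (drop (length P) V) f + count_list (drop (length P - K) P) f"
  by simp

text \<open>The rank is below the number of words with enough copies of \<open>f\<close>, which
  \<open>tails_bound\<close> limits to \<open>2 ^ (j - gain)\<close> for the \<open>j\<close> bits
  at the end of the stack. If \<open>j < gain\<close> there would be no such word at all.\<close>

lemma tail_rank_bound:
  assumes "bad f P"
  shows "tail_rank f P < 2 ^ (min (length P) K - gain)" and "gain \<le> min (length P) K"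
proof -
  let ?j = "min (length P) K" and ?t = "need f (length P)"
  let ?w = "map (\<lambda>b. b = f) (drop (length P - K) P)"
  have len: "length ?w = ?j" by simp
  have "?t \<le> count_list ?w True"
    using assms unfolding bad_def count_window count_list_map_eq need_def by linarith
  from rank_less[OF this] have r: "tail_rank f P < tails ?j ?t"
    unfolding tail_rank_def len .
  have "K - ?j = K - length P" by (simp add: min_def)
  with count_alternating[of "length P" K f] have "h + 1 \<le> ?t + (K - ?j + 1) div 2"
    unfolding need_def by linarith
  from tails_bound[OF _ this] have *: "tails ?j ?t * 2 ^ gain \<le> 2 ^ ?j" by simp
  show "gain \<le> ?j"
  proof (rule ccontr)
    assume "\<not> gain \<le> ?j"
    then have "(2::nat) ^ ?j < 2 ^ gain" by (intro power_strict_increasing) auto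
    also have "(2::nat) ^ gain \<le> tails ?j ?t * 2 ^ gain" using r by simp
    finally show False using * by simp
  qed
  then have "(2::nat) ^ ?j = 2 ^ (?j - gain) * 2 ^ gain" by (simp flip: power_add)
  with * have "tails ?j ?t \<le> 2 ^ (?j - gain)" by (metis mult_le_cancel2 zero_less_numeral zero_less_power)
  with r show "tail_rank f P < 2 ^ (?j - gain)" by simp
qed

lemma length_code: "bad f P \<Longrightarrow> length (code f P) + g = min (length P) K"
proof -
  assume "bad f P"
  have "length (code f P) = min (length P) K - gain + (L + 3)" by (simp add: code_def)
  with tail_rank_bound(2)[OF \<open>bad f P\<close>] show ?thesis by linarith
qed

lemma tail_of_rank:
  assumes "bad f P"
  shows "map (\<lambda>b. b = f) (unrank (min (length P) K) (need f (length P)) (tail_rank f P)) = drop (length P - K) P"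
proof -
  let ?w = "map (\<lambda>b. b = f) (drop (length P - K) P)"
  have "need f (length P) \<le> count_list ?w True"
    using assms unfolding bad_def count_window count_list_map_eq need_def by linarith
  moreover have len: "length ?w = min (length P) K" by simp
  ultimately have "unrank (min (length P) K) (need f (length P)) (tail_rank f P) = ?w"
    unfolding tail_rank_def using unrank_rank[of "need f (length P)" ?w, unfolded len] by blast
  then show ?thesis by (cases f) (simp_all add: comp_def)
qed

text \<open>The encoder without its program; \<open>r\<close> counts replacements. Pushes keep
  \<open>P @ R\<close> and codes are appended at its end, so the latest code always ends the
  sequence. In \<open>pop\<close> the truncated difference empties a stack of fewer than
  \<open>K\<close> bits.\<close>

inductive reach :: "bool list \<Rightarrow> nat \<Rightarrow> bool list \<Rightarrow> bool list \<Rightarrow> bool" for x where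
  start: "reach x 0 [] (x @ [False])"
| push: "reach x r P (b # R) \<Longrightarrow> (\<And>f. \<not> bad f (P @ [b])) \<Longrightarrow> reach x r (P @ [b]) R"
| pop: "reach x r P (b # R) \<Longrightarrow> bad f (P @ [b]) \<Longrightarrow>
    reach x (Suc r) (take (length (P @ [b]) - K) (P @ [b])) (R @ code f (P @ [b]))"

text \<open>Each replacement saves exactly \<open>g\<close> bits. This bounds their number and is
  the potential that pays for them, in the encoder and in the decoder.\<close>

lemma reach_length: "reach x r P R \<Longrightarrow> length P + length R + g * r = length x + 1"
proof (induction rule: reach.induct)
  case (pop r P b R f)
  have "length (take (length (P @ [b]) - K) (P @ [b])) + min (length (P @ [b])) K = length P + 1"
    by simp
  with pop.IH length_code[OF pop.hyps(2)] show ?case by simp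
qed auto

text \<open>A push creates one new window, which has just passed the test, and a pop returns to a
  prefix of the stack before the push.\<close>

lemma reach_good:
  "reach x r P R \<Longrightarrow> i \<le> length P \<Longrightarrow> count_list (take K (drop i (V @ P))) f \<le> h"
proof (induction arbitrary: i rule: reach.induct)
  case start
  then show ?case using count_alternating[of 0 K f] half_le_h by simp
next
  case (push r P b R)
  show ?case
  proof (cases "i = length (P @ [b])")
    case True
    then show ?thesis using push.hyps(2)[of f] unfolding bad_def by simp
  next
    case False
    then have "i \<le> length P" using push.prems by simp
    moreover from this have "take K (drop i (V @ P @ [b])) = take K (drop i (V @ P))" by simp
    ultimately show ?thesis using push.IH by (simp only: append_assoc)
  qed
next
  case (pop r P b R f')
  define Y where "Y = V @ take (length (P @ [b]) - K) (P @ [b])"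
  define Z where "Z = drop (length (P @ [b]) - K) P"
  have eq: "V @ P = Y @ Z" using K_pos by (simp add: Y_def Z_def)
  have i: "i \<le> length P" "i + K \<le> length Y" using pop.prems K_pos by (auto simp: Y_def)
  have eq': "take K (drop i (V @ P)) = take K (drop i Y)"
    unfolding eq using i(2) by simp
  from pop.IH[OF i(1), unfolded eq', unfolded Y_def] show ?case .
qed

lemma reach_0: "reach x r P R \<Longrightarrow> r = 0 \<Longrightarrow> P @ R = x @ [False]"
  by (induction rule: reach.induct) auto

text \<open>The inverse step. Pushes after the last replacement change only the boundary between
  stack and queue, and only to the right, which is recorded in the last conjunct.\<close>

lemma reach_last:
  assumes "reach x r P R" "0 < r"
  shows "\<exists>P0 b R' f. reach x (r - 1) P0 (b # R') \<and> bad f (P0 @ [b]) \<and>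
    P @ R = take (length (P0 @ [b]) - K) (P0 @ [b]) @ R' @ code f (P0 @ [b]) \<and>
    length (P0 @ [b]) - K \<le> length P"
  using assms
proof (induction rule: reach.induct)
  case (push r P b R)
  then show ?case by fastforce
next
  case (pop r P b R f)
  then show ?case
    by (intro exI[of _ P] exI[of _ b] exI[of _ R] exI[of _ f]) (use K_pos in auto)
qed auto

text \<open>
  The first padding bit differs from the bit \<open>K\<close> places before it and the later ones repeat it,
  so the decoder finds the start of the padding.  The last bit marks that there is padding.
\<close>

definition padded :: "bool list \<Rightarrow> bool list \<Rightarrow> bool" where
  "padded P A \<longleftrightarrow> length A = N \<and> take (length P) A = P \<and>
    (length P < N \<longrightarrow> A ! (N - 1) \<and> (V @ A) ! (K + length P) \<noteq> (V @ A) ! length P \<and>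
      (\<forall>i. length P < i \<and> i < N - 1 \<longrightarrow> (V @ A) ! (K + i) = (V @ A) ! i))"

text \<open>Sliding a window does not change its counts if the bit that enters equals the bit that
  leaves. Only the first padding bit, which breaks the period, and the last one, which is forced to
  1, can add one each; hence \<open>h + 2\<close>.\<close>

lemma padded_windows:
  assumes "padded P A" "length P \<le> N"
    and good: "\<And>i f. i \<le> length P \<Longrightarrow> count_list (take K (drop i (V @ P))) f \<le> h"
  shows "windows_le K (real (h + 2)) A"
proof -
  let ?X = "V @ A"
  let ?c = "\<lambda>i f. count_list (take K (drop i ?X)) f"
  have A: "length A = N" "take (length P) A = P" using assms(1) by (auto simp: padded_def)
  have low: "?c i f \<le> h" if "i \<le> length P" for i f
  proof -
    have "take K (drop i (V @ P)) = take K (drop i (V @ take (length P) A))" by (simp add: A)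
    also have "\<dots> = take K (drop i (take (K + length P) ?X))" by simp
    also have "\<dots> = take K (drop i ?X)" using that by (simp add: drop_take del: drop_append take_append)
    finally show ?thesis using good[OF that, of f] by simp
  qed
  have slide: "?c (Suc i) f + of_bool (?X ! i = f) = ?c i f + of_bool (?X ! (i + K) = f)" if "i < N" for i f
    by (rule count_list_slide) (use that A in simp)
  have mid: "?c i f \<le> h + 1" if "length P \<le> i" "i < N" for i f
    using that
  proof (induction i rule: dec_induct)
    case base
    then show ?case using low[of "length P" f] by simp
  next
    case (step i)
    show ?case
    proof (cases "i = length P")
      case True
      have "of_bool (?X ! (i + K) = f) \<le> (1::nat)" by simp
      with slide[of i f] low[of i f] True step.prems show ?thesis by linarith
    next
      case False
      then have "?X ! (K + i) = ?X ! i"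
        using assms(1) step unfolding padded_def by auto
      with slide[of i f] step show ?thesis by (simp add: add.commute del: drop_append take_append)
    qed
  qed
  have all: "?c i f \<le> h + 2" if "i \<le> N" for i f
  proof -
    consider "i \<le> length P" | "length P < i" "i < N" | "length P < i" "i = N" using \<open>i \<le> N\<close> by linarith
    then show ?thesis
    proof cases
      case 3
      have "of_bool (?X ! (N - 1 + K) = f) \<le> (1::nat)" by simp
      moreover have "?c (N - 1) f \<le> h + 1" using 3 by (intro mid) auto
      moreover have "Suc (N - 1) = N" using 3 by simp
      ultimately show ?thesis using slide[of "N - 1" f] 3 by (simp del: drop_append take_append)
    qed (use low[of i f] mid[of i f] in simp_all)
  qed
  show ?thesis
    unfolding windows_le_def
  proof (intro allI impI)
    fix i f assume "i + K \<le> length A"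
    then have "?c (K + i) f \<le> h + 2" using A by (intro all) simp
    then show "real (count_list (window K A i) f) \<le> real (h + 2)" by (simp add: window_def)
  qed
qed

definition encodes :: "bool list \<Rightarrow> bool list \<Rightarrow> bool" where
  "encodes x A \<longleftrightarrow> (\<exists>r P. reach x r P [] \<and> padded P A)"

lemma encodes_windows:
  assumes "encodes x A" "length x + 1 = N"
  shows "length A = N" "windows_le K (real (h + 2)) A"
proof -
  obtain r P where *: "reach x r P []" "padded P A" using assms unfolding encodes_def by blast
  show "length A = N" using *(2) by (simp add: padded_def)
  show "windows_le K (real (h + 2)) A"
    by (rule padded_windows[OF *(2)]) (use reach_length[OF *(1)] reach_good[OF *(1)] assms(2) in auto)
qed

end

section \<open>The common preparation\<close>

abbreviation (input) plus_expr (infixl "\<oplus>" 65) where "a \<oplus> b \<equiv> Op Plus a b"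
abbreviation (input) minus_expr (infixl "\<ominus>" 65) where "a \<ominus> b \<equiv> Op Minus a b"
abbreviation (input) times_expr (infixl "\<otimes>" 70) where "a \<otimes> b \<equiv> Op Times a b"
abbreviation (input) div_expr (infixl "\<oslash>" 70) where "a \<oslash> b \<equiv> Op Div a b"
abbreviation (input) less_expr (infix "\<lessdot>" 60) where "a \<lessdot> b \<equiv> Op Less a b"
abbreviation (input) equal_expr (infix "\<doteq>" 60) where "a \<doteq> b \<equiv> Op Equal a b"
abbreviation (input) assign (infix "::=" 55) where "x ::= e \<equiv> Assign x e"
abbreviation (input) seq (infixr ";;" 53) where "c ;; d \<equiv> Seq c d"

text \<open>Except for loops the preconditions are equations; as rewrite rules they execute programs
  symbolically, credits included.\<close>

lemma wp_Skip_iff: "wp w Skip Q s a \<longleftrightarrow> 1 \<le> a \<and> Q s (a - 1)"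
  unfolding wp_def
proof
  assume "\<exists>t s'. exec w Skip s t s' \<and> t \<le> a \<and> Q s' (a - t)"
  then show "1 \<le> a \<and> Q s (a - 1)" by (auto elim!: exec_elims(1))
qed (use exec.Skip[of w s] in blast)

lemma wp_Assign_iff:
  "wp w (Assign x e) Q s a \<longleftrightarrow>
    1 + cost e \<le> a \<and> Q (s\<lparr>scal := (scal s)(x := val w e s)\<rparr>) (a - (1 + cost e))"
  unfolding wp_def
proof
  assume "\<exists>t s'. exec w (x ::= e) s t s' \<and> t \<le> a \<and> Q s' (a - t)"
  then show "1 + cost e \<le> a \<and> Q (s\<lparr>scal := (scal s)(x := val w e s)\<rparr>) (a - (1 + cost e))"
    by (auto elim!: exec_elims(2))
qed (use exec.Assign[of w x e s] in blast)

lemma wp_Store_iff: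
  "wp w (Store x e1 e2) Q s a \<longleftrightarrow> 1 + cost e1 + cost e2 \<le> a \<and>
    Q (s\<lparr>arr := (arr s)(x := (arr s x)(val w e1 s := val w e2 s))\<rparr>) (a - (1 + cost e1 + cost e2))"
  unfolding wp_def
proof
  assume "\<exists>t s'. exec w (Store x e1 e2) s t s' \<and> t \<le> a \<and> Q s' (a - t)"
  then show "1 + cost e1 + cost e2 \<le> a \<and>
    Q (s\<lparr>arr := (arr s)(x := (arr s x)(val w e1 s := val w e2 s))\<rparr>) (a - (1 + cost e1 + cost e2))"
    by (auto elim!: exec_elims(3))
qed (use exec.Store[of w x e1 e2 s] in blast)

lemma wp_Seq_iff: "wp w (Seq c1 c2) Q s a \<longleftrightarrow> wp w c1 (wp w c2 Q) s a"
proof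
  assume "wp w (Seq c1 c2) Q s a"
  then obtain t s' where "exec w (Seq c1 c2) s t s'" "t \<le> a" "Q s' (a - t)"
    unfolding wp_def by blast
  then obtain t1 r t2 where "t = t1 + t2" "exec w c1 s t1 r" "exec w c2 r t2 s'"
    by (elim exec_elims(4)) simp
  with \<open>t \<le> a\<close> \<open>Q s' (a - t)\<close> show "wp w c1 (wp w c2 Q) s a"
    unfolding wp_def
    by (intro exI[of _ t1] exI[of _ r] conjI exI[of _ t2] exI[of _ s']) auto
qed (rule wp_Seq)

lemma wp_If_iff:
  "wp w (If e c1 c2) Q s a \<longleftrightarrow> 1 + cost e \<le> a \<and>
    (if val w e s \<noteq> 0 then wp w c1 Q s (a - (1 + cost e)) else wp w c2 Q s (a - (1 + cost e)))"
proof
  assume "wp w (If e c1 c2) Q s a"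
  then obtain t s' where *: "exec w (If e c1 c2) s t s'" "t \<le> a" "Q s' (a - t)"
    unfolding wp_def by blast
  obtain t' where "t = 1 + cost e + t'" "exec w (if val w e s \<noteq> 0 then c1 else c2) s t' s'"
    by (rule exec_elims(5)[OF *(1)]) (auto split: if_splits)
  with *(2,3) show "1 + cost e \<le> a \<and>
    (if val w e s \<noteq> 0 then wp w c1 Q s (a - (1 + cost e)) else wp w c2 Q s (a - (1 + cost e)))"
    unfolding wp_def by (auto intro!: exI[of _ t'] exI[of _ s'] split: if_splits)
qed (auto intro!: wp_If split: if_splits)

declare One_nat_def [simp del] add_2_eq_Suc [simp del] add_2_eq_Suc' [simp del]

lemma less_add_one_iff: "(i::nat) < k + 1 \<longleftrightarrow> i < k \<or> i = k"
  by auto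

text \<open>Collects the credits spent so far into one inequality about the original budget.\<close>

lemma numeral_le_diff_iff: "numeral k \<le> a - b \<longleftrightarrow> numeral k + b \<le> (a::nat)"
  using zero_less_numeral[where 'a = nat, of k] by (intro iffI; linarith)

lemmas wp_iffs = numeral_le_diff_iff wp_Skip_iff wp_Assign_iff wp_Store_iff wp_Seq_iff wp_If_iff

definition same :: "vname set \<Rightarrow> vname set \<Rightarrow> state \<Rightarrow> state \<Rightarrow> bool" where
  "same X Y s s' \<longleftrightarrow> (\<forall>x. x \<notin> X \<longrightarrow> scal s' x = scal s x) \<and> (\<forall>y. y \<notin> Y \<longrightarrow> arr s' y = arr s y)"

lemma same_refl: "same X Y s s"
  by (simp add: same_def)

lemma of_bool_mod_exp: "0 < w \<Longrightarrow> (of_bool b :: nat) mod 2 ^ w = of_bool b"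
  by (cases b) auto

section \<open>Binary logarithm, parameters and the table of binomial tails\<close>

definition find_log :: com where
  "find_log =
    (''N'' ::= Var ''n'' \<otimes> Var ''n'') ;; (''B'' ::= Const 1) ;; (''L'' ::= Const 0) ;;
    While (Var ''B'' \<lessdot> Var ''N'') ((''B'' ::= Var ''B'' \<oplus> Var ''B'') ;; (''L'' ::= Var ''L'' \<oplus> Const 1))"

text \<open>The table is stored row by row with \<open>Z\<close> cells per row. Row 0 is a 1
  followed by zeros that the memory already holds.\<close>

definition fill_table :: com where
  "fill_table =
    Store ''T'' (Const 0) (Const 1) ;;
    (''i'' ::= Var ''Z'') ;;
    While (Var ''i'' \<lessdot> (Var ''K'' \<oplus> Const 1) \<otimes> Var ''Z'')
      (If (Op Mod (Var ''i'') (Var ''Z''))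
        (Store ''T'' (Var ''i'') (Get ''T'' (Var ''i'' \<ominus> Var ''Z'') \<oplus> Get ''T'' (Var ''i'' \<ominus> Var ''Z'' \<ominus> Const 1)))
        (Store ''T'' (Var ''i'') (Get ''T'' (Var ''i'' \<ominus> Var ''Z'') \<oplus> Get ''T'' (Var ''i'' \<ominus> Var ''Z''))) ;;
      (''i'' ::= Var ''i'' \<oplus> Const 1))"

text \<open>\<open>al * L div be\<close> is the target length; dividing \<open>m\<close> by it gives
  the number of summands, and dividing \<open>m\<close> by that number their actual length. The 2
  taken off \<open>h\<close> is returned by the two irregular padding bits, see
  \<open>padded_windows\<close>.\<close>

definition prepare :: "nat \<Rightarrow> nat \<Rightarrow> nat \<Rightarrow> nat \<Rightarrow> com" where
  "prepare al be u v =
    find_log ;;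
    (''K'' ::= Var ''m'' \<oslash> (Var ''m'' \<oslash> (Const al \<otimes> Var ''L'' \<oslash> Const be)) \<oplus> Const 1) ;;
    (''h'' ::= Const u \<otimes> (Var ''K'' \<ominus> Const 1) \<oslash> Const v \<ominus> Const 2) ;;
    (''g'' ::= Var ''L'' \<oslash> Const 8 \<oplus> Const 2) ;;
    (''Z'' ::= Var ''K'' \<oplus> Const 2) ;;
    fill_table"

text \<open>
  \<open>al / be\<close> and \<open>u / v\<close> approximate \<open>ln 2 / \<epsilon>\<^sup>2\<close> and \<open>1/2 + \<epsilon>\<close> from below; \<open>X\<close> is the number of steps that
  each of the \<open>g\<close> bits saved by a replacement pays for.
\<close>

locale machine = codec +
  fixes w n m al be u v X :: nat
  assumes w_pos: "0 < w"
    and N_def: "N = n * n"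
    and m_pos: "0 < m"
    and L_pos: "0 < L"
    and L_least: "2 ^ (L - 1) < N"
    and K_def: "K = m div (m div (al * L div be)) + 1"
    and h_def: "h = u * (K - 1) div v - 2"
    and g_def: "g = L div 8 + 2"
    and K_le: "400 * K \<le> X * g"
    and KK_le: "(K + 1) * (K + 2) \<le> 10 * N"
    and const_bounds: "al < 2 ^ w" "be < 2 ^ w" "u < 2 ^ w" "v < 2 ^ w"
    and prods: "al * L < 2 ^ w" "u * K < 2 ^ w" "m < 2 ^ w"
    and word_N: "4 * N + N * K + 4 * K + 16 < 2 ^ w"
    and word_K: "(K + 1) * (K + 2) + K + 2 < 2 ^ w"
    and word_T: "4 * 2 ^ K < (2::nat) ^ w"
begin

definition env :: "state \<Rightarrow> bool" where
  "env s \<longleftrightarrow> scal s ''n'' = n \<and> scal s ''N'' = N \<and> scal s ''B'' = 2 ^ L \<and> scal s ''L'' = L \<and>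
    scal s ''K'' = K \<and> scal s ''h'' = h \<and> scal s ''g'' = g \<and> scal s ''Z'' = K + 2 \<and>
    (\<forall>j\<le>K. \<forall>t\<le>K + 1. arr s ''T'' (j * (K + 2) + t) = tails j t)"

lemma env_same:
  assumes "same A B s s'" "env s" "''n'' \<notin> A" "''N'' \<notin> A" "''B'' \<notin> A" "''L'' \<notin> A"
    "''K'' \<notin> A" "''h'' \<notin> A" "''g'' \<notin> A" "''Z'' \<notin> A" "''T'' \<notin> B"
  shows "env s'"
  using assms unfolding env_def same_def by metis

lemma word_2: "2 < (2::nat) ^ w" and word_8: "8 < (2::nat) ^ w"
  using word_N by auto

lemma L_le: "L \<le> N"
proof -
  have "L - 1 < 2 ^ (L - 1)" by (rule less_exp)
  with L_least L_pos show ?thesis by linarith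
qed

text \<open>One row back keeps \<open>t\<close> and lowers \<open>j\<close>; one cell further lowers
  \<open>t\<close>, except at the start of a row, where the truncated \<open>t - 1\<close> is
  \<open>t\<close> again.\<close>

lemma tails_step:
  assumes "i < (K + 1) * (K + 2)" "K + 2 \<le> i"
  shows "tails (i div (K + 2)) (i mod (K + 2)) =
    tails ((i - (K + 2)) div (K + 2)) ((i - (K + 2)) mod (K + 2)) +
    (if i mod (K + 2) = 0 then tails ((i - (K + 2)) div (K + 2)) ((i - (K + 2)) mod (K + 2))
     else tails ((i - (K + 2) - 1) div (K + 2)) ((i - (K + 2) - 1) mod (K + 2)))"
proof -
  define Z where "Z = K + 2"
  define j where "j = (i - Z) div Z"
  define t where "t = i mod Z"
  have "0 < Z" by (simp add: Z_def)
  have d: "i div Z = Suc j"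
    using assms le_div_geq[of Z i] \<open>0 < Z\<close> by (simp add: j_def Z_def)
  have t: "(i - Z) mod Z = t" "t < Z"
    using assms le_mod_geq[of Z i] \<open>0 < Z\<close> by (simp_all add: t_def Z_def)
  have i: "i - Z = j * Z + t" using t(1) by (metis div_mult_mod_eq j_def)
  have "(i - Z - 1) div Z = j \<and> (i - Z - 1) mod Z = t - 1" if "t \<noteq> 0"
  proof -
    have "i - Z - 1 = j * Z + (t - 1)" using i that by simp
    then show ?thesis using t(2) \<open>0 < Z\<close> by simp
  qed
  then show ?thesis
    using d t unfolding Z_def[symmetric] t_def[symmetric] j_def[symmetric] by auto
qed

lemma wp_find_log:
  assumes s: "scal s ''n'' = n"
    and a: "12 * N + 20 \<le> a"
    and Q: "\<And>s' a'. same {''N'', ''B'', ''L''} {} s s' \<Longrightarrow> scal s' ''N'' = N \<Longrightarrow> scal s' ''B'' = 2 ^ L \<Longrightarrow>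
      scal s' ''L'' = L \<Longrightarrow> a \<le> a' + (12 * N + 20) \<Longrightarrow> Q s' a'"
  shows "wp w find_log Q s a"
proof -
  note [simp] = of_bool_mod_exp[OF w_pos] wp_iffs
  note word = word_N word_2 w_pos
  have two: "N \<le> 2 ^ L" "2 ^ L < 2 * N"
    using N_le L_least L_pos by (simp_all add: power_eq_if)
  have nn: "n * n < 2 ^ w" using word_N N_def by linarith
  define I where "I = (\<lambda>s' a'. same {''N'', ''B'', ''L''} {} s s' \<and> scal s' ''N'' = N \<and>
    (\<exists>l\<le>L. scal s' ''L'' = l \<and> scal s' ''B'' = 2 ^ l \<and> a \<le> a' + 12 * l + 10))"
  let ?b = "(''B'' ::= Var ''B'' \<oplus> Var ''B'') ;; (''L'' ::= Var ''L'' \<oplus> Const 1)"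
  have "wp w (While (Var ''B'' \<lessdot> Var ''N'') ?b) Q s' a'" if "I s' a'" for s' a'
    using that
  proof (rule wp_While)
    fix s' a' assume I: "I s' a'" and c: "val w (Var ''B'' \<lessdot> Var ''N'') s' \<noteq> 0"
    then obtain l where l: "scal s' ''L'' = l" "scal s' ''B'' = 2 ^ l" "l \<le> L" "scal s' ''N'' = N"
       "same {''N'', ''B'', ''L''} {} s s'" "a \<le> a' + 12 * l + 10" unfolding I_def by blast
    have "(2::nat) ^ l < N" using c l by (simp split: if_splits)
    with two l(3) have "l < L" by (cases "l = L") auto
    have b: "2 ^ l + 2 ^ l < (2::nat) ^ w" "l + 1 < 2 ^ w"
      using \<open>2 ^ l < N\<close> word_N \<open>l < L\<close> L_le by linarith+
    have [simp]: "2 ^ l + 2 ^ l = (2::nat) ^ (l + 1)" by (metis Suc_eq_plus1 mult_2 power_Suc)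
    have "12 * (l + 1) \<le> 12 * N" using \<open>l < L\<close> L_le by simp
    then have "20 \<le> a'" using l(6) a by simp
    then show "1 + cost (Var ''B'' \<lessdot> Var ''N'') \<le> a' \<and> wp w ?b I s' (a' - (1 + cost (Var ''B'' \<lessdot> Var ''N'')))"
      using b word l \<open>l < L\<close> unfolding I_def by (simp add: same_def)
  next
    fix s' a' assume I: "I s' a'" and c: "val w (Var ''B'' \<lessdot> Var ''N'') s' = 0"
    then obtain l where l: "scal s' ''L'' = l" "scal s' ''B'' = 2 ^ l" "l \<le> L" "scal s' ''N'' = N"
       "same {''N'', ''B'', ''L''} {} s s'" "a \<le> a' + 12 * l + 10" unfolding I_def by blast
    have "N \<le> 2 ^ l" using c l by (simp split: if_splits)
    then have "\<not> l \<le> L - 1" using L_least power_increasing[of l "L - 1" "2::nat"] by linarith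
    then have "l = L" using l by simp
    moreover have "12 * L \<le> 12 * N" using L_le by simp
    ultimately show "1 + cost (Var ''B'' \<lessdot> Var ''N'') \<le> a' \<and> Q s' (a' - (1 + cost (Var ''B'' \<lessdot> Var ''N'')))"
      using l a by (auto intro!: Q)
  qed
  moreover have "I (s\<lparr>scal := (scal s)(''N'' := N, ''B'' := 1, ''L'' := 0)\<rparr>) (a - 8)"
    unfolding I_def same_def using a by simp
  ultimately show ?thesis
    unfolding find_log_def using a word nn by (simp add: s N_def)
qed

lemma wp_fill_table:
  assumes s: "scal s ''K'' = K" "scal s ''Z'' = K + 2" "\<And>i. arr s ''T'' i = 0"
    and a: "40 * ((K + 1) * (K + 2)) + 30 \<le> a"
    and Q: "\<And>s' a'. same {''i''} {''T''} s s' \<Longrightarrow>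
      (\<And>j t. j \<le> K \<Longrightarrow> t \<le> K + 1 \<Longrightarrow> arr s' ''T'' (j * (K + 2) + t) = tails j t) \<Longrightarrow>
      a \<le> a' + (40 * ((K + 1) * (K + 2)) + 30) \<Longrightarrow> Q s' a'"
  shows "wp w fill_table Q s a"
proof -
  note [simp] = of_bool_mod_exp[OF w_pos] wp_iffs
  note word = word_K word_2 w_pos
  define Z where "Z = K + 2"
  define M where "M = (K + 1) * Z"
  have M: "M + K + 2 < 2 ^ w" using word_K by (simp add: M_def Z_def)
  define T where "T = (\<lambda>q. tails (q div Z) (q mod Z))"
  \<comment> \<open>With \<open>word_T\<close> this excludes overflow in the additions of the
    table.\<close>
  have Tbound: "T q \<le> 2 ^ K" if "q < M" for q
  proof -
    have "q div Z < K + 1" using that by (simp add: M_def less_mult_imp_div_less)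
    then have "(2::nat) ^ (q div Z) \<le> 2 ^ K" by (intro power_increasing) auto
    then show ?thesis unfolding T_def using tails_le[of "q div Z" "q mod Z"] by linarith
  qed
  define I where "I = (\<lambda>s' a'. same {''i''} {''T''} s s' \<and>
    (\<exists>i. Z \<le> i \<and> i \<le> M \<and> scal s' ''i'' = i \<and> (\<forall>q<i. arr s' ''T'' q = T q) \<and> a \<le> a' + 40 * i + 10))"
  let ?e = "Var ''i'' \<lessdot> (Var ''K'' \<oplus> Const 1) \<otimes> Var ''Z''"
  let ?b = "If (Op Mod (Var ''i'') (Var ''Z''))
        (Store ''T'' (Var ''i'') (Get ''T'' (Var ''i'' \<ominus> Var ''Z'') \<oplus> Get ''T'' (Var ''i'' \<ominus> Var ''Z'' \<ominus> Const 1)))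
        (Store ''T'' (Var ''i'') (Get ''T'' (Var ''i'' \<ominus> Var ''Z'') \<oplus> Get ''T'' (Var ''i'' \<ominus> Var ''Z''))) ;;
      (''i'' ::= Var ''i'' \<oplus> Const 1)"
  have e: "val w ?e s' = of_bool (scal s' ''i'' < M)" if "same {''i''} {''T''} s s'" for s'
  proof -
    have "K + 1 < 2 ^ w" using M by simp
    moreover have "(K + 1) * Z < 2 ^ w" using M by (simp add: M_def)
    ultimately show ?thesis using that s word unfolding same_def by (simp add: M_def Z_def)
  qed
  have "wp w (While ?e ?b) Q s' a'" if "I s' a'" for s' a'
    using that
  proof (rule wp_While)
    fix s' a' assume I: "I s' a'" and c: "val w ?e s' \<noteq> 0"
    then obtain i where i: "same {''i''} {''T''} s s'" "Z \<le> i" "i \<le> M" "scal s' ''i'' = i"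
       "\<forall>q<i. arr s' ''T'' q = T q" "a \<le> a' + 40 * i + 10" unfolding I_def by blast
    have lt: "i < M" using c i(4) unfolding e[OF i(1)] by simp
    have Z: "0 < Z" "scal s' ''Z'' = Z" using s i(1) by (simp_all add: Z_def same_def)
    have r: "T i = T (i - Z) + (if i mod Z = 0 then T (i - Z) else T (i - Z - 1))"
      using tails_step[of i] lt i(2) unfolding T_def M_def Z_def by simp
    have "T (i - Z) \<le> 2 ^ K" "T (i - Z - 1) \<le> 2 ^ K"
      by (rule Tbound; use lt in linarith)+
    then have ub: "T (i - Z) + T (i - Z) < 2 ^ w" "T (i - Z) + T (i - Z - 1) < 2 ^ w"
      using word_T by linarith+
    have vals: "arr s' ''T'' (i - Z) = T (i - Z)" "arr s' ''T'' (i - Z - 1) = T (i - Z - 1)"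
      using i(2,5) Z by simp_all
    have iw: "i < 2 ^ w" "i + 1 < 2 ^ w" "i mod Z < 2 ^ w" "i - Z < 2 ^ w" "i - Z - 1 < 2 ^ w"
      using M lt mod_less_eq_dividend[of i Z] by linarith+
    have "40 * i + 40 \<le> 40 * M" using lt by simp
    then have a': "50 \<le> a'" using i(6) a unfolding M_def Z_def by linarith
    have same': "same {''i''} {''T''} s (s'\<lparr>arr := (arr s')(''T'' := A), scal := (scal s')(''i'' := i + 1)\<rparr>)" for A
      using i(1) unfolding same_def by simp
    show "1 + cost ?e \<le> a' \<and> wp w ?b I s' (a' - (1 + cost ?e))"
      using a' i(2,4,5,6) Z iw ub vals word r lt unfolding I_def
      by (auto simp: less_add_one_iff same')
  next
    fix s' a' assume I: "I s' a'" and c: "val w ?e s' = 0"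
    then obtain i where i: "same {''i''} {''T''} s s'" "Z \<le> i" "i \<le> M" "scal s' ''i'' = i"
       "\<forall>q<i. arr s' ''T'' q = T q" "a \<le> a' + 40 * i + 10" unfolding I_def by blast
    then have "i = M" using c unfolding e[OF i(1)] by simp
    have "arr s' ''T'' (j * (K + 2) + t) = tails j t" if "j \<le> K" "t \<le> K + 1" for j t
    proof -
      have "j * Z \<le> K * Z" using that by (intro mult_le_mono1)
      moreover have "M = K * Z + Z" by (simp add: M_def add_mult_distrib)
      moreover have "t < Z" using that by (simp add: Z_def)
      ultimately have "j * Z + t < M" by linarith
      moreover have "T (j * Z + t) = tails j t" using that by (simp add: T_def Z_def)
      ultimately show ?thesis using i(5) \<open>i = M\<close> by (simp add: Z_def)
    qed
    moreover have "20 \<le> a'" "a \<le> a' - (1 + cost ?e) + (40 * ((K + 1) * (K + 2)) + 30)"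
      using i(6) a unfolding \<open>i = M\<close> M_def Z_def cost.simps by linarith+
    ultimately show "1 + cost ?e \<le> a' \<and> Q s' (a' - (1 + cost ?e))"
      using i(1) by (auto intro!: Q)
  qed
  moreover have "I (s\<lparr>arr := (arr s)(''T'' := (arr s ''T'')(0 := 1)), scal := (scal s)(''i'' := K + 2)\<rparr>) (a - 5)"
    unfolding I_def same_def using a s(3) by (auto simp: T_def Z_def M_def)
  ultimately show ?thesis
    unfolding fill_table_def using a word by (simp add: s)
qed

text \<open>The table dominates: \<open>KK_le\<close> allows at most \<open>10 * N\<close> cells of
  40 credits each. The logarithm loop and the assignments are covered by the remaining room in
  \<open>1000 * N\<close>.\<close>

lemma wp_prepare:
  assumes s: "scal s ''n'' = n" "scal s ''m'' = m" "\<And>i. arr s ''T'' i = 0"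
    and a: "1000 * N \<le> a"
    and Q: "\<And>s' a'. env s' \<Longrightarrow> same {''N'', ''B'', ''L'', ''K'', ''h'', ''g'', ''Z'', ''i''} {''T''} s s' \<Longrightarrow>
      a \<le> a' + 1000 * N \<Longrightarrow> Q s' a'"
  shows "wp w (prepare al be u v) Q s a"
proof -
  note [simp] = of_bool_mod_exp[OF w_pos] wp_iffs
  note word = word_N word_2 word_8 w_pos
  have N1: "1 \<le> N" using L_least by linarith
  have uK: "u * (K - 1) \<le> u * K" by simp
  have lt: "al * L < 2 ^ w" "m div (m div (al * L div be)) < 2 ^ w" "m div (m div (al * L div be)) + 1 < 2 ^ w"
    "K - 1 < 2 ^ w" "u * (K - 1) < 2 ^ w" "u * (K - 1) div v < 2 ^ w" "u * (K - 1) div v - 2 < 2 ^ w"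
    "al * L div be < 2 ^ w" "m div (al * L div be) < 2 ^ w" "L div 8 < 2 ^ w" "L div 8 + 2 < 2 ^ w" "K + 2 < 2 ^ w"
    using prods uK word_N K_def L_le div_le_dividend[of m "m div (al * L div be)"]
      div_le_dividend[of "u * (K - 1)" v] div_le_dividend[of "al * L" be]
      div_le_dividend[of m "al * L div be"] div_le_dividend[of L 8] by linarith+
  show ?thesis
    unfolding prepare_def
    apply (simp only: wp_Seq_iff)
    apply (rule wp_find_log[OF s(1)])
    subgoal using a N1 by linarith
    subgoal for s' a'
    proof -
      assume *: "same {''N'', ''B'', ''L''} {} s s'" "scal s' ''N'' = N" "scal s' ''B'' = 2 ^ L"
        "scal s' ''L'' = L" "a \<le> a' + (12 * N + 20)"
      have m: "scal s' ''m'' = m" using *(1) s(2) by (simp add: same_def)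
      define s1 where "s1 = s'\<lparr>scal := (scal s')(''K'' := K, ''h'' := h, ''g'' := g, ''Z'' := K + 2)\<rparr>"
      have "wp w fill_table Q s1 (a' - 32)"
      proof (rule wp_fill_table)
        fix s2 a2 assume 2: "same {''i''} {''T''} s1 s2"
          "\<And>j t. j \<le> K \<Longrightarrow> t \<le> K + 1 \<Longrightarrow> arr s2 ''T'' (j * (K + 2) + t) = tails j t"
          "a' - 32 \<le> a2 + (40 * ((K + 1) * (K + 2)) + 30)"
        show "Q s2 a2"
        proof (rule Q)
          show "env s2" using 2(1,2) * s(1) unfolding env_def by (simp add: same_def s1_def)
          show "same {''N'', ''B'', ''L'', ''K'', ''h'', ''g'', ''Z'', ''i''} {''T''} s s2"
            using 2(1) *(1) unfolding same_def s1_def by simp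
          show "a \<le> a2 + 1000 * N" using 2(3) *(5) KK_le N1 a by linarith
        qed
      qed (use *(1,5) s(3) KK_le N1 a in \<open>simp_all add: s1_def same_def\<close>)
      moreover have "32 \<le> a'" using *(5) N1 a by linarith
      moreover have "m div (m div (al * L div be)) + 1 = K" by (subst K_def) simp
      ultimately show ?thesis
        using * lt word const_bounds m unfolding s1_def by (simp add: h_def[symmetric] g_def)
    qed
    done
qed

end

section \<open>The encoder\<close>

text \<open>The tested window occupies the indices from \<open>p = c - K\<close> to
  \<open>c - 1\<close> of the virtual prefix followed by the stack. Indices below \<open>K\<close>
  are virtual: such bits lower the threshold \<open>t\<close> but add nothing to the rank, so
  \<open>t\<close> equals \<open>need\<close> when the first real bit is reached.\<close>

definition rank_com :: com where
  "rank_com =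
    (''t'' ::= Var ''h'' \<oplus> Const 1) ;; (''z'' ::= Const 0) ;; (''i'' ::= Var ''p'') ;;
    While (Var ''i'' \<lessdot> Var ''c'')
      ((''d'' ::= Get ''P'' (Var ''i'' \<oplus> Const 1) \<ominus> Get ''P'' (Var ''i'') \<doteq> Var ''f'') ;;
      If (Var ''d'')
        (If (Var ''i'' \<lessdot> Var ''K'') Skip
          (''z'' ::= Var ''z'' \<oplus> Get ''T'' ((Var ''c'' \<ominus> Const 1 \<ominus> Var ''i'') \<otimes> Var ''Z'' \<oplus> Var ''t'')) ;;
        (''t'' ::= Var ''t'' \<ominus> Const 1))
        Skip ;;
      (''i'' ::= Var ''i'' \<oplus> Const 1))"

text \<open>The lowest bit of \<open>z\<close>, the flag, must be the last bit of the queue, so the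
  cells are written downwards from the new end.\<close>

definition write_com :: com where
  "write_com =
    (''i'' ::= Var ''j'' \<ominus> Var ''g'') ;; (''y'' ::= Var ''e'' \<oplus> Var ''i'') ;; (''e'' ::= Var ''y'') ;;
    While (Const 0 \<lessdot> Var ''i'')
      ((''i'' ::= Var ''i'' \<ominus> Const 1) ;; (''y'' ::= Var ''y'' \<ominus> Const 1) ;;
      Store ''in'' (Var ''y'') (Op Mod (Var ''z'') (Const 2)) ;;
      (''z'' ::= Var ''z'' \<oslash> Const 2))"

text \<open>The stack is stored as prefix sums: the weight of its last window is one subtraction, a
  bit is the difference of neighbours, and a pop only lowers \<open>c\<close>.\<close>

definition psum :: "state \<Rightarrow> bool list \<Rightarrow> bool" where
  "psum s x \<longleftrightarrow> (\<forall>i\<le>length x. arr s ''P'' i = count_list (take i x) True)"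

lemma psum_nth: "psum s x \<Longrightarrow> i < length x \<Longrightarrow> arr s ''P'' (i + 1) - arr s ''P'' i = of_bool (x ! i)"
  unfolding psum_def by (simp add: take_Suc_conv_app_nth flip: Suc_eq_plus1)

lemma psum_le: "psum s x \<Longrightarrow> i \<le> length x \<Longrightarrow> arr s ''P'' i \<le> length x"
  using count_le_length[of "take i x" True] unfolding psum_def by simp

lemma psum_window:
  assumes "psum s x" "i + k = length x"
  shows "arr s ''P'' (length x) - arr s ''P'' i = count_list (drop i x) True"
  using assms count_list_take_drop[of x True i] unfolding psum_def by simp

lemma psum_appendD: "psum s (x @ y) \<Longrightarrow> psum s x"
  unfolding psum_def by (metis append_eq_conv_conj length_append le_add1 le_trans take_all take_append append_Nil2 diff_is_0_eq' take_0)

lemma psum_snoc: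
  assumes "psum s x" "arr s' ''P'' (length x + 1) = arr s ''P'' (length x) + of_bool b"
    "\<And>i. i \<le> length x \<Longrightarrow> arr s' ''P'' i = arr s ''P'' i"
  shows "psum s' (x @ [b])"
  unfolding psum_def
proof (intro allI impI)
  fix i assume "i \<le> length (x @ [b])"
  then consider "i \<le> length x" | "i = length x + 1" by fastforce
  then show "arr s' ''P'' i = count_list (take i (x @ [b])) True"
    using assms unfolding psum_def by cases auto
qed

context machine
begin

text \<open>The sum accumulated in \<open>z\<close> plus the rank of the unread rest is invariant.
  As its value is below \<open>2 ^ K\<close>, no partial sum overflows.\<close>

lemma wp_rank_com:
  assumes env: "env s" and P: "psum s (V @ P)" "length P \<le> N" "bad f P"
    and s: "scal s ''c'' = K + length P" "scal s ''p'' = length P" "scal s ''f'' = of_bool f"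
    and a: "50 * K + 30 \<le> a"
    and Q: "\<And>s' a'. same {''t'', ''z'', ''i'', ''d''} {} s s' \<Longrightarrow> scal s' ''z'' = tail_rank f P \<Longrightarrow>
      a \<le> a' + (50 * K + 30) \<Longrightarrow> Q s' a'"
  shows "wp w rank_com Q s a"
proof -
  note [simp] = of_bool_mod_exp[OF w_pos] wp_iffs
  note word = word_2 w_pos
  define x where "x = V @ P"
  define p where "p = length P"
  \<comment> \<open>\<open>tt i\<close> is the threshold after the window bits before index
    \<open>i\<close>, and \<open>rest i\<close> the rank contributed from \<open>i\<close> on; the
    maximum with \<open>K\<close> skips the virtual bits.\<close>
  define tt where "tt = (\<lambda>i. h + 1 - count_list (take (i - p) (drop p x)) f)"
  define rest where "rest = (\<lambda>i. rank (map (\<lambda>b. b = f) (drop (max i K) x)) (tt (max i K)))"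
  have len: "length x = K + p" by (simp add: x_def p_def)
  have tt_Suc: "tt (i + 1) = tt i - of_bool (x ! i = f)" if "p \<le> i" "i < K + p" for i
  proof -
    have "take (i + 1 - p) (drop p x) = take (i - p) (drop p x) @ [x ! i]"
      using that len by (simp add: take_Suc_conv_app_nth Suc_diff_le flip: Suc_eq_plus1)
    then show ?thesis by (simp add: tt_def)
  qed
  have rest_low: "rest (i + 1) = rest i" if "i < K" for i
    using that by (simp add: rest_def max_def)
  have rest_high: "rest i = of_bool (x ! i = f) * tails (K + p - 1 - i) (tt i) + rest (i + 1)"
    if "p \<le> i" "K \<le> i" "i < K + p" for i
  proof -
    have m: "max i K = i" "max (i + 1) K = i + 1" using that by auto
    have "drop i x = x ! i # drop (i + 1) x"
      using that len by (simp add: Cons_nth_drop_Suc flip: Suc_eq_plus1)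
    then show ?thesis
      unfolding rest_def m tt_Suc[OF that(1,3)] using len that(3) by (simp add: add.commute[of i 1])
  qed
  have rest_init: "rest p = tail_rank f P"
  proof (cases "K \<le> p")
    case True
    then have "drop p x = drop (p - K) P" "need f p = h + 1" by (simp_all add: x_def need_def)
    then show ?thesis using True by (simp add: rest_def tt_def tail_rank_def max_def p_def)
  next
    case False
    then have "take (K - p) (drop p x) = drop p V" by (simp add: x_def)
    then show ?thesis using False by (simp add: rest_def tt_def tail_rank_def max_def p_def need_def x_def)
  qed
  have rest_exit: "rest (K + p) = 0" using len by (simp add: rest_def max_def)
  have "tail_rank f P < 2 ^ K"
    by (rule less_le_trans[OF tail_rank_bound(1)[OF P(3)]]) (intro power_increasing, auto)
  then have rank_w: "tail_rank f P < 2 ^ w" using word_T by linarith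
  let ?e = "Var ''i'' \<lessdot> Var ''c''"
  let ?b = "(''d'' ::= Get ''P'' (Var ''i'' \<oplus> Const 1) \<ominus> Get ''P'' (Var ''i'') \<doteq> Var ''f'') ;;
      If (Var ''d'')
        (If (Var ''i'' \<lessdot> Var ''K'') Skip
          (''z'' ::= Var ''z'' \<oplus> Get ''T'' ((Var ''c'' \<ominus> Const 1 \<ominus> Var ''i'') \<otimes> Var ''Z'' \<oplus> Var ''t'')) ;;
        (''t'' ::= Var ''t'' \<ominus> Const 1))
        Skip ;;
      (''i'' ::= Var ''i'' \<oplus> Const 1)"
  define I where "I = (\<lambda>s' a'. same {''t'', ''z'', ''i'', ''d''} {} s s' \<and>
    (\<exists>i z. p \<le> i \<and> i \<le> K + p \<and> scal s' ''i'' = i \<and> scal s' ''t'' = tt i \<and> scal s' ''z'' = z \<and>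
      z + rest i = tail_rank f P \<and> a + 50 * p \<le> a' + 50 * i + 20))"
  have tt_le: "tt i \<le> K" for i using h_less_K by (simp add: tt_def)
  have "wp w (While ?e ?b) Q s' a'" if "I s' a'" for s' a'
    using that
  proof (rule wp_While)
    fix s' a' assume I: "I s' a'" and c: "val w ?e s' \<noteq> 0"
    then obtain i z where i: "same {''t'', ''z'', ''i'', ''d''} {} s s'" "p \<le> i" "i \<le> K + p" "scal s' ''i'' = i"
      "scal s' ''t'' = tt i" "scal s' ''z'' = z" "z + rest i = tail_rank f P" "a + 50 * p \<le> a' + 50 * i + 20"
      unfolding I_def by blast
    have params': "scal s' ''c'' = K + p" "scal s' ''K'' = K" "scal s' ''Z'' = K + 2" "scal s' ''f'' = of_bool f"
      using i(1) env s unfolding same_def env_def p_def by simp_all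
    have lt: "i < K + p" using c i(4) params' by simp
    have iw: "i + 1 < 2 ^ w" "K + p < 2 ^ w"
      using lt P(2) word_N unfolding p_def by linarith+
    have d: "arr s' ''P'' (i + 1) - arr s' ''P'' i = of_bool (x ! i)"
      using psum_nth[of s' x i] P(1) i(1) lt len unfolding x_def psum_def same_def by simp
    have j: "K + p - 1 - i \<le> K" using i(2) by linarith
    have T: "arr s' ''T'' ((K + p - 1 - i) * (K + 2) + tt i) = tails (K + p - 1 - i) (tt i)"
      using env i(1) j tt_le[of i] unfolding env_def same_def by simp
    have "(K + p - 1 - i) * (K + 2) \<le> K * (K + 2)" using j by (rule mult_le_mono1)
    then have ix: "(K + p - 1 - i) * (K + 2) + tt i < 2 ^ w" "(K + p - 1 - i) * (K + 2) < 2 ^ w"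
      using tt_le[of i] word_K unfolding add_mult_distrib by linarith+
    have "50 * i + 50 \<le> 50 * K + 50 * p" using lt by simp
    then have a': "50 \<le> a'" using i(8) a by linarith
    have z1: "z + tails (K + p - 1 - i) (tt i) < 2 ^ w" if "K \<le> i" "x ! i = f"
      using rest_high[OF i(2) that(1) lt] that(2) i(7) rank_w by simp
    have ixs: "K + p - 1 < 2 ^ w" "K + p - 1 - i < 2 ^ w" "tt i - 1 < 2 ^ w" "tt i < 2 ^ w"
      using iw tt_le[of i] by linarith+
    have eqf: "(of_bool (x ! i) = (of_bool f :: nat)) = (x ! i = f)" by simp
    have tt1: "tt (i + 1) = tt i - of_bool (x ! i = f)" by (rule tt_Suc[OF i(2) lt])
    have r1: "rest i = (if K \<le> i \<and> x ! i = f then tails (K + p - 1 - i) (tt i) else 0) + rest (i + 1)"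
    proof (cases "K \<le> i")
      case True
      show ?thesis by (subst rest_high[OF i(2) True lt]) (simp add: True)
    next
      case False
      then show ?thesis using rest_low[of i] by simp
    qed
    show "1 + cost ?e \<le> a' \<and> wp w ?b I s' (a' - (1 + cost ?e))"
    proof (cases "x ! i = f")
      case True
      then show ?thesis
      proof (cases "K \<le> i")
        case high: True
        have "z + tails (K + p - 1 - i) (tt i) + rest (i + 1) = tail_rank f P"
          using i(7) r1 high True by simp
        then show ?thesis
          using a' i(1-6,8) params' word iw d ix T z1[OF high True] ixs lt True high tt1
          unfolding I_def same_def by (simp add: eqf)
      next
        case False
        then have "z + rest (i + 1) = tail_rank f P" using i(7) r1 by simp
        with False show ?thesis
          using a' i(1-6,8) params' word iw d ixs lt True tt1
          unfolding I_def same_def by (simp add: eqf)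
      qed
    next
      case False
      then have "z + rest (i + 1) = tail_rank f P" using i(7) r1 by simp
      moreover obtain dd ff :: nat where d': "arr s' ''P'' (i + 1) - arr s' ''P'' i = dd"
          "scal s' ''f'' = ff" "dd \<noteq> ff" "dd < 2 ^ w"
        by (rule that[OF d params'(4)]) (use False word in simp_all)
      moreover have "tt (i + 1) = tt i" using tt1 False by simp
      ultimately show ?thesis
        using a' i(1-6,8) params'(1-3) word iw ixs lt unfolding I_def same_def by simp
    qed
  next
    fix s' a' assume I: "I s' a'" and c: "val w ?e s' = 0"
    then obtain i z where i: "same {''t'', ''z'', ''i'', ''d''} {} s s'" "p \<le> i" "i \<le> K + p" "scal s' ''i'' = i"
      "scal s' ''t'' = tt i" "scal s' ''z'' = z" "z + rest i = tail_rank f P" "a + 50 * p \<le> a' + 50 * i + 20"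
      unfolding I_def by blast
    have "scal s' ''c'' = K + p" using i(1) s unfolding same_def p_def by simp
    then have "i = K + p" using c i(3,4) by simp
    moreover have "10 \<le> a'" using i(8) a unfolding \<open>i = K + p\<close> by simp
    ultimately show "1 + cost ?e \<le> a' \<and> Q s' (a' - (1 + cost ?e))"
      using i rest_exit by (auto intro!: Q)
  qed
  moreover have "I (s\<lparr>scal := (scal s)(''t'' := h + 1, ''z'' := 0, ''i'' := p)\<rparr>) (a - 8)"
    unfolding I_def same_def using a rest_init by (simp add: tt_def)
  moreover have "h + 1 < 2 ^ w" using h_less_K word_K by linarith
  moreover have "scal s ''h'' = h" using env by (simp add: env_def)
  ultimately show ?thesis
    unfolding rank_com_def using a word s by (simp add: p_def)
qed

lemma wp_write_com:
  assumes s: "scal s ''j'' - scal s ''g'' = l" "scal s ''e'' = e" "scal s ''z'' = z"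
    and b: "scal s ''j'' < 2 ^ w" "e + l < 2 ^ w" "z < 2 ^ w"
    and a: "30 * l + 30 \<le> a"
    and Q: "\<And>s' a'. same {''i'', ''y'', ''e'', ''z''} {''in''} s s' \<Longrightarrow> scal s' ''e'' = e + l \<Longrightarrow>
      (\<And>q. q < e \<Longrightarrow> arr s' ''in'' q = arr s ''in'' q) \<Longrightarrow>
      (\<And>q. q < l \<Longrightarrow> arr s' ''in'' (e + q) = of_bool (rev (nbits l z) ! q)) \<Longrightarrow>
      a \<le> a' + (30 * l + 30) \<Longrightarrow> Q s' a'"
  shows "wp w write_com Q s a"
proof -
  note [simp] = of_bool_mod_exp[OF w_pos] wp_iffs
  note word = word_2 w_pos
  have lw: "l < 2 ^ w" using b(2) by linarith
  let ?e = "Const 0 \<lessdot> Var ''i''"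
  let ?b = "(''i'' ::= Var ''i'' \<ominus> Const 1) ;; (''y'' ::= Var ''y'' \<ominus> Const 1) ;;
      Store ''in'' (Var ''y'') (Op Mod (Var ''z'') (Const 2)) ;;
      (''z'' ::= Var ''z'' \<oslash> Const 2)"
  define I where "I = (\<lambda>s' a'. same {''i'', ''y'', ''e'', ''z''} {''in''} s s' \<and> scal s' ''e'' = e + l \<and>
    (\<exists>k\<le>l. scal s' ''i'' = k \<and> scal s' ''y'' = e + k \<and> scal s' ''z'' = z div 2 ^ (l - k) \<and>
      (\<forall>q<e. arr s' ''in'' q = arr s ''in'' q) \<and>
      (\<forall>q. k \<le> q \<and> q < l \<longrightarrow> arr s' ''in'' (e + q) = of_bool (odd (z div 2 ^ (l - 1 - q)))) \<and>
      30 * k + 10 \<le> a' \<and> a + 30 * k \<le> a' + 30 * l + 20))"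
  have "wp w (While ?e ?b) Q s' a'" if "I s' a'" for s' a'
    using that
  proof (rule wp_While)
    fix s' a' assume I: "I s' a'" and c: "val w ?e s' \<noteq> 0"
    then obtain k where k: "same {''i'', ''y'', ''e'', ''z''} {''in''} s s'" "scal s' ''e'' = e + l" "k \<le> l"
      "scal s' ''i'' = k" "scal s' ''y'' = e + k" "scal s' ''z'' = z div 2 ^ (l - k)"
      "\<forall>q<e. arr s' ''in'' q = arr s ''in'' q"
      "\<forall>q. k \<le> q \<and> q < l \<longrightarrow> arr s' ''in'' (e + q) = of_bool (odd (z div 2 ^ (l - 1 - q)))"
      "30 * k + 10 \<le> a'" "a + 30 * k \<le> a' + 30 * l + 20"
      unfolding I_def by blast
    have "k \<noteq> 0" using c k(4) by simp
    then obtain r where r: "k = r + 1" by (metis Suc_eq_plus1 not0_implies_Suc)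
    have l: "l - r = (l - (r + 1)) + 1" "l - 1 - r = l - (r + 1)" using k(3) r by linarith+
    define D where "D = z div 2 ^ (l - k)"
    have D2: "D div 2 = z div 2 ^ (l - r)"
      unfolding D_def l(1) r by (simp add: div_mult2_eq power_add)
    have Dw: "D < 2 ^ w" "D div 2 < 2 ^ w"
      using b(3) div_le_dividend[of z "2 ^ (l - k)"] div_le_dividend[of D 2] unfolding D_def by linarith+
    have rw: "r < 2 ^ w" "e + r < 2 ^ w" using k(3) r b(2) by linarith+
    have m2: "D mod 2 = of_bool (odd D)" by (simp add: mod_2_eq_odd)
    have new: "\<forall>q. r \<le> q \<and> q < l \<longrightarrow> (if q = r then of_bool (odd D) else arr s' ''in'' (e + q)) =
        of_bool (odd (z div 2 ^ (l - 1 - q)))"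
    proof (intro allI impI)
      fix q assume q: "r \<le> q \<and> q < l"
      show "(if q = r then of_bool (odd D) else arr s' ''in'' (e + q)) = of_bool (odd (z div 2 ^ (l - 1 - q)))"
      proof (cases "q = r")
        case True
        then show ?thesis unfolding D_def r l(2)[symmetric] by simp
      next
        case False
        with q r have "k \<le> q" by linarith
        then show ?thesis using k(8) q False by simp
      qed
    qed
    have J: "I (s'\<lparr>arr := (arr s')(''in'' := (arr s' ''in'')(e + r := of_bool (odd D))),
        scal := (scal s')(''i'' := r, ''y'' := e + r, ''z'' := D div 2)\<rparr>) (a' - 21)"
      unfolding I_def same_def
    proof (intro conjI exI[of _ r])
      show "30 * r + 10 \<le> a' - 21" "a + 30 * r \<le> a' - 21 + 30 * l + 20" "r \<le> l"
        using k(3,9,10) r by simp_all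
    qed (use k(1,2,7) new D2 in \<open>simp_all add: same_def\<close>)
    have "scal s' ''z'' = D" using k(6) by (simp add: D_def)
    then show "1 + cost ?e \<le> a' \<and> wp w ?b I s' (a' - (1 + cost ?e))"
      using k(4,5,9) word rw Dw J m2 unfolding r by simp
  next
    fix s' a' assume I: "I s' a'" and c: "val w ?e s' = 0"
    then obtain k where k: "same {''i'', ''y'', ''e'', ''z''} {''in''} s s'" "scal s' ''e'' = e + l" "k \<le> l"
      "scal s' ''i'' = k"
      "\<forall>q<e. arr s' ''in'' q = arr s ''in'' q"
      "\<forall>q. k \<le> q \<and> q < l \<longrightarrow> arr s' ''in'' (e + q) = of_bool (odd (z div 2 ^ (l - 1 - q)))"
      "30 * k + 10 \<le> a'" "a + 30 * k \<le> a' + 30 * l + 20"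
      unfolding I_def by blast
    have k0: "k = 0" using c k(4) by (simp split: if_splits)
    have "arr s' ''in'' (e + q) = of_bool (rev (nbits l z) ! q)" if "q < l" for q
    proof -
      have "rev (nbits l z) ! q = nbits l z ! (l - 1 - q)" using that by (simp add: rev_nth Suc_eq_plus1 add.commute[of 1])
      then show ?thesis using k(6) k0 that by (simp add: nth_nbits)
    qed
    then show "1 + cost ?e \<le> a' \<and> Q s' (a' - (1 + cost ?e))"
      using k k0 by (auto intro!: Q)
  qed
  moreover have "I (s\<lparr>scal := (scal s)(''i'' := l, ''y'' := e + l, ''e'' := e + l)\<rparr>) (a - 10)"
    unfolding I_def same_def using a s(3) by simp
  ultimately show ?thesis
    unfolding write_com_def using a word s b lw by simp
qed

end

text \<open>\<open>code\<close> as a single number, lowest bit first: the flag, the letter, the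
  position in \<open>L + 1\<close> bits (\<open>2 * B = 2 ^ (L + 1)\<close>), the rank.\<close>

definition pack_com :: com where
  "pack_com = (''z'' ::= ((Var ''z'' \<otimes> (Const 2 \<otimes> Var ''B'') \<oplus> Var ''p'') \<otimes> Const 2 \<oplus> Var ''f'') \<otimes> Const 2 \<oplus> Const 1)"

definition replace_com :: com where
  "replace_com =
    (''p'' ::= Var ''c'' \<ominus> Var ''K'') ;; rank_com ;; (''j'' ::= Var ''p'') ;;
    If (Var ''K'' \<lessdot> Var ''p'') (''j'' ::= Var ''K'') Skip ;;
    (''c'' ::= Var ''c'' \<ominus> Var ''j'') ;;
    pack_com ;;
    write_com"

definition push_com :: com where
  "push_com =
    Store ''P'' (Var ''c'' \<oplus> Const 1) (Get ''P'' (Var ''c'') \<oplus> Get ''in'' (Var ''a'')) ;;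
    (''c'' ::= Var ''c'' \<oplus> Const 1) ;; (''a'' ::= Var ''a'' \<oplus> Const 1) ;;
    (''d'' ::= Get ''P'' (Var ''c'') \<ominus> Get ''P'' (Var ''c'' \<ominus> Var ''K'')) ;;
    (''f'' ::= (Var ''h'' \<lessdot> Var ''d''))"

text \<open>The sum in the condition is a disjunction. \<open>f\<close> already tells whether ones
  are in excess; if it is 0 and the condition holds, zeros are, so \<open>f\<close> names the letter
  in either case.\<close>

definition compress_com :: com where
  "compress_com = While (Var ''a'' \<lessdot> Var ''e'')
    (push_com ;; If (Var ''f'' \<oplus> (Var ''h'' \<lessdot> Var ''K'' \<ominus> Var ''d'')) replace_com Skip)"

definition pad_com :: com where
  "pad_com = (''y'' ::= Var ''c'') ;;
    While (Var ''c'' \<lessdot> Var ''N'' \<oplus> Var ''K'')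
      ((''d'' ::= Get ''P'' (Var ''c'' \<ominus> Var ''K'' \<oplus> Const 1) \<ominus> Get ''P'' (Var ''c'' \<ominus> Var ''K'')) ;;
      If (Var ''c'' \<doteq> Var ''y'') (''d'' ::= Const 1 \<ominus> Var ''d'') Skip ;;
      If (Var ''c'' \<oplus> Const 1 \<doteq> Var ''N'' \<oplus> Var ''K'') (''d'' ::= Const 1) Skip ;;
      Store ''P'' (Var ''c'' \<oplus> Const 1) (Get ''P'' (Var ''c'') \<oplus> Var ''d'') ;;
      (''c'' ::= Var ''c'' \<oplus> Const 1))"

definition output_com :: com where
  "output_com = (''i'' ::= Const 0) ;;
    While (Var ''i'' \<lessdot> Var ''N'')
      (Store ''out'' (Var ''i'') (Get ''P'' (Var ''i'' \<oplus> Var ''K'' \<oplus> Const 1) \<ominus> Get ''P'' (Var ''i'' \<oplus> Var ''K'')) ;;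
      (''i'' ::= Var ''i'' \<oplus> Const 1))"

text \<open>\<open>i div 2\<close> is the prefix sum of the alternating word, which starts with 0.
  The queue ends at \<open>N\<close> although the input has \<open>N - 1\<close> bits: the cell
  behind the input reads 0, and this is the appended bit.\<close>

definition prefix_com :: com where
  "prefix_com = (''i'' ::= Const 0) ;;
    While (Var ''i'' \<lessdot> Var ''K'' \<oplus> Const 1)
      (Store ''P'' (Var ''i'') (Var ''i'' \<oslash> Const 2) ;; (''i'' ::= Var ''i'' \<oplus> Const 1)) ;;
    (''a'' ::= Const 0) ;; (''e'' ::= Var ''N'') ;; (''c'' ::= Var ''K'')"

definition encoder :: "nat \<Rightarrow> nat \<Rightarrow> nat \<Rightarrow> nat \<Rightarrow> com" where
  "encoder al be u v = prepare al be u v ;; prefix_com ;; compress_com ;; pad_com ;; output_com"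

section \<open>Correctness and cost of the encoder\<close>

lemma one_le_diff_iff: "1 \<le> a - b \<longleftrightarrow> 1 + b \<le> (a::nat)"
  by (intro iffI; linarith)

lemma pack_bounds:
  fixes x p f M :: nat
  assumes "((x + p) * 2 + f) * 2 + 1 < M"
  shows "x < M" "x + p < M" "(x + p) * 2 < M" "(x + p) * 2 + f < M" "((x + p) * 2 + f) * 2 < M"
  using assms by simp_all

lemma count_alternating_take: "i \<le> K \<Longrightarrow> count_list (take i (alternating K)) True = i div 2"
proof (induction i)
  case (Suc i)
  then have "take (Suc i) (alternating K) = take i (alternating K) @ [odd i]"
    by (simp add: take_Suc_conv_app_nth alternating_def)
  then show ?case using Suc by (cases "odd i") auto
qed simp

context codec
begin

text \<open>The fields do not overlap, since
  \<open>length P \<le> N \<le> 2 ^ L < 2 ^ (L + 1)\<close> and the rank fits into the bits that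
  remain.\<close>

lemma code_eq_nbits:
  assumes "bad f P" "length P \<le> N"
  defines "z \<equiv> ((tail_rank f P * (2 * 2 ^ L) + length P) * 2 + of_bool f) * 2 + 1"
  shows "code f P = rev (nbits (min (length P) K - g) z)" "z < 2 ^ (min (length P) K - g)"
proof -
  let ?j = "min (length P) K"
  define r where "r = ?j - gain"
  have j: "?j - g = Suc (Suc (L + 1 + r))"
    using tail_rank_bound(2)[OF assms(1)] unfolding r_def by linarith
  have p: "length P < 2 ^ (L + 1)"
    using assms(2) N_le power_strict_increasing[of L "L + 1" "2::nat"] by linarith
  define y where "y = length P + 2 ^ (L + 1) * tail_rank f P"
  have z: "z = (y * 2 + of_bool f) * 2 + 1" by (simp add: z_def y_def mult_ac power_add)
  have "nbits (?j - g) z = True # f # nbits (L + 1 + r) y"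
  proof -
    have o: "of_bool f \<le> (1::nat)" by simp
    have "odd z" "z div 2 = y * 2 + of_bool f" unfolding z by presburger+
    moreover have "odd (y * 2 + of_bool f) = f" by (cases f) simp_all
    moreover have "(y * 2 + of_bool f) div 2 = y" using o by presburger
    ultimately show ?thesis unfolding j by simp
  qed
  also have "nbits (L + 1 + r) y = nbits (L + 1) (length P) @ nbits r (tail_rank f P)"
    unfolding y_def by (rule nbits_append[OF p])
  finally show "code f P = rev (nbits (?j - g) z)" by (simp add: code_def r_def)
  have "tail_rank f P < 2 ^ r" using tail_rank_bound(1)[OF assms(1)] by (simp add: r_def)
  then have "2 ^ (L + 1) * (tail_rank f P + 1) \<le> 2 ^ (L + 1) * 2 ^ r"
    by (intro mult_le_mono2) simp
  then have "2 ^ (L + 1) * tail_rank f P + 2 ^ (L + 1) \<le> 2 ^ (L + 1) * 2 ^ r"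
    by (simp only: add_mult_distrib2 mult_1_right)
  then have "y < 2 ^ (L + 1) * 2 ^ r" using p unfolding y_def by linarith
  moreover have "(2::nat) ^ (?j - g) = 4 * (2 ^ (L + 1) * 2 ^ r)" unfolding j by (simp add: power_add)
  ultimately show "z < 2 ^ (?j - g)" unfolding z by (cases f) auto
qed

end

context machine
begin

lemma wp_pack_com:
  assumes "scal s ''z'' = r" "scal s ''B'' = b" "scal s ''p'' = p" "scal s ''f'' = f"
    and "2 * b < 2 ^ w" "((r * (2 * b) + p) * 2 + f) * 2 + 1 < 2 ^ w"
  shows "wp w pack_com Q s a \<longleftrightarrow>
    16 \<le> a \<and> Q (s\<lparr>scal := (scal s)(''z'' := ((r * (2 * b) + p) * 2 + f) * 2 + 1)\<rparr>) (a - 16)"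
proof -
  have one_w: "1 < (2::nat) ^ w" using word_2 by linarith
  note b = pack_bounds[OF assms(6)] assms(5,6) word_2 one_w
  have v: "val w (((Var ''z'' \<otimes> (Const 2 \<otimes> Var ''B'') \<oplus> Var ''p'') \<otimes> Const 2 \<oplus> Var ''f'') \<otimes> Const 2 \<oplus> Const 1) s =
      ((r * (2 * b) + p) * 2 + f) * 2 + 1"
    by (simp only: val.simps binop_val.simps assms(1-4) b[THEN mod_less])
  have c: "1 + cost (((Var ''z'' \<otimes> (Const 2 \<otimes> Var ''B'') \<oplus> Var ''p'') \<otimes> Const 2 \<oplus> Var ''f'') \<otimes> Const 2 \<oplus> Const 1) = 16"
    by simp
  show ?thesis unfolding pack_com_def wp_Assign_iff c v ..
qed

lemma wp_replace_com:
  assumes env: "env s" and P: "psum s (V @ P)" "length P \<le> N" "bad f P"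
    and s: "scal s ''c'' = K + length P" "scal s ''f'' = of_bool f" "scal s ''e'' = e"
    and e: "e + K < 2 ^ w"
    and a: "100 * K + 150 \<le> a"
    and Q: "\<And>s' a'. same {''p'', ''t'', ''z'', ''i'', ''d'', ''j'', ''c'', ''y'', ''e''} {''in''} s s' \<Longrightarrow>
      scal s' ''c'' = K + (length P - K) \<Longrightarrow> scal s' ''e'' = e + length (code f P) \<Longrightarrow>
      (\<And>q. q < e \<Longrightarrow> arr s' ''in'' q = arr s ''in'' q) \<Longrightarrow>
      (\<And>q. q < length (code f P) \<Longrightarrow> arr s' ''in'' (e + q) = of_bool (code f P ! q)) \<Longrightarrow>
      a \<le> a' + (100 * K + 150) \<Longrightarrow> Q s' a'"
  shows "wp w replace_com Q s a"
proof -
  note [simp] = of_bool_mod_exp[OF w_pos] wp_iffs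
  note word = word_2 w_pos
  define p where "p = length P"
  define j where "j = min p K"
  define z where "z = ((tail_rank f P * (2 * 2 ^ L) + p) * 2 + of_bool f) * 2 + 1"
  have z_less: "z < 2 ^ (j - g)"
    unfolding z_def p_def j_def by (rule code_eq_nbits(2)[OF P(3,2)])
  have code: "code f P = rev (nbits (j - g) z)"
    unfolding z_def p_def j_def by (rule code_eq_nbits(1)[OF P(3,2)])
  have len: "length (code f P) = j - g" unfolding code by simp
  \<comment> \<open>A code has fewer than \<open>K\<close> bits, so \<open>word_T\<close> lets one
    word hold it.\<close>
  have "(2::nat) ^ (j - g) \<le> 2 ^ K" by (intro power_increasing) (auto simp: j_def)
  with z_less word_T have zw: "z < 2 ^ w" by linarith
  have B: "2 * 2 ^ L < (2::nat) ^ w"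
  proof -
    have "2 ^ L < 2 * N" using L_least L_pos by (simp add: power_eq_if)
    then show ?thesis using word_N by linarith
  qed
  have cw: "K + p < 2 ^ w" "p < 2 ^ w" using P(2) word_N unfolding p_def by linarith+
  define s1 where "s1 = s\<lparr>scal := (scal s)(''p'' := p)\<rparr>"
  let ?rest = "(''j'' ::= Var ''p'') ;;
    If (Var ''K'' \<lessdot> Var ''p'') (''j'' ::= Var ''K'') Skip ;;
    (''c'' ::= Var ''c'' \<ominus> Var ''j'') ;;
    pack_com ;;
    write_com"
  have "wp w rank_com (wp w ?rest Q) s1 (a - 4)"
  proof (rule wp_rank_com[OF _ _ P(2,3)])
    show "env s1" by (rule env_same[OF _ env, of "{''p''}" "{}"]) (simp_all add: s1_def same_def)
    show "psum s1 (V @ P)" using P(1) by (simp add: psum_def s1_def)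
    show "scal s1 ''c'' = K + length P" "scal s1 ''p'' = length P" "scal s1 ''f'' = of_bool f"
      using s by (simp_all add: s1_def p_def)
    show "50 * K + 30 \<le> a - 4" using a by simp
    fix s2 a2 assume 2: "same {''t'', ''z'', ''i'', ''d''} {} s1 s2" "scal s2 ''z'' = tail_rank f P"
      "a - 4 \<le> a2 + (50 * K + 30)"
    define s3 where "s3 = s2\<lparr>scal := (scal s2)(''j'' := j, ''c'' := K + p - j, ''z'' := z)\<rparr>"
    have c2: "scal s2 ''c'' = K + p" "scal s2 ''p'' = p" "scal s2 ''f'' = of_bool f" "scal s2 ''K'' = K"
      "scal s2 ''B'' = 2 ^ L" "scal s2 ''g'' = g" "scal s2 ''e'' = e"
      using 2(1) s env unfolding same_def s1_def env_def p_def by simp_all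
    have a2: "50 * K + 100 \<le> a2" using 2(3) a by linarith
    have W: "wp w write_com Q s3 a3" if a3: "a2 \<le> a3 + 50" for a3
    proof (rule wp_write_com[where l = "j - g" and e = e and z = z])
      show "scal s3 ''j'' - scal s3 ''g'' = j - g" "scal s3 ''e'' = e" "scal s3 ''z'' = z"
        using c2 by (simp_all add: s3_def)
      show "scal s3 ''j'' < 2 ^ w" "e + (j - g) < 2 ^ w" "z < 2 ^ w"
        using e zw by (simp_all add: s3_def j_def)
      have "30 * (j - g) \<le> 30 * K" by (simp add: j_def)
      with a3 a2 show "30 * (j - g) + 30 \<le> a3" by linarith
      fix s' a' assume 4: "same {''i'', ''y'', ''e'', ''z''} {''in''} s3 s'" "scal s' ''e'' = e + (j - g)"
        "\<And>q. q < e \<Longrightarrow> arr s' ''in'' q = arr s3 ''in'' q"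
        "\<And>q. q < j - g \<Longrightarrow> arr s' ''in'' (e + q) = of_bool (rev (nbits (j - g) z) ! q)"
        "a3 \<le> a' + (30 * (j - g) + 30)"
      show "Q s' a'"
      proof (rule Q)
        show "same {''p'', ''t'', ''z'', ''i'', ''d'', ''j'', ''c'', ''y'', ''e''} {''in''} s s'"
          using 4(1) 2(1) unfolding same_def s3_def s1_def by simp
        show "scal s' ''c'' = K + (length P - K)"
          using 4(1) unfolding same_def s3_def by (simp add: j_def p_def min_def)
        show "scal s' ''e'' = e + length (code f P)" using 4(2) len by simp
        show "arr s' ''in'' q = arr s ''in'' q" if "q < e" for q
          using 4(3)[OF that] 2(1) unfolding same_def s3_def s1_def by simp
        show "arr s' ''in'' (e + q) = of_bool (code f P ! q)" if "q < length (code f P)" for q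
          using 4(4)[of q] that len unfolding code by simp
        show "a \<le> a' + (100 * K + 150)"
          using 4(5) a3 2(3) \<open>30 * (j - g) \<le> 30 * K\<close> by linarith
      qed
    qed
    have kj: "K < p \<Longrightarrow> j = K" "\<not> K < p \<Longrightarrow> j = p" by (simp_all add: j_def)
    have "wp w pack_com (wp w write_com Q) (s2\<lparr>scal := (scal s2)(''j'' := j, ''c'' := K + p - j)\<rparr>) a3"
      if "a2 \<le> a3 + 20" for a3
    proof (subst wp_pack_com)
      have "16 \<le> a3" "a2 \<le> a3 - 16 + 50" using a2 that by linarith+
      with W[of "a3 - 16"] show "16 \<le> a3 \<and> wp w write_com Q
        (s2\<lparr>scal := (scal s2)(''j'' := j, ''c'' := K + p - j),
          scal := (scal (s2\<lparr>scal := (scal s2)(''j'' := j, ''c'' := K + p - j)\<rparr>))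
            (''z'' := ((tail_rank f P * (2 * 2 ^ L) + p) * 2 + of_bool f) * 2 + 1)\<rparr>) (a3 - 16)"
        unfolding s3_def z_def by simp
    qed (use c2 2(2) B zw in \<open>simp_all add: z_def\<close>)
    then show "wp w ?rest Q s2 a2"
      using c2 cw word a2 by (cases "K < p") (simp_all add: kj one_le_diff_iff)
  qed
  then show ?thesis
    unfolding replace_com_def using s env cw a by (simp add: env_def s1_def p_def)
qed

lemma wp_push_com:
  assumes env: "env s" and P: "psum s (V @ P)" "length P < N"
    and s: "scal s ''c'' = K + length P" "scal s ''a'' = i" "arr s ''in'' i = of_bool b" "i + 1 < 2 ^ w"
    and a: "50 \<le> a"
    and Q: "\<And>s' a'. same {''c'', ''a'', ''d'', ''f''} {''P''} s s' \<Longrightarrow> psum s' (V @ P @ [b]) \<Longrightarrow>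
      scal s' ''c'' = K + length P + 1 \<Longrightarrow> scal s' ''a'' = i + 1 \<Longrightarrow>
      scal s' ''f'' = of_bool (bad True (P @ [b])) \<Longrightarrow>
      h < K - scal s' ''d'' \<longleftrightarrow> bad False (P @ [b]) \<Longrightarrow>
      scal s' ''d'' \<le> K \<Longrightarrow> a \<le> a' + 50 \<Longrightarrow> Q s' a'"
  shows "wp w push_com Q s a"
proof -
  note [simp] = of_bool_mod_exp[OF w_pos] wp_iffs one_le_diff_iff
  note word = word_2 w_pos
  define p where "p = length P"
  define T where "T = (\<lambda>q. if q = K + p + 1 then arr s ''P'' (K + p) + of_bool b else arr s ''P'' q)"
  define s1 where "s1 = s\<lparr>arr := (arr s)(''P'' := T)\<rparr>"
  define d where "d = T (K + p + 1) - T (p + 1)"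
  define s2 where "s2 = s\<lparr>arr := (arr s)(''P'' := T),
    scal := (scal s)(''c'' := K + p + 1, ''a'' := i + 1, ''d'' := d, ''f'' := of_bool (h < d))\<rparr>"
  have P1: "psum s1 (V @ P @ [b])"
    using psum_snoc[OF P(1), of s1 b] by (simp add: s1_def T_def p_def)
  have "arr s1 ''P'' (length (V @ P @ [b])) - arr s1 ''P'' (p + 1) = count_list (drop (p + 1) (V @ P @ [b])) True"
    by (rule psum_window[OF P1, of _ K]) (simp add: p_def)
  moreover have "length (V @ P @ [b]) = K + p + 1" by (simp add: p_def)
  ultimately have d: "d = count_list (drop (length (P @ [b])) (V @ P @ [b])) True"
    by (simp add: d_def s1_def p_def Suc_eq_plus1 add.assoc del: drop_append count_list_append)
  have "d + count_list (drop (length (P @ [b])) (V @ P @ [b])) False = K"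
    unfolding d count_bool_sum by simp
  then have dK: "d \<le> K" "K - d = count_list (drop (length (P @ [b])) (V @ P @ [b])) False" by linarith+
  have bT: "(h < d) = bad True (P @ [b])" unfolding bad_def d by simp
  have bF: "(h < K - d) = bad False (P @ [b])" unfolding bad_def dK(2) by simp
  have Q2: "Q s2 a'" if "a \<le> a' + 50" for a'
  proof (rule Q)
    show "psum s2 (V @ P @ [b])" using P1 by (simp add: psum_def s1_def s2_def)
  qed (use bT bF dK that in \<open>simp_all add: same_def s2_def p_def\<close>)
  have sum: "arr s ''P'' (K + p) + of_bool b < 2 ^ w"
  proof -
    have "arr s ''P'' (K + p) \<le> length (V @ P)" by (rule psum_le[OF P(1)]) (simp add: p_def)
    then show ?thesis using word_N P(2) by (cases b) simp_all
  qed
  have dw: "d < 2 ^ w" using dK(1) word_K by linarith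
  have bounds: "K + p + 1 < 2 ^ w" "K + p + 1 - K = p + 1" "p + 1 < 2 ^ w" using P(2) word_N by (simp_all add: p_def)
  have upd: "(arr s ''P'')(K + p + 1 := arr s ''P'' (K + p) + of_bool b) = T" by (auto simp: T_def)
  have "scal s ''K'' = K" "scal s ''h'' = h" using env by (simp_all add: env_def)
  have T1: "T (K + p + 1) - T (p + 1) = d" "T (1 + (K + p)) - T (1 + p) = d" "T (K + (p + 1)) - T (p + 1) = d"
    by (simp_all add: d_def ac_simps)
  show ?thesis
    unfolding push_com_def using s a word sum dw bounds \<open>scal s ''K'' = K\<close> \<open>scal s ''h'' = h\<close> T1 Q2
    by (simp add: p_def[symmetric] upd s2_def)
qed


text \<open>A bit leaving the queue pays 80 credits for its push. A replacement costs about
  \<open>100 * K\<close> and puts at most \<open>K\<close> bits back into the queue; it is paid by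
  the \<open>X * g \<ge> 400 * K\<close> credits that the \<open>g\<close> saved bits
  release.\<close>

lemma wp_compress_com:
  assumes env: "env s" and x: "length x + 1 = N" and P: "psum s V"
    and s: "scal s ''c'' = K" "scal s ''a'' = 0" "scal s ''e'' = N"
    and inp: "\<And>q. q < N \<Longrightarrow> arr s ''in'' q = of_bool ((x @ [False]) ! q)"
    and a: "Y + 10 + 80 * N + X * N \<le> a"
    and Q: "\<And>s' a' r P. env s' \<Longrightarrow> reach x r P [] \<Longrightarrow> psum s' (V @ P) \<Longrightarrow>
      scal s' ''c'' = K + length P \<Longrightarrow> Y \<le> a' \<Longrightarrow> Q s' a'"
  shows "wp w compress_com Q s a"
proof -
  note [simp] = of_bool_mod_exp[OF w_pos]
  note word = word_2 w_pos
  have K2: "2 \<le> K" using half_le_h h_less_K by linarith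
  let ?e = "Var ''a'' \<lessdot> Var ''e''"
  let ?c = "Var ''f'' \<oplus> (Var ''h'' \<lessdot> Var ''K'' \<ominus> Var ''d'')"
  let ?b = "push_com ;; If ?c replace_com Skip"
  \<comment> \<open>Besides the potential, the invariant bounds the addresses of the queue: its
    cells are never reused, but at most \<open>N\<close> replacements append at most
    \<open>K\<close> bits each. \<open>Y\<close> is kept for the later phases.\<close>
  define J where "J = (\<lambda>s' a' r P R i. env s' \<and> reach x r P R \<and> psum s' (V @ P) \<and>
    scal s' ''c'' = K + length P \<and> scal s' ''a'' = i \<and> scal s' ''e'' = i + length R \<and>
    i + length R \<le> N + r * K \<and> (\<forall>q<length R. arr s' ''in'' (i + q) = of_bool (R ! q)) \<and>
    Y + 10 + 80 * length R + X * (length P + length R) \<le> a')"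
  define I where "I = (\<lambda>s' a'. \<exists>r P R i. J s' a' r P R i)"
  have "wp w (While ?e ?b) Q s' a'" if "I s' a'" for s' a'
    using that
  proof (rule wp_While)
    fix s' a' assume I: "I s' a'" and c: "val w ?e s' \<noteq> 0"
    then obtain r P R i where J: "J s' a' r P R i" unfolding I_def by blast
    then have env': "env s'" and reach: "reach x r P R" and ps: "psum s' (V @ P)"
      and sc: "scal s' ''c'' = K + length P" "scal s' ''a'' = i" "scal s' ''e'' = i + length R"
      and e_le: "i + length R \<le> N + r * K" and inR: "\<And>q. q < length R \<Longrightarrow> arr s' ''in'' (i + q) = of_bool (R ! q)"
      and a': "Y + 10 + 80 * length R + X * (length P + length R) \<le> a'"
      unfolding J_def by auto
    have "R \<noteq> []" using c sc by (cases R) auto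
    then obtain b R' where R: "R = b # R'" by (cases R) auto
    have len: "length P + length R + g * r = N" using reach_length[OF reach] x by simp
    have PN: "length P < N" using len R by simp
    have "1 * r \<le> g * r" using g_ge_2 by (intro mult_le_mono1) simp
    then have "r \<le> N" using len by linarith
    then have "r * K \<le> N * K" by (rule mult_le_mono1)
    then have ew: "i + length R + K < 2 ^ w" using e_le word_N by linarith
    let ?P = "P @ [b]"
    have "wp w push_com (wp w (If ?c replace_com Skip) I) s' (a' - 4)"
    proof (rule wp_push_com[OF env' ps PN sc(1,2)])
      show "arr s' ''in'' i = of_bool b" using inR[of 0] R by simp
      show "i + 1 < 2 ^ w" using ew R K_pos by simp
      show "50 \<le> a' - 4" using a' R by simp
      fix s2 a2 assume 2: "same {''c'', ''a'', ''d'', ''f''} {''P''} s' s2" "psum s2 (V @ P @ [b])"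
        "scal s2 ''c'' = K + length P + 1" "scal s2 ''a'' = i + 1" "scal s2 ''f'' = of_bool (bad True ?P)"
        "(h < K - scal s2 ''d'') = bad False ?P" "scal s2 ''d'' \<le> K" "a' - 4 \<le> a2 + 50"
      have env2: "env s2" by (rule env_same[OF 2(1) env']) auto
      have e2: "scal s2 ''e'' = i + 1 + length R'" using 2(1) sc(3) R unfolding same_def by simp
      have in2: "arr s2 ''in'' (i + 1 + q) = of_bool (R' ! q)" if "q < length R'" for q
        using inR[of "q + 1"] that 2(1) R unfolding same_def by (simp add: ac_simps)
      have hK: "scal s2 ''h'' = h" "scal s2 ''K'' = K" using env2 by (simp_all add: env_def)
      have "K < 2 ^ w" using word_N by linarith
      then have v: "val w ?c s2 = of_bool (bad True ?P) + of_bool (bad False ?P)"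
        using 2(5,6) hK word less_imp_diff_less[of K "2 ^ w" "scal s2 ''d''"]
        by (cases "bad True ?P"; cases "bad False ?P") simp_all
      have a2: "Y + 10 + 80 * length R' + X * (length P + length R) \<le> a2 + 54 - 80" "8 \<le> a2" 
        using a' 2(8) R by simp_all
      show "wp w (If ?c replace_com Skip) I s2 a2"
      proof (cases "bad True ?P \<or> bad False ?P")
        case False
        then have nb: "\<not> bad f ?P" for f by (cases f) auto
        have "J s2 (a2 - 9) r ?P R' (i + 1)"
          unfolding J_def
        proof (intro conjI allI impI)
          show "reach x r ?P R'" using reach.push[of x r P b R'] reach nb R by simp
          show "i + 1 + length R' \<le> N + r * K" using e_le R by simp
          show "Y + 10 + 80 * length R' + X * (length ?P + length R') \<le> a2 - 9"
            using a2 R by simp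
        qed (use env2 2 e2 in2 in simp_all)
        then have "I s2 (a2 - 9)" unfolding I_def by blast
        moreover have "9 \<le> a2" using a2(1) by simp
        ultimately show ?thesis
          unfolding wp_If_iff v wp_Skip_iff using False by simp
      next
        case True
        define f where "f = bad True ?P"
        have bad: "bad f ?P" using True by (cases "bad True ?P") (simp_all add: f_def)
        have lc: "length (code f ?P) + g = min (length ?P) K" by (rule length_code[OF bad])
        let ?P2 = "take (length ?P - K) ?P" and ?R2 = "R' @ code f ?P"
        have "wp w replace_com I s2 (a2 - 8)"
        proof (rule wp_replace_com[OF env2 _ _ bad])
          show "psum s2 (V @ ?P)" using 2(2) by simp
          show "length ?P \<le> N" using PN by simp
          show "scal s2 ''c'' = K + length ?P" using 2(3) by simp
          show "scal s2 ''f'' = of_bool f" using 2(5) by (simp add: f_def)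
          show "scal s2 ''e'' = i + 1 + length R'" by (rule e2)
          show "i + 1 + length R' + K < 2 ^ w" using ew R by simp
          have S: "length ?P2 + length ?R2 + g = length P + length R"
          proof -
            have "length ?P2 + min (length ?P) K = length ?P" by simp
            then show ?thesis using lc R by simp
          qed
          have XS: "X * (length ?P2 + length ?R2) + X * g = X * (length P + length R)"
            unfolding S[symmetric] by (simp only: add_mult_distrib2)
          then show "100 * K + 150 \<le> a2 - 8" using a2 K_le K2 by linarith
          fix s3 a3 assume 3: "same {''p'', ''t'', ''z'', ''i'', ''d'', ''j'', ''c'', ''y'', ''e''} {''in''} s2 s3"
            "scal s3 ''c'' = K + (length ?P - K)" "scal s3 ''e'' = i + 1 + length R' + length (code f ?P)"
            "\<And>q. q < i + 1 + length R' \<Longrightarrow> arr s3 ''in'' q = arr s2 ''in'' q"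
            "\<And>q. q < length (code f ?P) \<Longrightarrow> arr s3 ''in'' (i + 1 + length R' + q) = of_bool (code f ?P ! q)"
            "a2 - 8 \<le> a3 + (100 * K + 150)"
          have "J s3 a3 (Suc r) ?P2 ?R2 (i + 1)"
            unfolding J_def
          proof (intro conjI allI impI)
            show "env s3" by (rule env_same[OF 3(1) env2]) auto
            show "reach x (Suc r) ?P2 ?R2" using reach.pop[OF reach[unfolded R] bad] .
            have "psum s2 ((V @ ?P2) @ drop (length ?P - K) ?P)"
              using 2(2) by (simp only: append_assoc append_take_drop_id)
            then have "psum s2 (V @ ?P2)" by (rule psum_appendD)
            then show "psum s3 (V @ ?P2)" using 3(1) by (simp add: psum_def same_def)
            show "scal s3 ''c'' = K + length ?P2" using 3(2) by simp
            show "scal s3 ''a'' = i + 1" using 3(1) 2(4) by (simp add: same_def)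
            show "scal s3 ''e'' = i + 1 + length ?R2" using 3(3) by simp
            show "i + 1 + length ?R2 \<le> N + Suc r * K" using e_le R lc by simp
            show "arr s3 ''in'' (i + 1 + q) = of_bool (?R2 ! q)" if "q < length ?R2" for q
            proof (cases "q < length R'")
              case True
              then show ?thesis using 3(4)[of "i + 1 + q"] in2[OF True] by (simp add: nth_append)
            next
              case False
              then have "i + 1 + length R' + (q - length R') = i + 1 + q" by simp
              with 3(5)[of "q - length R'"] show ?thesis using False that by (simp add: nth_append)
            qed
            have "length (code f ?P) \<le> K" using lc by simp
            moreover have "length ?R2 = length R' + length (code f ?P)" by simp
            ultimately show "Y + 10 + 80 * length ?R2 + X * (length ?P2 + length ?R2) \<le> a3"
              using a2 3(6) K_le K2 XS by linarith
          qed
          then show "I s3 a3" unfolding I_def by blast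
        qed
        moreover have "1 + cost ?c = 8" by simp
        moreover have "val w ?c s2 \<noteq> 0" unfolding v using True by auto
        ultimately show ?thesis unfolding wp_If_iff using a2(2) by simp
      qed
    qed
    moreover have "1 + cost ?e = 4" by simp
    ultimately show "1 + cost ?e \<le> a' \<and> wp w ?b I s' (a' - (1 + cost ?e))"
      unfolding wp_Seq_iff using a' by simp
  next
    fix s' a' assume I: "I s' a'" and c: "val w ?e s' = 0"
    then obtain r P R i where J: "J s' a' r P R i" unfolding I_def by blast
    then have sc: "scal s' ''a'' = i" "scal s' ''e'' = i + length R" unfolding J_def by auto
    have R: "R = []" using c sc w_pos by (cases R) (simp_all split: if_splits)
    have "Q s' (a' - 4)" using J unfolding J_def R by (auto intro!: Q)
    moreover have "10 \<le> a'" using J unfolding J_def by simp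
    ultimately show "1 + cost ?e \<le> a' \<and> Q s' (a' - (1 + cost ?e))" by simp
  qed
  moreover have lenx: "length (x @ [False]) = N" using x by simp
  have "J s a 0 [] (x @ [False]) 0"
    unfolding J_def lenx using env P s inp a reach.start by simp
  then have "I s a" unfolding I_def by blast
  ultimately show ?thesis unfolding compress_com_def by blast
qed

text \<open>A stack of length \<open>N - 1\<close> is excluded: with a single padding bit the start
  mark and the final 1 could contradict each other.\<close>

lemma wp_pad_com:
  assumes env: "env s" and P: "psum s (V @ P)" "length P = N \<or> length P + 2 \<le> N"
    and s: "scal s ''c'' = K + length P"
    and a: "Y + 10 + 80 * N \<le> a"
    and Q: "\<And>s' a' A. env s' \<Longrightarrow> padded P A \<Longrightarrow> psum s' (V @ A) \<Longrightarrow> Y \<le> a' \<Longrightarrow> Q s' a'"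
  shows "wp w pad_com Q s a"
proof -
  note [simp] = of_bool_mod_exp[OF w_pos] wp_iffs one_le_diff_iff
  note word = word_2 w_pos
  define p where "p = length P"
  let ?e = "Var ''c'' \<lessdot> Var ''N'' \<oplus> Var ''K''"
  let ?b = "(''d'' ::= Get ''P'' (Var ''c'' \<ominus> Var ''K'' \<oplus> Const 1) \<ominus> Get ''P'' (Var ''c'' \<ominus> Var ''K'')) ;;
      If (Var ''c'' \<doteq> Var ''y'') (''d'' ::= Const 1 \<ominus> Var ''d'') Skip ;;
      If (Var ''c'' \<oplus> Const 1 \<doteq> Var ''N'' \<oplus> Var ''K'') (''d'' ::= Const 1) Skip ;;
      Store ''P'' (Var ''c'' \<oplus> Const 1) (Get ''P'' (Var ''c'') \<oplus> Var ''d'') ;;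
      (''c'' ::= Var ''c'' \<oplus> Const 1)"
  \<comment> \<open>\<open>b \<noteq> (i = p)\<close> is an exclusive or: it negates the bit
    \<open>K\<close> places before at the first padding position and copies it elsewhere.\<close>
  define ok where "ok = (\<lambda>A. p \<le> length A \<and> length A \<le> N \<and> take p A = P \<and>
    (\<forall>i. p \<le> i \<and> i < length A \<longrightarrow> (V @ A) ! (K + i) = (i = N - 1 \<or> (V @ A) ! i \<noteq> (i = p))))"
  define I where "I = (\<lambda>s' a'. env s' \<and> scal s' ''y'' = K + p \<and>
    (\<exists>A. ok A \<and> psum s' (V @ A) \<and> scal s' ''c'' = K + length A \<and> Y + 8 + 80 * (N - length A) \<le> a'))"
  have NK: "N + K < 2 ^ w" using word_N by linarith
  have ok_snoc: "ok (A @ [b])" if "ok A" "length A < N"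
    "b = (length A = N - 1 \<or> (V @ A) ! length A \<noteq> (length A = p))" for A b
    unfolding ok_def
  proof (intro conjI allI impI)
    fix i assume i: "p \<le> i \<and> i < length (A @ [b])"
    have "(V @ A @ [b]) ! i = ((V @ A) @ [b]) ! i" by simp
    also have "\<dots> = (V @ A) ! i" using i K_pos by (subst nth_append) simp
    finally have "(V @ A @ [b]) ! i = (V @ A) ! i" .
    moreover have "(V @ A @ [b]) ! (K + i) = (if i = length A then b else (V @ A) ! (K + i))"
      using i by (simp add: nth_append)
    moreover have "(V @ A) ! (K + i) = (i = N - 1 \<or> (V @ A) ! i \<noteq> (i = p))" if "i \<noteq> length A"
      using \<open>ok A\<close> i that unfolding ok_def by simp
    ultimately show "(V @ A @ [b]) ! (K + i) = (i = N - 1 \<or> (V @ A @ [b]) ! i \<noteq> (i = p))"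
      using that(3) by (cases "i = length A") auto
  qed (use that in \<open>auto simp: ok_def\<close>)
  have "wp w (While ?e ?b) Q s' a'" if "I s' a'" for s' a'
    using that
  proof (rule wp_While)
    fix s' a' assume I: "I s' a'" and c: "val w ?e s' \<noteq> 0"
    then obtain A where env': "env s'" and y: "scal s' ''y'' = K + p" and ok: "ok A" and ps: "psum s' (V @ A)"
      and cc: "scal s' ''c'' = K + length A" and a': "Y + 8 + 80 * (N - length A) \<le> a'"
      unfolding I_def by blast
    have NKs: "scal s' ''N'' = N" "scal s' ''K'' = K" using env' by (simp_all add: env_def)
    have lt: "length A < N" using c cc NKs NK by (simp split: if_splits)
    define k where "k = length A"
    define b where "b = (k = N - 1 \<or> (V @ A) ! k \<noteq> (k = p))"
    define T where "T = (arr s' ''P'')(K + k + 1 := arr s' ''P'' (K + k) + of_bool b)"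
    have d: "arr s' ''P'' (k + 1) - arr s' ''P'' k = of_bool ((V @ A) ! k)"
      by (rule psum_nth[OF ps]) (use K_pos in \<open>simp add: k_def\<close>)
    have last: "(K + k + 1 = N + K) = (k = N - 1)" using lt by (auto simp: k_def)
    have "arr s' ''P'' (K + k) \<le> length (V @ A)" by (rule psum_le[OF ps]) (simp add: k_def)
    then have w1: "arr s' ''P'' (K + k) + of_bool c < 2 ^ w" for c
      using word_N lt by (cases c) simp_all
    have w2: "K + k < 2 ^ w" "K + k + 1 < 2 ^ w" "k < 2 ^ w" "k + 1 < 2 ^ w" "k + 1 < 2 ^ w"
      using lt word_N unfolding k_def by linarith+
    have new: "I (s'\<lparr>arr := (arr s')(''P'' := T), scal := (scal s')(''d'' := q, ''c'' := K + k + 1)\<rparr>) a2"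
      if "a' \<le> a2 + 80" for a2 q
      unfolding I_def
    proof (intro conjI exI[of _ "A @ [b]"])
      show "ok (A @ [b])" by (rule ok_snoc[OF ok lt]) (simp add: b_def k_def)
      show "psum (s'\<lparr>arr := (arr s')(''P'' := T), scal := (scal s')(''d'' := q, ''c'' := K + k + 1)\<rparr>) (V @ A @ [b])"
        using psum_snoc[OF ps, of _ b] by (simp add: T_def k_def)
      show "Y + 8 + 80 * (N - length (A @ [b])) \<le> a2" using a' that lt by simp
    qed (use env' y in \<open>simp_all add: env_def k_def\<close>)
    have big: "88 \<le> a'" using a' lt by simp
    have bT: "of_bool b = (if k = N - 1 then 1 else if k = p then 1 - of_bool ((V @ A) ! k) else of_bool ((V @ A) ! k) :: nat)"
      by (auto simp: b_def)
    have new': "I (s'\<lparr>arr := (arr s')(''P'' := (arr s' ''P'')(K + k + 1 := arr s' ''P'' (K + k) + of_bool b)),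
        scal := (scal s')(''d'' := q, ''c'' := K + k + 1)\<rparr>) a2" if "a' \<le> a2 + 80" for a2 q
      using new[OF that] unfolding T_def .
    have cK: "scal s' ''c'' = K + k" "K + k < N + K" using cc lt by (simp_all add: k_def)
    show "1 + cost ?e \<le> a' \<and> wp w ?b I s' (a' - (1 + cost ?e))"
    proof (cases "k = N - 1")
      case True
      then have b: "b" and Nk: "N = k + 1" using lt by (simp_all add: b_def)
      show ?thesis
        using big y cK NKs d w1[of True] w2 word new' b Nk by (cases "k = p") simp_all
    next
      case False
      show ?thesis
      proof (cases "k = p")
        case True
        then have b: "b = (\<not> (V @ A) ! k)" using False by (simp add: b_def)
        then show ?thesis
          using big y cK NKs NK d w1[of b] w2 word new' last False True by (cases "(V @ A) ! k") simp_all
      next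
        case kp: False
        then have b: "b = (V @ A) ! k" using False by (simp add: b_def)
        then show ?thesis
          using big y cK NKs NK d w1[of b] w2 word new' last kp False by (cases "(V @ A) ! k") simp_all
      qed
    qed
  next
    fix s' a' assume I: "I s' a'" and c: "val w ?e s' = 0"
    then obtain A where env': "env s'" and ok: "ok A" and ps: "psum s' (V @ A)"
      and cc: "scal s' ''c'' = K + length A" and a': "Y + 8 + 80 * (N - length A) \<le> a'"
      unfolding I_def by blast
    have NKs: "scal s' ''N'' = N" "scal s' ''K'' = K" using env' by (simp_all add: env_def)
    have "length A = N" using c cc NKs NK ok by (simp add: ok_def)
    have "padded P A"
      unfolding padded_def
    proof (intro conjI impI allI)
      show "length A = N" by fact
      show "take (length P) A = P" using ok by (simp add: ok_def p_def)
      have step: "(V @ A) ! (K + i) = (i = N - 1 \<or> (V @ A) ! i \<noteq> (i = p))" if "p \<le> i" "i < N" for i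
        using ok that \<open>length A = N\<close> by (simp add: ok_def)
      assume "length P < N"
      then have pN: "p + 2 \<le> N" using P(2) by (simp add: p_def)
      have "(V @ A) ! (K + (N - 1)) = A ! (N - 1)" unfolding nth_append by simp
      then show "A ! (N - 1)" using step[of "N - 1"] pN by simp
      show "(V @ A) ! (K + length P) \<noteq> (V @ A) ! length P" using step[of p] pN by (auto simp: p_def)
      show "(V @ A) ! (K + i) = (V @ A) ! i" if "length P < i \<and> i < N - 1" for i
        using step[of i] that by (auto simp: p_def)
    qed
    then show "1 + cost ?e \<le> a' \<and> Q s' (a' - (1 + cost ?e))"
      using env' ps a' by (auto intro!: Q)
  qed
  moreover have "I (s\<lparr>scal := (scal s)(''y'' := K + p)\<rparr>) (a - 2)"
    unfolding I_def
  proof (intro conjI exI[of _ P])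
    have "80 * (N - length P) \<le> 80 * N" by simp
    then show "Y + 8 + 80 * (N - length P) \<le> a - 2" using a by linarith
  qed (use env P s in \<open>auto simp: env_def psum_def ok_def p_def\<close>)
  ultimately show ?thesis
    unfolding pad_com_def using a s by (simp add: p_def)
qed


lemma wp_output_com:
  assumes env: "env s" and A: "psum s (V @ A)" "length A = N"
    and a: "30 * N + 10 \<le> a"
    and Q: "\<And>s' a'. (\<And>i. i < N \<Longrightarrow> arr s' ''out'' i = of_bool (A ! i)) \<Longrightarrow> Q s' a'"
  shows "wp w output_com Q s a"
proof -
  note [simp] = of_bool_mod_exp[OF w_pos] wp_iffs one_le_diff_iff
  note word = word_2 w_pos
  let ?e = "Var ''i'' \<lessdot> Var ''N''"
  let ?b = "Store ''out'' (Var ''i'') (Get ''P'' (Var ''i'' \<oplus> Var ''K'' \<oplus> Const 1) \<ominus> Get ''P'' (Var ''i'' \<oplus> Var ''K'')) ;;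
      (''i'' ::= Var ''i'' \<oplus> Const 1)"
  define I where "I = (\<lambda>s' a'. same {''i''} {''out''} s s' \<and>
    (\<exists>i\<le>N. scal s' ''i'' = i \<and> (\<forall>q<i. arr s' ''out'' q = of_bool (A ! q)) \<and> 30 * (N - i) + 5 \<le> a'))"
  have "wp w (While ?e ?b) Q s' a'" if "I s' a'" for s' a'
    using that
  proof (rule wp_While)
    fix s' a' assume I: "I s' a'" and c: "val w ?e s' \<noteq> 0"
    then obtain i where i: "same {''i''} {''out''} s s'" "i \<le> N" "scal s' ''i'' = i"
      "\<forall>q<i. arr s' ''out'' q = of_bool (A ! q)" "30 * (N - i) + 5 \<le> a'" unfolding I_def by blast
    have sc: "scal s' ''N'' = N" "scal s' ''K'' = K" using env i(1) by (simp_all add: env_def same_def)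
    have lt: "i < N" using c i(3) sc by simp
    have "arr s ''P'' (i + K + 1) - arr s ''P'' (i + K) = of_bool ((V @ A) ! (i + K))"
      by (rule psum_nth[OF A(1)]) (use lt A in simp)
    moreover have "(V @ A) ! (i + K) = A ! i" by (simp add: nth_append)
    ultimately have d: "arr s' ''P'' (i + K + 1) - arr s' ''P'' (i + K) = of_bool (A ! i)"
      using i(1) by (simp add: same_def)
    have w1: "i + K < 2 ^ w" "i + K + 1 < 2 ^ w" "i + 1 < 2 ^ w" "i < 2 ^ w"
      using lt word_N by linarith+
    have "30 * (N - (i + 1)) + 35 \<le> a'" using i(5) lt by simp
    then have "I (s'\<lparr>arr := (arr s')(''out'' := (arr s' ''out'')(i := of_bool (A ! i))),
        scal := (scal s')(''i'' := i + 1)\<rparr>) a2" if "a' \<le> a2 + 30" for a2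
      unfolding I_def using that i(1,4) lt by (auto simp: same_def less_add_one_iff)
    moreover have "35 \<le> a'" using i(5) lt by simp
    ultimately show "1 + cost ?e \<le> a' \<and> wp w ?b I s' (a' - (1 + cost ?e))"
      using i(3) sc lt d w1 word by simp
  next
    fix s' a' assume I: "I s' a'" and c: "val w ?e s' = 0"
    then obtain i where i: "same {''i''} {''out''} s s'" "i \<le> N" "scal s' ''i'' = i"
      "\<forall>q<i. arr s' ''out'' q = of_bool (A ! q)" "30 * (N - i) + 5 \<le> a'" unfolding I_def by blast
    have "scal s' ''N'' = N" using env i(1) by (simp_all add: env_def same_def)
    then have "i = N" using c i(2,3) by simp
    then show "1 + cost ?e \<le> a' \<and> Q s' (a' - (1 + cost ?e))"
      using i(4,5) by (auto intro!: Q)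
  qed
  moreover have "I (s\<lparr>scal := (scal s)(''i'' := 0)\<rparr>) (a - 2)"
    unfolding I_def using a by (simp add: same_def)
  ultimately show ?thesis unfolding output_com_def using a by simp
qed

lemma wp_prefix_com:
  assumes env: "env s" and a: "30 * K + 60 \<le> a"
    and Q: "\<And>s' a'. same {''i'', ''a'', ''e'', ''c''} {''P''} s s' \<Longrightarrow> psum s' V \<Longrightarrow>
      scal s' ''c'' = K \<Longrightarrow> scal s' ''a'' = 0 \<Longrightarrow> scal s' ''e'' = N \<Longrightarrow> a \<le> a' + (30 * K + 60) \<Longrightarrow> Q s' a'"
  shows "wp w prefix_com Q s a"
proof -
  note [simp] = of_bool_mod_exp[OF w_pos] wp_iffs one_le_diff_iff
  note word = word_2 w_pos
  let ?e = "Var ''i'' \<lessdot> Var ''K'' \<oplus> Const 1"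
  let ?b = "Store ''P'' (Var ''i'') (Var ''i'' \<oslash> Const 2) ;; (''i'' ::= Var ''i'' \<oplus> Const 1)"
  let ?r = "(''a'' ::= Const 0) ;; (''e'' ::= Var ''N'') ;; (''c'' ::= Var ''K'')"
  have w1: "K + 1 < 2 ^ w" using word_N by linarith
  define I where "I = (\<lambda>s' a'. same {''i''} {''P''} s s' \<and>
    (\<exists>i\<le>K + 1. scal s' ''i'' = i \<and> (\<forall>q<i. arr s' ''P'' q = q div 2) \<and>
      25 \<le> a' \<and> a \<le> a' + 30 * i + 5))"
  have "wp w (While ?e ?b) (wp w ?r Q) s' a'" if "I s' a'" for s' a'
    using that
  proof (rule wp_While)
    fix s' a' assume I: "I s' a'" and c: "val w ?e s' \<noteq> 0"
    then obtain i where i: "same {''i''} {''P''} s s'" "i \<le> K + 1" "scal s' ''i'' = i"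
      "\<forall>q<i. arr s' ''P'' q = q div 2" "a \<le> a' + 30 * i + 5" unfolding I_def by blast
    have sc: "scal s' ''K'' = K" using env i(1) by (simp_all add: env_def same_def)
    have lt: "i < K + 1" using c i(3) sc w1 word by simp
    have w2: "i div 2 < 2 ^ w" "i + 1 < 2 ^ w" using lt w1 div_le_dividend[of i 2] by linarith+
    have "30 * i \<le> 30 * K" using lt by simp
    then have a': "55 \<le> a'" using i(5) a by linarith
    have "I (s'\<lparr>arr := (arr s')(''P'' := (arr s' ''P'')(i := i div 2)),
        scal := (scal s')(''i'' := i + 1)\<rparr>) a2" if "a' \<le> a2 + 30" for a2
      unfolding I_def using that i(1,4,5) lt a' a by (auto simp: same_def less_add_one_iff)
    then show "1 + cost ?e \<le> a' \<and> wp w ?b I s' (a' - (1 + cost ?e))"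
      using i(3) sc lt w1 w2 word a' by simp
  next
    fix s' a' assume I: "I s' a'" and c: "val w ?e s' = 0"
    then obtain i where i: "same {''i''} {''P''} s s'" "i \<le> K + 1" "scal s' ''i'' = i"
      "\<forall>q<i. arr s' ''P'' q = q div 2" "a \<le> a' + 30 * i + 5" "25 \<le> a'" unfolding I_def by blast
    have sc: "scal s' ''K'' = K" "scal s' ''N'' = N" using env i(1) by (simp_all add: env_def same_def)
    have "i = K + 1" using c i(2,3) sc w1 word by simp
    have P: "psum s' V"
      unfolding psum_def using i(4) \<open>i = K + 1\<close> by (simp add: count_alternating_take)
    have "Q (s'\<lparr>scal := (scal s')(''a'' := 0, ''e'' := N, ''c'' := K)\<rparr>) a2" if "a' \<le> a2 + 25" for a2
    proof (rule Q)
      show "a \<le> a2 + (30 * K + 60)" using that i(5) \<open>i = K + 1\<close> by simp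
    qed (use P i(1) in \<open>simp_all add: same_def psum_def\<close>)
    then show "1 + cost ?e \<le> a' \<and> wp w ?r Q s' (a' - (1 + cost ?e))"
      using i(6) sc by simp
  qed
  moreover have "I (s\<lparr>scal := (scal s)(''i'' := 0)\<rparr>) (a - 2)"
    unfolding I_def using a by (simp add: same_def)
  ultimately show ?thesis unfolding prefix_com_def using a by simp
qed

text \<open>\<open>X * N\<close> pays for the replacements, \<open>1000 * N\<close> for the
  preparation, and the rest of \<open>1400 * N\<close> for prefix, pushes, padding and
  output.\<close>

theorem wp_encoder:
  assumes x: "length x + 1 = N"
  shows "wp w (encoder al be u v) (\<lambda>s a. \<exists>A. encodes x A \<and> (\<forall>i<N. arr s ''out'' i = of_bool (A ! i)))
    (init n m x) ((X + 1400) * N)"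
proof -
  have N1: "K \<le> N" "1 \<le> N" using K_le_N K_pos by linarith+
  have tot: "(X + 1400) * N = X * N + 1400 * N" by (rule add_mult_distrib)
  show ?thesis
    unfolding encoder_def wp_Seq_iff
  proof (rule wp_prepare)
    show "scal (init n m x) ''n'' = n" "scal (init n m x) ''m'' = m" "arr (init n m x) ''T'' i = 0" for i
      by (simp_all add: init_def)
    show "1000 * N \<le> (X + 1400) * N" unfolding tot by simp
    fix s1 a1 assume 1: "env s1"
      "same {''N'', ''B'', ''L'', ''K'', ''h'', ''g'', ''Z'', ''i''} {''T''} (init n m x) s1"
      "(X + 1400) * N \<le> a1 + 1000 * N"
    show "wp w prefix_com (wp w compress_com (wp w pad_com (wp w output_com
        (\<lambda>s a. \<exists>A. encodes x A \<and> (\<forall>i<N. arr s ''out'' i = of_bool (A ! i)))))) s1 a1"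
    proof (rule wp_prefix_com[OF 1(1)])
      show "30 * K + 60 \<le> a1" using 1(3) N1 unfolding tot by linarith
      fix s2 a2 assume 2: "same {''i'', ''a'', ''e'', ''c''} {''P''} s1 s2" "psum s2 V"
        "scal s2 ''c'' = K" "scal s2 ''a'' = 0" "scal s2 ''e'' = N" "a1 \<le> a2 + (30 * K + 60)"
      have env2: "env s2" by (rule env_same[OF 2(1) 1(1)]) auto
      have inp: "arr s2 ''in'' q = of_bool ((x @ [False]) ! q)" if "q < N" for q
        using 1(2) 2(1) that x by (auto simp: same_def init_def nth_append)
      have a2: "(110 * N + 30) + 10 + 80 * N + X * N \<le> a2" using 1(3) 2(6) N1 unfolding tot by linarith
      show "wp w compress_com (wp w pad_com (wp w output_com
        (\<lambda>s a. \<exists>A. encodes x A \<and> (\<forall>i<N. arr s ''out'' i = of_bool (A ! i))))) s2 a2"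
      proof (rule wp_compress_com[OF env2 x 2(2-5) inp a2])
        fix s3 a3 r P assume 3: "env s3" "reach x r P []" "psum s3 (V @ P)"
          "scal s3 ''c'' = K + length P" "110 * N + 30 \<le> a3"
        have len: "length P + g * r = N" using reach_length[OF 3(2)] x by simp
        have lenP: "length P = N \<or> length P + 2 \<le> N"
        proof (cases r)
          case (Suc q)
          then show ?thesis using len g_ge_2 by simp
        qed (use len in simp)
        have a3: "(30 * N + 10) + 10 + 80 * N \<le> a3" using 3(5) by simp
        show "wp w pad_com (wp w output_com
          (\<lambda>s a. \<exists>A. encodes x A \<and> (\<forall>i<N. arr s ''out'' i = of_bool (A ! i)))) s3 a3"
        proof (rule wp_pad_com[OF 3(1,3) lenP 3(4) a3])
          fix s4 a4 A assume 4: "env s4" "padded P A" "psum s4 (V @ A)" "30 * N + 10 \<le> a4"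
          have "length A = N" using 4(2) by (simp add: padded_def)
          moreover have "encodes x A" using 3(2) 4(2) unfolding encodes_def by blast
          ultimately show "wp w output_com
            (\<lambda>s a. \<exists>A. encodes x A \<and> (\<forall>i<N. arr s ''out'' i = of_bool (A ! i))) s4 a4"
            by (intro wp_output_com[OF 4(1,3) _ 4(4)]) auto
        qed
      qed
    qed
  qed
qed

end

section \<open>The decoder\<close>

definition load_com :: com where
  "load_com = (''i'' ::= Const 0) ;;
    While (Var ''i'' \<lessdot> Var ''K'')
      (Store ''P'' (Var ''i'') (Op Mod (Var ''i'') (Const 2)) ;; (''i'' ::= Var ''i'' \<oplus> Const 1)) ;;
    (''i'' ::= Const 0) ;;
    While (Var ''i'' \<lessdot> Var ''N'')
      (Store ''P'' (Var ''K'' \<oplus> Var ''i'') (Get ''in'' (Var ''i'')) ;; (''i'' ::= Var ''i'' \<oplus> Const 1))"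

text \<open>The search starts at the last bit but one, because the final padding bit is the mark and
  need not follow the period.\<close>

definition find_com :: com where
  "find_com = (''c'' ::= Var ''K'' \<oplus> Var ''N'' \<ominus> Const 2) ;;
    While (Get ''P'' (Var ''c'') \<doteq> Get ''P'' (Var ''c'' \<ominus> Var ''K'')) (''c'' ::= Var ''c'' \<ominus> Const 1) ;;
    (''r'' ::= Const 0) ;; (''e'' ::= Const 0)"

definition move_com :: com where
  "move_com = (''c'' ::= Var ''c'' \<ominus> Const 1) ;; Store ''R'' (Var ''r'') (Get ''P'' (Var ''c'')) ;;
    (''r'' ::= Var ''r'' \<oplus> Const 1)"

text \<open>\<open>L + 3\<close> is the length of the fixed part of a code: flag, letter and
  position.\<close>

definition expose_com :: com where
  "expose_com = While (Var ''r'' \<lessdot> Var ''e'' \<oplus> (Var ''L'' \<oplus> Const 3)) move_com"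

definition read_com :: "vname \<Rightarrow> expr \<Rightarrow> expr \<Rightarrow> com" where
  "read_com v b l = (''i'' ::= l) ;; (v ::= Const 0) ;;
    While (Const 0 \<lessdot> Var ''i'')
      ((''i'' ::= Var ''i'' \<ominus> Const 1) ;; (v ::= Var v \<oplus> Var v \<oplus> Get ''R'' (b \<oplus> Var ''i'')))"

text \<open>Runs over the window in the same direction as \<open>rank_com\<close>. \<open>d\<close>
  tells whether the bit is the frequent letter \<open>f\<close>, so the bit itself is the value of
  \<open>d = f\<close>.\<close>

definition unrank_com :: com where
  "unrank_com = (''t'' ::= Var ''h'' \<oplus> Const 1) ;; (''i'' ::= Var ''p'') ;;
    While (Var ''i'' \<lessdot> Var ''p'' \<oplus> Var ''K'')
      (If (Var ''i'' \<lessdot> Var ''K'') (''d'' ::= (Get ''P'' (Var ''i'') \<doteq> Var ''f''))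
        ((''y'' ::= Get ''T'' ((Var ''p'' \<oplus> Var ''K'' \<ominus> Const 1 \<ominus> Var ''i'') \<otimes> Var ''Z'' \<oplus> Var ''t'')) ;;
        If (Var ''z'' \<lessdot> Var ''y'') (''d'' ::= Const 0)
          ((''z'' ::= Var ''z'' \<ominus> Var ''y'') ;; (''d'' ::= Const 1)) ;;
        Store ''P'' (Var ''i'') (Var ''d'' \<doteq> Var ''f'')) ;;
      (''t'' ::= Var ''t'' \<ominus> Var ''d'') ;; (''i'' ::= Var ''i'' \<oplus> Const 1)) ;;
    (''c'' ::= Var ''p'' \<oplus> Var ''K'')"

text \<open>Raising \<open>e\<close> drops the code at the bottom of \<open>R\<close>. Before that,
  the boundary moves down to the height \<open>b\<close> that the stack had right after the pop,
  where the restored window belongs; only then the whole code, including its rank, is sure to lie in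
  \<open>R\<close>.\<close>

definition undo_com :: com where
  "undo_com = (''f'' ::= Get ''R'' (Var ''e'' \<oplus> Const 1)) ;;
    read_com ''p'' (Var ''e'' \<oplus> Const 2) (Var ''L'' \<oplus> Const 1) ;;
    (''j'' ::= Var ''p'') ;; If (Var ''K'' \<lessdot> Var ''p'') (''j'' ::= Var ''K'') Skip ;;
    (''b'' ::= Var ''K'' \<oplus> Var ''p'' \<ominus> Var ''j'') ;;
    While (Var ''b'' \<lessdot> Var ''c'') move_com ;;
    read_com ''z'' (Var ''e'' \<oplus> (Var ''L'' \<oplus> Const 3)) (Var ''j'' \<ominus> (Var ''L'' \<oplus> Const 3 \<oplus> Var ''g'')) ;;
    (''e'' ::= Var ''e'' \<oplus> (Var ''j'' \<ominus> Var ''g'')) ;;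
    unrank_com ;;
    expose_com"

definition flush_com :: com where
  "flush_com = While (Var ''e'' \<lessdot> Var ''r'')
    ((''r'' ::= Var ''r'' \<ominus> Const 1) ;; Store ''P'' (Var ''c'') (Get ''R'' (Var ''r'')) ;;
    (''c'' ::= Var ''c'' \<oplus> Const 1))"

definition recover_com :: com where
  "recover_com = find_com ;; expose_com ;; While (Get ''R'' (Var ''e'')) undo_com ;; flush_com"

definition decoder_core :: "nat \<Rightarrow> nat \<Rightarrow> nat \<Rightarrow> nat \<Rightarrow> com" where
  "decoder_core al be u v = prepare al be u v ;; load_com ;;
    If (Get ''in'' (Var ''N'' \<ominus> Const 1)) recover_com Skip"

text \<open>In contrast to the encoder the array holds plain bits: the decoder overwrites windows
  but never weighs them.\<close>

definition pbits :: "state \<Rightarrow> bool list \<Rightarrow> bool" where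
  "pbits s x \<longleftrightarrow> (\<forall>i<length x. arr s ''P'' i = of_bool (x ! i))"

context machine
begin

text \<open>
  The decoder keeps the sequence \<open>Q @ B\<close> as two stacks: \<open>P\<close> holds \<open>V @ Q\<close>, and \<open>R\<close> holds \<open>B\<close> in
  reverse above position \<open>e\<close>, so that codes are dropped at its bottom.
\<close>

definition stacks :: "state \<Rightarrow> bool list \<Rightarrow> bool list \<Rightarrow> bool" where
  "stacks s Q B \<longleftrightarrow> pbits s (V @ Q) \<and> scal s ''c'' = K + length Q \<and>
    scal s ''r'' = scal s ''e'' + length B \<and>
    (\<forall>q<length B. arr s ''R'' (scal s ''e'' + q) = of_bool (rev B ! q))"

section \<open>Correctness and cost of the decoder's parts\<close>

lemma wp_load_com:
  assumes env: "env s" and A: "length A = N" "\<And>i. i < N \<Longrightarrow> arr s ''in'' i = of_bool (A ! i)"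
    and a: "60 * N + 20 \<le> a"
    and Q: "\<And>s' a'. same {''i''} {''P''} s s' \<Longrightarrow> pbits s' (V @ A) \<Longrightarrow> a \<le> a' + (60 * N + 20) \<Longrightarrow> Q s' a'"
  shows "wp w load_com Q s a"
proof -
  note [simp] = of_bool_mod_exp[OF w_pos] wp_iffs one_le_diff_iff
  note word = word_2 w_pos
  let ?e1 = "Var ''i'' \<lessdot> Var ''K''"
  let ?b1 = "Store ''P'' (Var ''i'') (Op Mod (Var ''i'') (Const 2)) ;; (''i'' ::= Var ''i'' \<oplus> Const 1)"
  let ?e2 = "Var ''i'' \<lessdot> Var ''N''"
  let ?b2 = "Store ''P'' (Var ''K'' \<oplus> Var ''i'') (Get ''in'' (Var ''i'')) ;; (''i'' ::= Var ''i'' \<oplus> Const 1)"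
  have KN: "K \<le> N" by (rule K_le_N)
  define I1 where "I1 = (\<lambda>s' a'. same {''i''} {''P''} s s' \<and>
    (\<exists>i\<le>K. scal s' ''i'' = i \<and> (\<forall>q<i. arr s' ''P'' q = of_bool (odd q)) \<and> a \<le> a' + 30 * i + 5))"
  define I2 where "I2 = (\<lambda>s' a'. same {''i''} {''P''} s s' \<and>
    (\<exists>i\<le>N. scal s' ''i'' = i \<and> (\<forall>q<K + i. arr s' ''P'' q = of_bool ((V @ A) ! q)) \<and> a \<le> a' + 30 * N + 30 * i + 12))"
  have W2: "wp w (While ?e2 ?b2) Q s' a'" if "I2 s' a'" for s' a'
    using that
  proof (rule wp_While)
    fix s' a' assume I: "I2 s' a'" and c: "val w ?e2 s' \<noteq> 0"
    then obtain i where i: "same {''i''} {''P''} s s'" "i \<le> N" "scal s' ''i'' = i"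
      "\<forall>q<K + i. arr s' ''P'' q = of_bool ((V @ A) ! q)" "a \<le> a' + 30 * N + 30 * i + 12" unfolding I2_def by blast
    have sc: "scal s' ''N'' = N" "scal s' ''K'' = K" using env i(1) by (simp_all add: env_def same_def)
    have lt: "i < N" using c i(3) sc by simp
    have w2: "K + i < 2 ^ w" "i + 1 < 2 ^ w" using lt word_N by linarith+
    have "30 * i + 30 \<le> 30 * N" using lt by simp
    then have a': "35 \<le> a'" using i(5) a by linarith
    have inA: "arr s' ''in'' i = of_bool (A ! i)" using A(2)[OF lt] i(1) by (simp add: same_def)
    have VA: "(V @ A) ! (K + i) = A ! i" by (simp add: nth_append)
    have q: "q < K + i + 1 \<longleftrightarrow> q < K + i \<or> q = K + i" for q by auto
    have "I2 (s'\<lparr>arr := (arr s')(''P'' := (arr s' ''P'')(K + i := of_bool (A ! i))),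
        scal := (scal s')(''i'' := i + 1)\<rparr>) a2" if "a' \<le> a2 + 30" for a2
      unfolding I2_def same_def
    proof (intro conjI exI[of _ "i + 1"])
      show "a \<le> a2 + 30 * N + 30 * (i + 1) + 12" using that i(5) by simp
      show "\<forall>qa<K + (i + 1). arr (s'\<lparr>arr := (arr s')(''P'' := (arr s' ''P'')(K + i := of_bool (A ! i))),
        scal := (scal s')(''i'' := i + 1)\<rparr>) ''P'' qa = of_bool ((V @ A) ! qa)"
        using i(4) VA q by (simp add: add.assoc[symmetric])
    qed (use i(1) lt in \<open>simp_all add: same_def\<close>)
    then show "1 + cost ?e2 \<le> a' \<and> wp w ?b2 I2 s' (a' - (1 + cost ?e2))"
      using i(3) sc lt w2 word a' inA by simp
  next
    fix s' a' assume I: "I2 s' a'" and c: "val w ?e2 s' = 0"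
    then obtain i where i: "same {''i''} {''P''} s s'" "i \<le> N" "scal s' ''i'' = i"
      "\<forall>q<K + i. arr s' ''P'' q = of_bool ((V @ A) ! q)" "a \<le> a' + 30 * N + 30 * i + 12" unfolding I2_def by blast
    have "scal s' ''N'' = N" using env i(1) by (simp add: env_def same_def)
    then have "i = N" using c i(2,3) word by simp
    then have "pbits s' (V @ A)" using i(4) A(1) unfolding pbits_def by simp
    then show "1 + cost ?e2 \<le> a' \<and> Q s' (a' - (1 + cost ?e2))"
      using i(1,5) a \<open>i = N\<close> by (auto intro!: Q)
  qed
  let ?rest = "(''i'' ::= Const 0) ;; While ?e2 ?b2"
  have "wp w (While ?e1 ?b1) (wp w ?rest Q) s' a'" if "I1 s' a'" for s' a'
    using that
  proof (rule wp_While)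
    fix s' a' assume I: "I1 s' a'" and c: "val w ?e1 s' \<noteq> 0"
    then obtain i where i: "same {''i''} {''P''} s s'" "i \<le> K" "scal s' ''i'' = i"
      "\<forall>q<i. arr s' ''P'' q = of_bool (odd q)" "a \<le> a' + 30 * i + 5" unfolding I1_def by blast
    have sc: "scal s' ''K'' = K" using env i(1) by (simp_all add: env_def same_def)
    have lt: "i < K" using c i(3) sc by simp
    have w2: "i < 2 ^ w" "i + 1 < 2 ^ w" using lt word_N by linarith+
    have m2: "i mod 2 = of_bool (odd i)" by (simp add: mod_2_eq_odd)
    have "30 * i + 30 \<le> 30 * N" using lt KN by simp
    then have a': "35 \<le> a'" using i(5) a by linarith
    have "I1 (s'\<lparr>arr := (arr s')(''P'' := (arr s' ''P'')(i := of_bool (odd i))),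
        scal := (scal s')(''i'' := i + 1)\<rparr>) a2" if "a' \<le> a2 + 30" for a2
      unfolding I1_def using that i(1,4,5) lt by (auto simp: same_def less_add_one_iff)
    then show "1 + cost ?e1 \<le> a' \<and> wp w ?b1 I1 s' (a' - (1 + cost ?e1))"
      using i(3) sc lt w2 word a' m2 by simp
  next
    fix s' a' assume I: "I1 s' a'" and c: "val w ?e1 s' = 0"
    then obtain i where i: "same {''i''} {''P''} s s'" "i \<le> K" "scal s' ''i'' = i"
      "\<forall>q<i. arr s' ''P'' q = of_bool (odd q)" "a \<le> a' + 30 * i + 5" unfolding I1_def by blast
    have "scal s' ''K'' = K" using env i(1) by (simp add: env_def same_def)
    then have iK: "i = K" using c i(2,3) word by simp
    have "30 * i \<le> 30 * N" using KN iK by simp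
    then have a': "10 \<le> a'" using i(5) a by linarith
    have "I2 (s'\<lparr>scal := (scal s')(''i'' := 0)\<rparr>) (a' - 6)"
      unfolding I2_def same_def
    proof (intro conjI exI[of _ 0])
      show "a \<le> a' - 6 + 30 * N + 30 * 0 + 12" using i(5) a' \<open>30 * i \<le> 30 * N\<close> by linarith
    qed (use i(1,4) iK in \<open>simp_all add: same_def nth_append alternating_def\<close>)
    then show "1 + cost ?e1 \<le> a' \<and> wp w ?rest Q s' (a' - (1 + cost ?e1))"
      using W2 a' by simp
  qed
  moreover have "I1 (s\<lparr>scal := (scal s)(''i'' := 0)\<rparr>) (a - 2)"
    unfolding I1_def using a by (simp add: same_def)
  ultimately show ?thesis unfolding load_com_def using a by simp
qed

lemma wp_find_com:
  assumes env: "env s" and A: "padded P A" "pbits s (V @ A)" "length P + 2 \<le> N"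
    and a: "20 * N + 30 \<le> a"
    and Q: "\<And>s' a'. same {''c'', ''r'', ''e''} {} s s' \<Longrightarrow> stacks s' P [] \<Longrightarrow> scal s' ''e'' = 0 \<Longrightarrow>
      a \<le> a' + (20 * N + 30) \<Longrightarrow> Q s' a'"
  shows "wp w find_com Q s a"
proof -
  note [simp] = of_bool_mod_exp[OF w_pos] wp_iffs one_le_diff_iff
  note word = word_2 w_pos
  define p where "p = length P"
  have lenA: "length A = N" using A(1) by (simp add: padded_def)
  have pN: "p + 2 \<le> N" using A(3) by (simp add: p_def)
  let ?X = "V @ A"
  \<comment> \<open>The mismatch at \<open>p\<close> stops the search, and no position from
    \<open>p + 1\<close> to \<open>N - 2\<close> stops it earlier.\<close>
  have ne: "?X ! (K + p) \<noteq> ?X ! p" and eq: "\<And>i. p < i \<Longrightarrow> i < N - 1 \<Longrightarrow> ?X ! (K + i) = ?X ! i"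
    using A(1) pN unfolding padded_def p_def by auto
  let ?e = "Get ''P'' (Var ''c'') \<doteq> Get ''P'' (Var ''c'' \<ominus> Var ''K'')"
  let ?b = "''c'' ::= Var ''c'' \<ominus> Const 1"
  let ?r = "(''r'' ::= Const 0) ;; (''e'' ::= Const 0)"
  define I where "I = (\<lambda>s' a'. same {''c''} {} s s' \<and>
    (\<exists>i. p \<le> i \<and> i + 2 \<le> N \<and> scal s' ''c'' = K + i \<and> 20 * i + 20 \<le> a' \<and> a \<le> a' + 20 * (N - i) + 10))"
  have "wp w (While ?e ?b) (wp w ?r Q) s' a'" if "I s' a'" for s' a'
    using that
  proof (rule wp_While)
    fix s' a' assume I: "I s' a'" and c: "val w ?e s' \<noteq> 0"
    then obtain i where i: "same {''c''} {} s s'" "p \<le> i" "i + 2 \<le> N" "scal s' ''c'' = K + i"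
      "20 * i + 20 \<le> a'" "a \<le> a' + 20 * (N - i) + 10" unfolding I_def by blast
    have sc: "scal s' ''K'' = K" using env i(1) by (simp add: env_def same_def)
    have arrs: "arr s' ''P'' (K + i) = of_bool (?X ! (K + i))" "arr s' ''P'' i = of_bool (?X ! i)"
      using A(2) i(1,3) lenA unfolding pbits_def same_def by simp_all
    have w2: "i < 2 ^ w" "K + i < 2 ^ w" "K + i - 1 < 2 ^ w" using i(3) word_N by linarith+
    have "arr s' ''P'' (K + i) = arr s' ''P'' i" using c i(4) sc w2 by (simp split: if_splits)
    then have "?X ! (K + i) = ?X ! i" unfolding arrs of_bool_eq_iff .
    then have "i \<noteq> p" using ne by auto
    then obtain k where k: "i = k + 1" using i(2) by (metis Suc_eq_plus1 gr0_implies_Suc le_neq_implies_less less_nat_zero_code not_gr_zero)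
    have "I (s'\<lparr>scal := (scal s')(''c'' := K + k)\<rparr>) a2" if "a' \<le> a2 + 20" for a2
      unfolding I_def
    proof (intro conjI exI[of _ k])
      show "same {''c''} {} s (s'\<lparr>scal := (scal s')(''c'' := K + k)\<rparr>)" using i(1) by (simp add: same_def)
    qed (use that i k \<open>i \<noteq> p\<close> in simp_all)
    then show "1 + cost ?e \<le> a' \<and> wp w ?b I s' (a' - (1 + cost ?e))"
      using i(4,5) sc w2 word k by simp
  next
    fix s' a' assume I: "I s' a'" and c: "val w ?e s' = 0"
    then obtain i where i: "same {''c''} {} s s'" "p \<le> i" "i + 2 \<le> N" "scal s' ''c'' = K + i"
      "20 * i + 20 \<le> a'" "a \<le> a' + 20 * (N - i) + 10" unfolding I_def by blast
    have sc: "scal s' ''K'' = K" using env i(1) by (simp add: env_def same_def)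
    have arrs: "arr s' ''P'' (K + i) = of_bool (?X ! (K + i))" "arr s' ''P'' i = of_bool (?X ! i)"
      using A(2) i(1,3) lenA unfolding pbits_def same_def by simp_all
    have w2: "i < 2 ^ w" using i(3) word_N by linarith
    have "arr s' ''P'' (K + i) \<noteq> arr s' ''P'' i" using c i(4) sc w2 w_pos by (simp split: if_splits)
    then have "?X ! (K + i) \<noteq> ?X ! i" unfolding arrs of_bool_eq_iff .
    then have ip: "i = p" using eq[of i] i(2,3) by (cases "i = p") auto
    have "pbits s (V @ P)"
      unfolding pbits_def
    proof (intro allI impI)
      fix q assume q: "q < length (V @ P)"
      have "(V @ P) ! q = (V @ take p A) ! q" using A(1) by (simp add: padded_def p_def)
      also have "\<dots> = (V @ A) ! q" using q lenA A(3) by (simp add: nth_append p_def)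
      finally show "arr s ''P'' q = of_bool ((V @ P) ! q)"
        using A(2) q lenA A(3) by (simp add: pbits_def)
    qed
    then have "stacks (s'\<lparr>scal := (scal s')(''r'' := 0, ''e'' := 0)\<rparr>) P []"
      using i(1,4) ip unfolding stacks_def pbits_def same_def by (simp add: p_def)
    moreover have "same {''c'', ''r'', ''e''} {} s (s'\<lparr>scal := (scal s')(''r'' := 0, ''e'' := 0)\<rparr>)"
      using i(1) by (simp add: same_def)
    moreover have "a \<le> a2 + (20 * N + 30)" if "a' \<le> a2 + 20" for a2
    proof -
      have "20 * (N - i) \<le> 20 * N" by simp
      with that i(6) show ?thesis by linarith
    qed
    ultimately have "Q (s'\<lparr>scal := (scal s')(''r'' := 0, ''e'' := 0)\<rparr>) a2" if "a' \<le> a2 + 20" for a2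
      using that by (intro Q) auto
    then show "1 + cost ?e \<le> a' \<and> wp w ?r Q s' (a' - (1 + cost ?e))"
      using i(5) by simp
  qed
  moreover have "I (s\<lparr>scal := (scal s)(''c'' := K + (N - 2))\<rparr>) (a - 6)"
    unfolding I_def
  proof (intro conjI exI[of _ "N - 2"])
  qed (use pN a in \<open>auto simp: same_def\<close>)
  moreover have "K + N - 2 = K + (N - 2)" "K + N < 2 ^ w" "K + N - 2 < 2 ^ w" using pN word_N by linarith+
  moreover have "scal s ''K'' = K" "scal s ''N'' = N" using env by (simp_all add: env_def)
  ultimately show ?thesis unfolding find_com_def using a word by simp
qed

text \<open>Any guard will do that compares the size of the second stack with a fixed
  \<open>t\<close>: exposing a code bounds \<open>r\<close> from below, undoing one bounds
  \<open>c\<close> from above.\<close>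

lemma wp_move_while:
  assumes st: "stacks s Q B" and t: "t \<le> length (Q @ B)" and e: "scal s ''e'' + length (Q @ B) < 2 ^ w"
    and S: "K + length (Q @ B) < 2 ^ w"
    and c: "\<And>s' Q' B'. same {''c'', ''r''} {''R''} s s' \<Longrightarrow> stacks s' Q' B' \<Longrightarrow> Q' @ B' = Q @ B \<Longrightarrow>
      val w ce s' \<noteq> 0 \<longleftrightarrow> length B' < t"
    and cost: "cost ce \<le> 10" and a: "30 * (t - length B) + 20 \<le> a"
    and Q: "\<And>s' a' Q' B'. same {''c'', ''r''} {''R''} s s' \<Longrightarrow> stacks s' Q' B' \<Longrightarrow> Q' @ B' = Q @ B \<Longrightarrow>
      length B' = max (length B) t \<Longrightarrow> a \<le> a' + (30 * (t - length B) + 20) \<Longrightarrow> F s' a'"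
  shows "wp w (While ce move_com) F s a"
proof -
  note [simp] = of_bool_mod_exp[OF w_pos] wp_iffs one_le_diff_iff
  note word = word_2 w_pos
  define I where "I = (\<lambda>s' a'. same {''c'', ''r''} {''R''} s s' \<and>
    (\<exists>Q' B'. stacks s' Q' B' \<and> Q' @ B' = Q @ B \<and> length B \<le> length B' \<and> length B' \<le> max (length B) t \<and>
      30 * (t - length B') + 20 \<le> a' \<and> a + 30 * (t - length B') \<le> a' + 30 * (t - length B)))"
  have "I s a" unfolding I_def using st a same_refl by (intro conjI exI[of _ Q] exI[of _ B]) auto
  then show ?thesis
  proof (rule wp_While)
    fix s' a' assume I: "I s' a'" and v: "val w ce s' \<noteq> 0"
    then obtain Q' B' where i: "same {''c'', ''r''} {''R''} s s'" "stacks s' Q' B'" "Q' @ B' = Q @ B"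
      "length B \<le> length B'" "length B' \<le> max (length B) t"
      "30 * (t - length B') + 20 \<le> a'" "a + 30 * (t - length B') \<le> a' + 30 * (t - length B)"
      unfolding I_def by blast
    have lt: "length B' < t" using c[OF i(1-3)] v by blast
    have lens: "length Q' + length B' = length (Q @ B)" unfolding i(3)[symmetric] by simp
    have "Q' \<noteq> []" using lt t i(3) by (cases Q') auto
    then obtain Q2 b where Q2: "Q' = Q2 @ [b]" by (metis rev_exhaust)
    have se: "scal s' ''e'' = scal s ''e''" using i(1) by (simp add: same_def)
    have sc: "scal s' ''c'' = K + length Q2 + 1" "scal s' ''r'' = scal s ''e'' + length B'"
      using i(2) se unfolding stacks_def Q2 by simp_all
    have "(V @ Q2 @ [b]) ! (K + length Q2) = b" by (simp add: nth_append)
    moreover have "K + length Q2 < length (V @ Q')" using Q2 by simp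
    then have "arr s' ''P'' (K + length Q2) = of_bool ((V @ Q') ! (K + length Q2))"
      using i(2) unfolding stacks_def pbits_def by blast
    ultimately have bit: "arr s' ''P'' (K + length Q2) = of_bool b" unfolding Q2 by simp
    have w2: "K + length Q2 < 2 ^ w" "scal s ''e'' + length B' + 1 < 2 ^ w"
      using lens S e lt t unfolding Q2 by simp_all
    define s2 where "s2 = s'\<lparr>arr := (arr s')(''R'' := (arr s' ''R'')(scal s ''e'' + length B' := of_bool b)),
      scal := (scal s')(''c'' := K + length Q2, ''r'' := scal s ''e'' + length B' + 1)\<rparr>"
    have st2: "stacks s2 Q2 (b # B')"
      unfolding stacks_def
    proof (intro conjI allI impI)
      show "pbits s2 (V @ Q2)"
        using i(2) unfolding stacks_def pbits_def s2_def Q2 by (auto simp: nth_append)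
      fix q assume q: "q < length (b # B')"
      then show "arr s2 ''R'' (scal s2 ''e'' + q) = of_bool (rev (b # B') ! q)"
        using i(2) se unfolding stacks_def s2_def by (auto simp: nth_append)
    qed (use se in \<open>simp_all add: s2_def\<close>)
    have "same {''c'', ''r''} {''R''} s s2" using i(1) by (simp add: s2_def same_def)
    moreover have "Q2 @ b # B' = Q @ B" "length B \<le> length (b # B')" "length (b # B') \<le> max (length B) t"
      using i(3-5) lt Q2 by simp_all
    moreover have "30 * (t - length (b # B')) + 20 \<le> a2"
      "a + 30 * (t - length (b # B')) \<le> a2 + 30 * (t - length B)" if "a' \<le> a2 + 30" for a2
      using i(6,7) that lt by simp_all
    ultimately have "I s2 a2" if "a' \<le> a2 + 30" for a2
      unfolding I_def using st2 that by blast
    moreover have "50 \<le> a'" using i(6) lt by simp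
    moreover have "K + length Q2 + 1 - 1 = K + length Q2" by simp
    ultimately show "1 + cost ce \<le> a' \<and> wp w move_com I s' (a' - (1 + cost ce))"
      unfolding move_com_def using sc bit w2 word cost by (simp add: s2_def)
  next
    fix s' a' assume I: "I s' a'" and v: "val w ce s' = 0"
    then obtain Q' B' where i: "same {''c'', ''r''} {''R''} s s'" "stacks s' Q' B'" "Q' @ B' = Q @ B"
      "length B \<le> length B'" "length B' \<le> max (length B) t"
      "30 * (t - length B') + 20 \<le> a'" "a + 30 * (t - length B') \<le> a' + 30 * (t - length B)"
      unfolding I_def by blast
    have "\<not> length B' < t" using c[OF i(1-3)] v by blast
    then have "length B' = max (length B) t" using i(4,5) by simp
    then show "1 + cost ce \<le> a' \<and> F s' (a' - (1 + cost ce))"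
      using i cost by (auto intro!: Q[of _ Q' B'])
  qed
qed


text \<open>Horner's scheme from the highest bit down. \<open>base\<close> must keep its value while
  the counter and \<open>dst\<close> change.\<close>

lemma wp_read_com:
  assumes bs: "length bs = l" "\<And>q. q < l \<Longrightarrow> arr s ''R'' (bv + q) = of_bool (bs ! q)"
    and b: "\<And>s'. same {''i'', dst} {} s s' \<Longrightarrow> val w base s' = bv" "cost base \<le> 10"
    and cnt: "val w cnt s = l" "cost cnt \<le> 10" and dst: "dst \<noteq> ''i''"
    and bnd: "bv + l < 2 ^ w" "2 * 2 ^ l \<le> (2::nat) ^ w"
    and a: "40 * l + 30 \<le> a"
    and Q: "\<And>s' a'. same {''i'', dst} {} s s' \<Longrightarrow> scal s' dst = num bs \<Longrightarrow>
      a \<le> a' + (40 * l + 30) \<Longrightarrow> F s' a'"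
  shows "wp w (read_com dst base cnt) F s a"
proof -
  note [simp] = of_bool_mod_exp[OF w_pos] wp_iffs one_le_diff_iff
  note word = word_2 w_pos
  let ?e = "Const 0 \<lessdot> Var ''i''"
  let ?b = "(''i'' ::= Var ''i'' \<ominus> Const 1) ;; (dst ::= Var dst \<oplus> Var dst \<oplus> Get ''R'' (base \<oplus> Var ''i''))"
  define I where "I = (\<lambda>s' a'. same {''i'', dst} {} s s' \<and>
    (\<exists>i\<le>l. scal s' ''i'' = i \<and> scal s' dst = num (drop i bs) \<and> 40 * i + 10 \<le> a' \<and> a + 40 * i \<le> a' + 40 * l + 20))"
  have "wp w (While ?e ?b) F s' a'" if "I s' a'" for s' a'
    using that
  proof (rule wp_While)
    fix s' a' assume I: "I s' a'" and c: "val w ?e s' \<noteq> 0"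
    then obtain i where i: "same {''i'', dst} {} s s'" "i \<le> l" "scal s' ''i'' = i" "scal s' dst = num (drop i bs)"
      "40 * i + 10 \<le> a'" "a + 40 * i \<le> a' + 40 * l + 20" unfolding I_def by blast
    have "i \<noteq> 0" using c i(3) by simp
    then obtain k where k: "i = k + 1" by (metis Suc_eq_plus1 not0_implies_Suc)
    have kl: "k < l" using i(2) k by simp
    have "drop k bs = bs ! k # drop i bs" using kl bs(1) k by (simp add: Cons_nth_drop_Suc flip: Suc_eq_plus1)
    then have nk: "num (drop k bs) = of_bool (bs ! k) + 2 * num (drop i bs)" by simp
    have "num (drop k bs) < 2 ^ length (drop k bs)" by (rule num_less)
    also have "\<dots> \<le> 2 ^ l" using bs(1) by (intro power_increasing) auto
    finally have nw: "num (drop k bs) < 2 ^ w" "num (drop i bs) + num (drop i bs) < 2 ^ w"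
      using bnd(2) nk by linarith+
    define s1 where "s1 = s'\<lparr>scal := (scal s')(''i'' := k)\<rparr>"
    have bv: "val w base s1 = bv" using i(1) by (intro b(1)) (simp add: s1_def same_def)
    have R: "arr s' ''R'' (bv + k) = of_bool (bs ! k)" using bs(2)[OF kl] i(1) by (simp add: same_def)
    have vs1: "scal s1 dst = num (drop i bs)" "scal s1 ''i'' = k" "arr s1 = arr s'"
      using i(4) dst by (simp_all add: s1_def)
    have bw: "bv + k < 2 ^ w" "k < 2 ^ w" using bnd(1) kl by linarith+
    have val: "val w (Var dst \<oplus> Var dst \<oplus> Get ''R'' (base \<oplus> Var ''i'')) s1 = num (drop k bs)"
      using nw(1) unfolding nk val.simps binop_val.simps vs1 bv mod_less[OF nw(2)] mod_less[OF bw(1)] R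
      by (simp add: add.commute mult_2)
    have J: "I (s'\<lparr>scal := (scal s')(''i'' := k, dst := num (drop k bs))\<rparr>) a2" if "a' \<le> a2 + 40" for a2
      unfolding I_def
    proof (intro conjI exI[of _ k])
      show "same {''i'', dst} {} s (s'\<lparr>scal := (scal s')(''i'' := k, dst := num (drop k bs))\<rparr>)"
        using i(1) by (simp add: same_def)
    qed (use that i(5,6) k kl dst in simp_all)
    have "wp w (dst ::= Var dst \<oplus> Var dst \<oplus> Get ''R'' (base \<oplus> Var ''i'')) I s1 (a' - 8)"
      unfolding wp_Assign_iff val
    proof
      have "1 + cost (Var dst \<oplus> Var dst \<oplus> Get ''R'' (base \<oplus> Var ''i'')) = 8 + cost base" by simp
      then show "1 + cost (Var dst \<oplus> Var dst \<oplus> Get ''R'' (base \<oplus> Var ''i'')) \<le> a' - 8"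
        "I (s1\<lparr>scal := (scal s1)(dst := num (drop k bs))\<rparr>) (a' - 8 - (1 + cost (Var dst \<oplus> Var dst \<oplus> Get ''R'' (base \<oplus> Var ''i''))))"
        using b(2) i(5) k J by (simp_all add: s1_def)
    qed
    then show "1 + cost ?e \<le> a' \<and> wp w ?b I s' (a' - (1 + cost ?e))"
      using i(3,5) k bw word unfolding s1_def by (simp del: wp_Assign_iff add: wp_Assign_iff[where x = "''i''"])
  next
    fix s' a' assume I: "I s' a'" and c: "val w ?e s' = 0"
    then obtain i where i: "same {''i'', dst} {} s s'" "i \<le> l" "scal s' ''i'' = i" "scal s' dst = num (drop i bs)"
      "40 * i + 10 \<le> a'" "a + 40 * i \<le> a' + 40 * l + 20" unfolding I_def by blast
    have "i = 0" using c i(3) w_pos by (simp split: if_splits)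
    then show "1 + cost ?e \<le> a' \<and> F s' (a' - (1 + cost ?e))"
      using i by (auto intro!: Q)
  qed
  moreover have "I (s\<lparr>scal := (scal s)(''i'' := l, dst := 0)\<rparr>) a2" if "a \<le> a2 + 15" for a2
    unfolding I_def using a that dst bs(1) by (auto simp: same_def)
  ultimately show ?thesis
    unfolding read_com_def using a cnt by simp
qed

text \<open>The invariant mirrors that of \<open>wp_rank_com\<close>: with the current threshold,
  the part of the rank left in \<open>z\<close> decodes to the rest of the window. Virtual bits are
  read, not decoded, and bring the threshold to \<open>need\<close>.\<close>

lemma wp_unrank_com:
  assumes env: "env s" and P: "pbits s (V @ take (length P - K) P)" "length P \<le> N" "bad f P"
    and s: "scal s ''p'' = length P" "scal s ''f'' = of_bool f" "scal s ''z'' = tail_rank f P"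
    and a: "80 * K + 40 \<le> a"
    and Q: "\<And>s' a'. same {''t'', ''z'', ''i'', ''d'', ''y'', ''c''} {''P''} s s' \<Longrightarrow> pbits s' (V @ P) \<Longrightarrow>
      scal s' ''c'' = K + length P \<Longrightarrow> a \<le> a' + (80 * K + 40) \<Longrightarrow> F s' a'"
  shows "wp w unrank_com F s a"
proof -
  note [simp] = of_bool_mod_exp[OF w_pos] wp_iffs one_le_diff_iff
  note word = word_2 w_pos
  define x where "x = V @ P"
  define p where "p = length P"
  define tt where "tt = (\<lambda>i. h + 1 - count_list (take (i - p) (drop p x)) f)"
  define rest where "rest = (\<lambda>i. map (\<lambda>b. b = f) (drop (max i K) x))"
  have len: "length x = K + p" by (simp add: x_def p_def)
  have tt_Suc: "tt (i + 1) = tt i - of_bool (x ! i = f)" if "p \<le> i" "i < K + p" for i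
  proof -
    have "take (i + 1 - p) (drop p x) = take (i - p) (drop p x) @ [x ! i]"
      using that len by (simp add: take_Suc_conv_app_nth Suc_diff_le flip: Suc_eq_plus1)
    then show ?thesis by (simp add: tt_def)
  qed
  have init: "unrank (p + K - max p K) (tt (max p K)) (tail_rank f P) = rest p"
  proof -
    have "map (\<lambda>b. b = f) (map (\<lambda>b. b = f) ys) = ys" for ys by (cases f) (simp_all add: comp_def)
    with tail_of_rank[OF P(3)] have *: "unrank (min p K) (need f p) (tail_rank f P) = map (\<lambda>b. b = f) (drop (p - K) P)"
      unfolding p_def by metis
    show ?thesis
    proof (cases "K \<le> p")
      case True
      then have "drop p x = drop (p - K) P" "need f p = h + 1" by (simp_all add: x_def need_def)
      then show ?thesis using True * by (simp add: rest_def tt_def max.absorb1 min.absorb2)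
    next
      case False
      then have "take (K - p) (drop p x) = drop p V" by (simp add: x_def)
      then show ?thesis using False * by (simp add: rest_def tt_def max.absorb2 min.absorb1 need_def x_def)
    qed
  qed
  have "tail_rank f P < 2 ^ K"
    by (rule less_le_trans[OF tail_rank_bound(1)[OF P(3)]]) (intro power_increasing, auto)
  then have rank_w: "tail_rank f P < 2 ^ w" using word_T by linarith
  let ?e = "Var ''i'' \<lessdot> Var ''p'' \<oplus> Var ''K''"
  let ?g = "Get ''T'' ((Var ''p'' \<oplus> Var ''K'' \<ominus> Const 1 \<ominus> Var ''i'') \<otimes> Var ''Z'' \<oplus> Var ''t'')"
  let ?b = "If (Var ''i'' \<lessdot> Var ''K'') (''d'' ::= (Get ''P'' (Var ''i'') \<doteq> Var ''f''))
        ((''y'' ::= ?g) ;;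
        If (Var ''z'' \<lessdot> Var ''y'') (''d'' ::= Const 0)
          ((''z'' ::= Var ''z'' \<ominus> Var ''y'') ;; (''d'' ::= Const 1)) ;;
        Store ''P'' (Var ''i'') (Var ''d'' \<doteq> Var ''f'')) ;;
      (''t'' ::= Var ''t'' \<ominus> Var ''d'') ;; (''i'' ::= Var ''i'' \<oplus> Const 1)"
  define I where "I = (\<lambda>s' a'. same {''t'', ''z'', ''i'', ''d'', ''y''} {''P''} s s' \<and>
    (\<exists>i z. p \<le> i \<and> i \<le> K + p \<and> scal s' ''i'' = i \<and> scal s' ''t'' = tt i \<and> scal s' ''z'' = z \<and> z < 2 ^ w \<and>
      unrank (p + K - max i K) (tt (max i K)) z = rest i \<and>
      (\<forall>q<max i K. arr s' ''P'' q = of_bool (x ! q)) \<and> a + 80 * p \<le> a' + 80 * i + 15))"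
  have II: "I s2 a2" if "same {''t'', ''z'', ''i'', ''d'', ''y''} {''P''} s s2" "p \<le> i" "i \<le> K + p"
    "scal s2 ''i'' = i" "scal s2 ''t'' = tt i" "scal s2 ''z'' = z" "z < 2 ^ w"
    "unrank (p + K - max i K) (tt (max i K)) z = rest i" "\<forall>q<max i K. arr s2 ''P'' q = of_bool (x ! q)"
    "a + 80 * p \<le> a2 + 80 * i + 15" for s2 a2 i z
    unfolding I_def using that by blast
  have tt_le: "tt i \<le> K" for i using h_less_K by (simp add: tt_def)
  have "wp w (While ?e ?b) (wp w (''c'' ::= Var ''p'' \<oplus> Var ''K'') F) s' a'" if "I s' a'" for s' a'
    using that
  proof (rule wp_While)
    fix s' a' assume I: "I s' a'" and c: "val w ?e s' \<noteq> 0"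
    then obtain i z where i: "same {''t'', ''z'', ''i'', ''d'', ''y''} {''P''} s s'" "p \<le> i" "i \<le> K + p" "scal s' ''i'' = i"
      "scal s' ''t'' = tt i" "scal s' ''z'' = z" "z < 2 ^ w" "unrank (p + K - max i K) (tt (max i K)) z = rest i"
      "\<forall>q<max i K. arr s' ''P'' q = of_bool (x ! q)" "a + 80 * p \<le> a' + 80 * i + 15"
      unfolding I_def by blast
    have params': "scal s' ''p'' = p" "scal s' ''K'' = K" "scal s' ''Z'' = K + 2" "scal s' ''f'' = of_bool f"
      using i(1) env s unfolding same_def env_def p_def by simp_all
    have pK: "p + K < 2 ^ w" using P(2) word_N unfolding p_def by linarith
    have lt: "i < K + p" using c i(4) params' pK by simp
    have iw: "i + 1 < 2 ^ w" "i < 2 ^ w" using lt pK by linarith+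
    have "80 * i + 80 \<le> 80 * K + 80 * p" using lt by simp
    then have a': "80 \<le> a'" using i(10) a by linarith
    have tt1: "tt (i + 1) = tt i - of_bool (x ! i = f)" by (rule tt_Suc[OF i(2) lt])
    have ttw: "tt (i + 1) < 2 ^ w" "tt i < 2 ^ w" using tt_le[of i] tt_le[of "i + 1"] word_K by linarith+
    show "1 + cost ?e \<le> a' \<and> wp w ?b I s' (a' - (1 + cost ?e))"
    proof (cases "i < K")
      case True
      have Pi: "arr s' ''P'' i = of_bool (x ! i)" using i(9) True by simp
      have mx: "max i K = K" "max (i + 1) K = K" using True by simp_all
      have J: "I (s'\<lparr>scal := (scal s')(''d'' := d, ''t'' := tt (i + 1), ''i'' := i + 1)\<rparr>) a2"
        if "a' \<le> a2 + 80" for a2 d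
      proof (rule II[where i = "i + 1" and z = z])
        show "same {''t'', ''z'', ''i'', ''d'', ''y''} {''P''} s
            (s'\<lparr>scal := (scal s')(''d'' := d, ''t'' := tt (i + 1), ''i'' := i + 1)\<rparr>)"
          using i(1) by (simp add: same_def)
        show "unrank (p + K - max (i + 1) K) (tt (max (i + 1) K)) z = rest (i + 1)"
          using i(8) unfolding rest_def mx .
      qed (use that i lt mx in simp_all)
      show ?thesis
        using a' i(4,5) params' pK True J Pi iw tt1 ttw word by (cases "x ! i"; cases f; simp)
    next
      case False
      define k where "k = p + K - 1 - i"
      define T where "T = tails k (tt i)"
      have k: "p + K - i = Suc k" "p + K - (i + 1) = k" "k \<le> K" using lt i(2) by (simp_all add: k_def)
      have mx: "max i K = i" "max (i + 1) K = i + 1" using False by simp_all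
      have "drop i x = x ! i # drop (i + 1) x"
        using lt len by (simp add: Cons_nth_drop_Suc flip: Suc_eq_plus1)
      then have rest_i: "rest i = (x ! i = f) # rest (i + 1)" unfolding rest_def mx by simp
      have T: "arr s' ''T'' (k * (K + 2) + tt i) = T"
        using env i(1) k(3) tt_le[of i] unfolding env_def same_def T_def by simp
      have "T \<le> 2 ^ k" unfolding T_def by (rule tails_le)
      also have "(2::nat) ^ k \<le> 2 ^ K" using k(3) by (intro power_increasing) auto
      finally have Tw: "T < 2 ^ w" using word_T by linarith
      have un: "unrank (Suc k) (tt i) z = (x ! i = f) # rest (i + 1)" using i(8) unfolding mx k(1) rest_i .
      have "k * (K + 2) \<le> K * (K + 2)" using k(3) by (rule mult_le_mono1)
      then have ix: "k * (K + 2) + tt i < 2 ^ w" "k * (K + 2) < 2 ^ w"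
        using tt_le[of i] word_K unfolding add_mult_distrib by linarith+
      have kd: "p + K - (1 + i) = k" by (simp add: k_def)
      have kw: "p + K - 1 < 2 ^ w" "p + K - 1 - i < 2 ^ w" using pK by linarith+
      have J: "I s2 a2" if "same {''t'', ''z'', ''i'', ''d'', ''y''} {''P''} s s2" "scal s2 ''i'' = i + 1"
        "scal s2 ''t'' = tt (i + 1)" "scal s2 ''z'' = z'" "z' < 2 ^ w" "unrank k (tt (i + 1)) z' = rest (i + 1)"
        "arr s2 ''P'' = (arr s' ''P'')(i := of_bool (x ! i))" "a' \<le> a2 + 80" for s2 a2 z'
      proof (rule II[where i = "i + 1" and z = z'])
        show "unrank (p + K - max (i + 1) K) (tt (max (i + 1) K)) z' = rest (i + 1)"
          using that(6) unfolding mx k(2) .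
        show "\<forall>q<max (i + 1) K. arr s2 ''P'' q = of_bool (x ! q)"
          using i(9) that(7) mx by (auto simp: less_add_one_iff)
      qed (use that i lt in simp_all)
      have vT: "val w ?g s' = T"
        unfolding val.simps binop_val.simps params' i(4,5) using word pK kw ix T
        by (simp add: kd)
      show ?thesis
      proof (cases "z < T")
        case low: True
        then have e: "x ! i \<noteq> f" "unrank k (tt i) z = rest (i + 1)" using un by (simp_all add: T_def)
        have fx: "of_bool (x ! i) = (if f then 0 else 1 :: nat)" using e(1) by (cases f) simp_all
        have tt2: "tt (i + 1) = tt i" using tt1 e(1) by simp
        show ?thesis
          using a' i(4,5,6,7) params' pK False iw ttw word low vT Tw
          apply (simp del: val.simps(3))
          apply (cases f)
           apply simp_all
           apply (rule J[where z' = z]; use i(1,6,7) e tt2 fx in \<open>simp add: same_def\<close>)+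
          done
      next
        case high: False
        then have e: "x ! i = f" "unrank k (tt i - 1) (z - T) = rest (i + 1)" using un by (simp_all add: T_def)
        have zw: "z - T < 2 ^ w" using i(7) by linarith
        have tt2: "tt (i + 1) = tt i - 1" using tt1 e(1) by simp
        show ?thesis
          using a' i(4,5,6,7) params' pK False iw ttw word high vT Tw zw
          apply (simp del: val.simps(3))
          apply (cases f)
           apply simp_all
           apply (rule J[where z' = "z - T"]; use i(1,6,7) e tt2 zw in \<open>simp add: same_def\<close>)+
          done
      qed
    qed
  next
    fix s' a' assume I: "I s' a'" and c: "val w ?e s' = 0"
    then obtain i where i: "same {''t'', ''z'', ''i'', ''d'', ''y''} {''P''} s s'" "i \<le> K + p" "scal s' ''i'' = i"
      "\<forall>q<max i K. arr s' ''P'' q = of_bool (x ! q)" "a + 80 * p \<le> a' + 80 * i + 15"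
      unfolding I_def by blast
    have params': "scal s' ''p'' = p" "scal s' ''K'' = K"
      using i(1) env s unfolding same_def env_def p_def by simp_all
    have pK: "p + K < 2 ^ w" using P(2) word_N unfolding p_def by linarith
    have ip: "i = K + p" using c i(2,3) params' pK by simp
    have a': "20 \<le> a'" using i(5) a unfolding ip by simp
    have "F (s'\<lparr>scal := (scal s')(''c'' := p + K)\<rparr>) a2" if "a' \<le> a2 + 12" for a2
    proof (rule Q)
      show "pbits (s'\<lparr>scal := (scal s')(''c'' := p + K)\<rparr>) (V @ P)"
        using i(4) ip unfolding pbits_def x_def[symmetric] len by simp
      show "a \<le> a2 + (80 * K + 40)" using that i(5) unfolding ip by simp
    qed (use i(1) in \<open>simp_all add: same_def p_def\<close>)
    then show "1 + cost ?e \<le> a' \<and> wp w (''c'' ::= Var ''p'' \<oplus> Var ''K'') F s' (a' - (1 + cost ?e))"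
      using a' params' pK by simp
  qed
  moreover have "I (s\<lparr>scal := (scal s)(''t'' := h + 1, ''i'' := p)\<rparr>) (a - 6)"
  proof (rule II[where i = p and z = "tail_rank f P"])
    show "\<forall>q<max p K. arr (s\<lparr>scal := (scal s)(''t'' := h + 1, ''i'' := p)\<rparr>) ''P'' q = of_bool (x ! q)"
    proof (intro allI impI)
      fix q assume q: "q < max p K"
      then have "(V @ take (p - K) P) ! q = x ! q" "q < length (V @ take (p - K) P)"
        unfolding x_def by (auto simp: nth_append p_def max_def split: if_splits)
      then show "arr (s\<lparr>scal := (scal s)(''t'' := h + 1, ''i'' := p)\<rparr>) ''P'' q = of_bool (x ! q)"
        using P(1) unfolding pbits_def p_def by simp
    qed
  qed (use a s init rank_w in \<open>simp_all add: same_def tt_def\<close>)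
  moreover have "h + 1 < 2 ^ w" using h_less_K word_K by linarith
  moreover have "scal s ''h'' = h" using env by (simp add: env_def)
  ultimately show ?thesis
    unfolding unrank_com_def using a word s by (simp add: p_def)
qed

end

lemma wp_Seq_fun: "wp w (Seq c1 c2) Q = wp w c1 (wp w c2 Q)"
  by (intro ext) (rule wp_Seq_iff)

context machine
begin

lemma wp_expose_com:
  assumes env: "env s" and st: "stacks s Q B" and len: "L + 3 \<le> length (Q @ B)" "length (Q @ B) \<le> N"
    and e: "scal s ''e'' \<le> N * K"
    and a: "30 * (L + 3 - length B) + 20 \<le> a"
    and F: "\<And>s' a' Q' B'. same {''c'', ''r''} {''R''} s s' \<Longrightarrow> stacks s' Q' B' \<Longrightarrow> Q' @ B' = Q @ B \<Longrightarrow>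
      length B' = max (length B) (L + 3) \<Longrightarrow> a \<le> a' + (30 * (L + 3 - length B) + 20) \<Longrightarrow> F s' a'"
  shows "wp w expose_com F s a"
  unfolding expose_com_def
proof (rule wp_move_while[OF st len(1) _ _ _ _ a F])
  show "scal s ''e'' + length (Q @ B) < 2 ^ w" "K + length (Q @ B) < 2 ^ w"
    using e len word_N by linarith+
  fix s' Q' B' assume *: "same {''c'', ''r''} {''R''} s s'" "stacks s' Q' B'" "Q' @ B' = Q @ B"
  have "scal s' ''L'' = L" "scal s' ''e'' = scal s ''e''" using *(1) env by (simp_all add: same_def env_def)
  moreover have "scal s' ''r'' = scal s' ''e'' + length B'" using *(2) by (simp add: stacks_def)
  moreover have "L + 3 < 2 ^ w" "scal s ''e'' + (L + 3) < 2 ^ w" "3 < (2::nat) ^ w" using e len word_N by linarith+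
  ultimately show "val w (Var ''r'' \<lessdot> Var ''e'' \<oplus> (Var ''L'' \<oplus> Const 3)) s' \<noteq> 0 \<longleftrightarrow> length B' < L + 3"
    using w_pos by (simp add: of_bool_mod_exp)
qed simp_all

text \<open>\<open>R\<close> holds the second stack reversed, so reading upwards from
  \<open>e\<close> reads the sequence from its end, where codes are stored reversed as well.\<close>

lemma stacks_nth:
  assumes "stacks s Q B" "Q @ B = Y @ rev cs" "q < length B" "q < length cs"
  shows "arr s ''R'' (scal s ''e'' + q) = of_bool (cs ! q)"
proof -
  have "rev B ! q = (rev B @ rev Q) ! q" using assms(3) by (simp add: nth_append)
  also have "rev B @ rev Q = cs @ rev Y" using arg_cong[OF assms(2), of rev] by simp
  also have "(cs @ rev Y) ! q = cs ! q" using assms(4) by (simp add: nth_append)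
  finally show ?thesis using assms(1,3) unfolding stacks_def by simp
qed

text \<open>The decoder's boundary need not be that of the encoder; only the concatenations agree.
  The condition on the lengths of \<open>Q\<close> and \<open>B\<close> ensures that
  \<open>Q\<close> reaches at least to where the popped window belongs, so bits move only from
  \<open>Q\<close> to \<open>B\<close>. These moves are paid by 30 credits per bit of
  \<open>Q\<close>; everything else costs \<open>O(K)\<close>.\<close>

lemma wp_undo_com:
  assumes env: "env s" and x: "length x + 1 = N" and reach: "reach x r P R" "0 < r"
    and st: "stacks s Q B" and S: "Q @ B = P @ R"
    and B: "L + 3 \<le> length B" "length P \<le> length Q \<or> length B = L + 3"
    and e: "scal s ''e'' + r * K \<le> N * K"
    and a: "30 * length Q + 250 * K \<le> a"
    and F: "\<And>s' a' P' R' Q' B'. env s' \<Longrightarrow> reach x (r - 1) P' R' \<Longrightarrow> stacks s' Q' B' \<Longrightarrow> Q' @ B' = P' @ R' \<Longrightarrow>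
      L + 3 \<le> length B' \<Longrightarrow> length P' \<le> length Q' \<or> length B' = L + 3 \<Longrightarrow>
      scal s' ''e'' + (r - 1) * K \<le> N * K \<Longrightarrow> a + 30 * length Q' \<le> a' + 30 * length Q + 250 * K \<Longrightarrow> F s' a'"
  shows "wp w undo_com F s a"
proof -
  note [simp] = of_bool_mod_exp[OF w_pos] wp_iffs one_le_diff_iff
  note word = word_2 w_pos
  obtain P0 b R' f where reach': "reach x (r - 1) P0 (b # R')" and bad: "bad f (P0 @ [b])"
    and PR: "P @ R = take (length (P0 @ [b]) - K) (P0 @ [b]) @ R' @ code f (P0 @ [b])"
    and le: "length (P0 @ [b]) - K \<le> length P"
    using reach_last[OF reach] by blast
  define P1 where "P1 = P0 @ [b]"
  define p where "p = length P1"
  define P2 where "P2 = take (p - K) P1"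
  define j where "j = min p K"
  define z where "z = tail_rank f P1"
  define cs where "cs = True # f # nbits (L + 1) p @ nbits (j - gain) z"
  define e0 where "e0 = scal s ''e''"
  have code: "code f P1 = rev cs" by (simp add: code_def cs_def p_def j_def z_def)
  have bad1: "bad f P1" using bad by (simp add: P1_def)
  have SS: "Q @ B = (P2 @ R') @ rev cs" using S PR code by (simp add: P1_def P2_def p_def)
  have gj: "gain \<le> j" using tail_rank_bound(2)[OF bad1] by (simp add: j_def p_def)
  have zj: "z < 2 ^ (j - gain)" using tail_rank_bound(1)[OF bad1] by (simp add: j_def p_def z_def)
  have lencs: "length cs = L + 3 + (j - gain)" by (simp add: cs_def)
  have len': "length P0 + length (b # R') + g * (r - 1) = N" using reach_length[OF reach'] x by simp
  have pN: "p \<le> N" using len' by (simp add: p_def P1_def)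
  have lenS: "length (Q @ B) \<le> N" using reach_length[OF reach(1)] S x by simp
  have lenP2: "length P2 = p - K" by (simp add: P2_def p_def)
  have jK: "j \<le> K" by (simp add: j_def)
  have K4: "4 \<le> K" using gj jK g_ge_2 by linarith
  define l1 where "l1 = L + 1"
  define jg where "jg = j - gain"
  have jl: "jg + l1 + 2 + g = j" using gj by (simp add: l1_def jg_def)
  \<comment> \<open>\<open>e\<close> grows by less than \<open>K\<close> with each code dropped, so
    reserving \<open>K\<close> cells per remaining replacement keeps all addresses in range.\<close>
  have e0N: "e0 + K \<le> N * K"
  proof -
    have "1 * K \<le> r * K" using reach(2) by (intro mult_le_mono1) simp
    then show ?thesis using e unfolding e0_def by linarith
  qed
  have params': "scal s ''L'' = L" "scal s ''K'' = K" "scal s ''g'' = g" "scal s ''e'' = e0"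
    using env by (simp_all add: env_def e0_def)
  have Rnth: "arr s ''R'' (e0 + q) = of_bool (cs ! q)" if "q < L + 3" for q
    unfolding e0_def by (rule stacks_nth[OF st SS]) (use that B(1) lencs in linarith)+
  have "arr s ''R'' (e0 + 1) = of_bool (cs ! 1)" by (rule Rnth) simp
  also have "cs ! 1 = f" by (simp add: cs_def)
  finally have R1: "arr s ''R'' (e0 + 1) = of_bool f" .
  have w1: "e0 + 1 < 2 ^ w" "e0 + 2 < 2 ^ w" "e0 + 2 + (L + 1) < 2 ^ w" "L + 1 < 2 ^ w" "L + 3 < 2 ^ w" "3 < (2::nat) ^ w"
    "e0 + (L + 3) < 2 ^ w" "L + 3 + g < 2 ^ w" "K + p < 2 ^ w" "e0 + (L + 3) + K < 2 ^ w"
    using e0N word_N L_le pN gj jK by linarith+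
  define s1 where "s1 = s\<lparr>scal := (scal s)(''f'' := of_bool f)\<rparr>"
  let ?c7 = "unrank_com ;; expose_com"
  let ?c6 = "(''e'' ::= Var ''e'' \<oplus> (Var ''j'' \<ominus> Var ''g'')) ;; ?c7"
  let ?c5 = "read_com ''z'' (Var ''e'' \<oplus> (Var ''L'' \<oplus> Const 3)) (Var ''j'' \<ominus> (Var ''L'' \<oplus> Const 3 \<oplus> Var ''g''))"
  let ?c4 = "While (Var ''b'' \<lessdot> Var ''c'') move_com"
  let ?c3 = "(''b'' ::= Var ''K'' \<oplus> Var ''p'' \<ominus> Var ''j'')"
  let ?c2 = "(''j'' ::= Var ''p'') ;; If (Var ''K'' \<lessdot> Var ''p'') (''j'' ::= Var ''K'') Skip"
  let ?c1 = "read_com ''p'' (Var ''e'' \<oplus> Const 2) (Var ''L'' \<oplus> Const 1)"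
  define A where "A = {''f'', ''i'', ''p'', ''j'', ''b'', ''c'', ''r'', ''z'', ''e'', ''t'', ''d'', ''y''}"
  have c7: "wp w ?c7 F s7 a7"
    if s7: "same A {''R''} s s7" "stacks s7 P2 R'" "scal s7 ''p'' = p" "scal s7 ''f'' = of_bool f"
      "scal s7 ''z'' = z" "scal s7 ''e'' = e0 + (j - g)"
      and a7: "a + 30 * length P2 \<le> a7 + 30 * length Q + 40 * K + 140"
    for s7 a7
    unfolding wp_Seq_iff
  proof (rule wp_unrank_com[where P = P1 and f = f])
    show env7: "env s7" by (rule env_same[OF s7(1) env]) (simp_all add: A_def)
    show "pbits s7 (V @ take (length P1 - K) P1)" using s7(2) unfolding stacks_def P2_def p_def by simp
    show "length P1 \<le> N" using pN by (simp add: p_def)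
    show "80 * K + 40 \<le> a7" using a a7 lenP2 K4 by linarith
    fix s8 a8 assume 8: "same {''t'', ''z'', ''i'', ''d'', ''y'', ''c''} {''P''} s7 s8" "pbits s8 (V @ P1)"
      "scal s8 ''c'' = K + length P1" "a7 \<le> a8 + (80 * K + 40)"
    have st8: "stacks s8 P1 R'" using 8(1-3) s7(2) unfolding stacks_def same_def by simp
    have env8: "env s8" by (rule env_same[OF 8(1) env7]) simp_all
    have e8: "scal s8 ''e'' = e0 + (j - g)" using 8(1) s7(6) by (simp add: same_def)
    have lenP1: "length P1 \<le> length P2 + K" using lenP2 by (simp add: p_def)
    have len1: "length (P1 @ R') = length P0 + length (b # R')" by (simp add: P1_def)
    have len2: "length (P1 @ R') = length (Q @ B) + g"
    proof -
      have "length (Q @ B) + g * r = N" using reach_length[OF reach(1)] S x by simp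
      moreover have "g * r = g * (r - 1) + g" using reach(2) by (cases r) simp_all
      ultimately show ?thesis using len' len1 by linarith
    qed
    show "wp w expose_com F s8 a8"
    proof (rule wp_expose_com[OF env8 st8])
      show "L + 3 \<le> length (P1 @ R')" unfolding len2 using B(1) by simp
      show "length (P1 @ R') \<le> N" unfolding len1 using len' by linarith
      show "scal s8 ''e'' \<le> N * K" unfolding e8 using e0N jK by linarith
      show "30 * (L + 3 - length R') + 20 \<le> a8" using a7 8(4) a lenP2 K4 gj jK by linarith
      fix s' a' Q' B' assume 9: "same {''c'', ''r''} {''R''} s8 s'" "stacks s' Q' B'" "Q' @ B' = P1 @ R'"
        "length B' = max (length R') (L + 3)" "a8 \<le> a' + (30 * (L + 3 - length R') + 20)"
      show "F s' a'"
      proof (rule F)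
        show "env s'" by (rule env_same[OF 9(1) env8]) simp_all
        show "reach x (r - 1) P0 (b # R')" by (rule reach')
        show "stacks s' Q' B'" by (rule 9)
        show "Q' @ B' = P0 @ b # R'" using 9(3) by (simp add: P1_def)
        show "L + 3 \<le> length B'" using 9(4) by simp
        have lens: "length Q' + length B' = length P1 + length R'" using arg_cong[OF 9(3), of length] by simp
        then show "length P0 \<le> length Q' \<or> length B' = L + 3"
          using 9(4) unfolding P1_def by (cases "L + 3 \<le> length R'") simp_all
        have "(r - 1) * K + K = r * K" using reach(2) by (cases r) simp_all
        then show "scal s' ''e'' + (r - 1) * K \<le> N * K"
          using 9(1) e8 e jK by (simp add: same_def e0_def)
        have "length Q' + (L + 3 - length R') = length P1" using lens 9(4) by linarith
        then show "a + 30 * length Q' \<le> a' + 30 * length Q + 250 * K"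
          using a7 8(4) 9(5) lenP1 K4 by linarith
      qed
    qed
  qed (use s7 bad1 in \<open>simp_all add: p_def z_def\<close>)
  have c5: "wp w ?c5 (wp w ?c6 F) s5 a5"
    if s5: "same (A - {''z'', ''e''}) {''R''} s s5" "stacks s5 P2 (R' @ rev cs)" "scal s5 ''p'' = p" "scal s5 ''f'' = of_bool f"
      "scal s5 ''j'' = j"
      and a5: "a + 30 * length P2 \<le> a5 + 30 * length Q + 40 * l1 + 100"
    for s5 a5
  proof (rule wp_read_com[where bs = "nbits (j - gain) z" and l = "j - gain" and bv = "e0 + (L + 3)"])
    have c5: "scal s5 ''L'' = L" "scal s5 ''g'' = g" "scal s5 ''e'' = e0"
      using s5(1) params' unfolding same_def A_def by simp_all
    have csq: "arr s5 ''R'' (e0 + q) = of_bool (cs ! q)" if "q < length cs" for q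
      using stacks_nth[OF s5(2), of "P2 @ R'" cs q] that c5(3) by simp
    show "arr s5 ''R'' (e0 + (L + 3) + q) = of_bool (nbits (j - gain) z ! q)" if "q < j - gain" for q
    proof -
      have "cs ! (L + 3 + q) = nbits (j - gain) z ! q"
      proof -
        have "L + 3 + q = Suc (Suc (L + 1 + q))" by simp
        then show ?thesis by (simp add: cs_def nth_append)
      qed
      then show ?thesis using csq[of "L + 3 + q"] that lencs by (simp add: add.assoc)
    qed
    show "val w (Var ''e'' \<oplus> (Var ''L'' \<oplus> Const 3)) s' = e0 + (L + 3)" if "same {''i'', ''z''} {} s5 s'" for s'
      using that c5 w1 by (simp add: same_def)
    show "val w (Var ''j'' \<ominus> (Var ''L'' \<oplus> Const 3 \<oplus> Var ''g'')) s5 = j - gain"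
      using s5(5) c5 w1 jK by (simp add: less_imp_diff_less)
    show "e0 + (L + 3) + (j - gain) < 2 ^ w" using w1 jK by linarith
    have "(2::nat) ^ (j - gain) \<le> 2 ^ K" using jK by (intro power_increasing) auto
    then show "2 * 2 ^ (j - gain) \<le> (2::nat) ^ w" using word_T by linarith
    show "40 * (j - gain) + 30 \<le> a5" unfolding jg_def[symmetric] using a5 a lenP2 K4 jl jK by linarith
    fix s6 a6 assume 6: "same {''i'', ''z''} {} s5 s6" "scal s6 ''z'' = num (nbits (j - gain) z)"
      "a5 \<le> a6 + (40 * (j - gain) + 30)"
    note 63 = 6(3)[folded jg_def]
    define s7 where "s7 = s6\<lparr>scal := (scal s6)(''e'' := e0 + (j - g))\<rparr>"
    have gjg: "j - g = length cs" using lencs gj by simp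
    have "wp w ?c7 F s7 (a6 - 6)"
    proof (rule c7)
      show "same A {''R''} s s7" using s5(1) 6(1) unfolding same_def s7_def A_def by simp
      show "stacks s7 P2 R'"
        unfolding stacks_def
      proof (intro conjI allI impI)
        show "pbits s7 (V @ P2)" using s5(2) 6(1) unfolding stacks_def pbits_def same_def s7_def by simp
        show "scal s7 ''c'' = K + length P2" using s5(2) 6(1) unfolding stacks_def same_def s7_def by simp
        show "scal s7 ''r'' = scal s7 ''e'' + length R'"
          using s5(2) 6(1) c5 gjg unfolding stacks_def same_def s7_def by simp
        fix q assume "q < length R'"
        then have "arr s5 ''R'' (e0 + (length cs + q)) = of_bool (rev (R' @ rev cs) ! (length cs + q))"
          using s5(2) c5 unfolding stacks_def by simp
        then show "arr s7 ''R'' (scal s7 ''e'' + q) = of_bool (rev R' ! q)"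
          using 6(1) gjg unfolding same_def s7_def by (simp add: nth_append add.assoc)
      qed
      show "scal s7 ''p'' = p" "scal s7 ''f'' = of_bool f" using s5(3,4) 6(1) by (simp_all add: same_def s7_def)
      show "scal s7 ''z'' = z" using 6(2) num_nbits[OF zj] by (simp add: s7_def)
      show "scal s7 ''e'' = e0 + (j - g)" by (simp add: s7_def)
      show "a + 30 * length P2 \<le> a6 - 6 + 30 * length Q + 40 * K + 140"
        using a5 63 jl jK by linarith
    qed
    moreover have "6 \<le> a6" using 63 a5 a lenP2 K4 jl jK by linarith
    moreover have "scal s6 ''j'' = j" "scal s6 ''g'' = g" "scal s6 ''e'' = e0"
      using 6(1) s5(5) c5 by (simp_all add: same_def)
    moreover have "j - g < 2 ^ w" "e0 + (j - g) < 2 ^ w" using w1 jK by linarith+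
    ultimately show "wp w ?c6 F s6 a6"
      unfolding wp_Seq_iff[of w "''e'' ::= Var ''e'' \<oplus> (Var ''j'' \<ominus> Var ''g'')"] wp_Assign_iff s7_def by simp
  qed simp_all
  have c4: "wp w ?c4 (wp w ?c5 (wp w ?c6 F)) s4 a4"
    if s4: "same {''f'', ''i'', ''p'', ''j'', ''b''} {} s s4" "scal s4 ''p'' = p" "scal s4 ''f'' = of_bool f"
      "scal s4 ''j'' = j" "scal s4 ''b'' = K + (p - K)"
      and a4: "a \<le> a4 + 40 * l1 + 70"
    for s4 a4
  proof (rule wp_move_while[where t = "length (Q @ B) - (p - K)"])
    show "stacks s4 Q B" using st s4(1) unfolding stacks_def pbits_def same_def by simp
    have Pcs: "length P2 + L + 3 \<le> length (Q @ B)" using SS lencs by simp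
    \<comment> \<open>Either \<open>Q\<close> contains the encoder's stack, which has not shrunk
      below \<open>P2\<close> since the replacement, or all but \<open>L + 3\<close> bits are in
      \<open>Q\<close>, while a code alone has at least that many.\<close>
    have PQ: "length P2 \<le> length Q"
      using B(2) le Pcs lenP2 unfolding p_def P1_def by auto
    have tB: "length B \<le> length (Q @ B) - (p - K)" using PQ lenP2 by simp
    show "scal s4 ''e'' + length (Q @ B) < 2 ^ w" "K + length (Q @ B) < 2 ^ w"
      using s4(1) params' e0N lenS word_N by (simp_all add: same_def)
    show "val w (Var ''b'' \<lessdot> Var ''c'') s' \<noteq> 0 \<longleftrightarrow> length B' < length (Q @ B) - (p - K)"
      if "same {''c'', ''r''} {''R''} s4 s'" "stacks s' Q' B'" "Q' @ B' = Q @ B" for s' Q' B'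
    proof -
      have "scal s' ''b'' = K + (p - K)" "scal s' ''c'' = K + length Q'"
        using that(1,2) s4(5) by (simp_all add: same_def stacks_def)
      moreover have "length (Q @ B) = length Q' + length B'" using arg_cong[OF that(3), of length] by simp
      ultimately show ?thesis by auto
    qed
    have ln: "30 * (length (Q @ B) - (p - K) - length B) + 30 * length P2 = 30 * length Q"
      using PQ lenP2 by simp
    show "30 * (length (Q @ B) - (p - K) - length B) + 20 \<le> a4" using ln a4 a K4 jl jK by linarith
    fix s5 a5 Q' B' assume 5: "same {''c'', ''r''} {''R''} s4 s5" "stacks s5 Q' B'" "Q' @ B' = Q @ B"
      "length B' = max (length B) (length (Q @ B) - (p - K))"
      "a4 \<le> a5 + (30 * (length (Q @ B) - (p - K) - length B) + 20)"
    have "length B' = length (Q @ B) - length P2" using 5(4) tB lenP2 by simp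
    moreover have "length (Q @ B) = length Q' + length B'" using arg_cong[OF 5(3), of length] by simp
    ultimately have "length Q' = length P2" using Pcs by linarith
    moreover have "Q' @ B' = P2 @ (R' @ rev cs)" using 5(3) SS by simp
    ultimately have QB: "Q' = P2" "B' = R' @ rev cs" by (simp_all add: append_eq_append_conv)
    show "wp w ?c5 (wp w ?c6 F) s5 a5"
    proof (rule c5)
      show "same (A - {''z'', ''e''}) {''R''} s s5" using s4(1) 5(1) unfolding same_def A_def by simp
      show "stacks s5 P2 (R' @ rev cs)" using 5(2) QB by simp
      show "a + 30 * length P2 \<le> a5 + 30 * length Q + 40 * l1 + 100" using a4 5(5) ln by linarith
    qed (use s4(2-4) 5(1) in \<open>simp_all add: same_def\<close>)
  qed simp_all
  have p_less: "p < 2 ^ (L + 1)"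
    using pN N_le power_strict_increasing[of L "L + 1" "2::nat"] by linarith
  have c1: "wp w ?c1 (wp w (?c2 ;; ?c3 ;; ?c4 ;; ?c5 ;; ?c6) F) s1 (a - 5)"
  proof (rule wp_read_com[where bs = "nbits (L + 1) p" and l = "L + 1" and bv = "e0 + 2"])
    show "arr s1 ''R'' (e0 + 2 + q) = of_bool (nbits (L + 1) p ! q)" if "q < L + 1" for q
    proof -
      have "cs ! (2 + q) = nbits (L + 1) p ! q"
        using that by (simp add: cs_def nth_append numeral_2_eq_2)
      then show ?thesis using Rnth[of "2 + q"] that by (simp add: s1_def add.assoc)
    qed
    show "val w (Var ''e'' \<oplus> Const 2) s' = e0 + 2" if "same {''i'', ''p''} {} s1 s'" for s'
      using that params' w1 word by (simp add: same_def s1_def)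
    show "val w (Var ''L'' \<oplus> Const 1) s1 = L + 1" using params' w1 word by (simp add: s1_def)
    show "e0 + 2 + (L + 1) < 2 ^ w" by (rule w1)
    \<comment> \<open>The position field has \<open>L + 1\<close> bits and is read by doubling,
      which needs \<open>4 * 2 ^ L\<close> below the word size; \<open>N * K\<close> with
      \<open>K \<ge> 4\<close> provides it.\<close>
    have "(2::nat) ^ L < 2 * N" using L_least L_pos by (simp add: power_eq_if)
    moreover have "N * 4 \<le> N * K" using K4 by (rule mult_le_mono2)
    moreover have "2 * (2::nat) ^ (L + 1) = 4 * 2 ^ L" by (simp add: power_add)
    ultimately show "2 * 2 ^ (L + 1) \<le> (2::nat) ^ w" using word_N by linarith
    show "40 * (L + 1) + 30 \<le> a - 5" unfolding l1_def[symmetric] using a jl jK K4 by linarith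
    fix s2 a2 assume 2: "same {''i'', ''p''} {} s1 s2" "scal s2 ''p'' = num (nbits (L + 1) p)"
      "a - 5 \<le> a2 + (40 * (L + 1) + 30)"
    note 23 = 2(3)[folded l1_def]
    have p2: "scal s2 ''p'' = p" using 2(2) num_nbits[OF p_less] by simp
    have K2: "scal s2 ''K'' = K" using 2(1) params' by (simp add: same_def s1_def)
    define s4 where "s4 = s2\<lparr>scal := (scal s2)(''j'' := j, ''b'' := K + (p - K))\<rparr>"
    have W: "wp w ?c4 (wp w ?c5 (wp w ?c6 F)) s4 a4" if "a2 \<le> a4 + 20" for a4
    proof (rule c4)
      show "same {''f'', ''i'', ''p'', ''j'', ''b''} {} s s4"
        using 2(1) unfolding same_def s4_def s1_def by simp
      show "a \<le> a4 + 40 * l1 + 70" using that 23 by linarith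
    qed (use p2 2(1) in \<open>simp_all add: s4_def same_def s1_def\<close>)
    have a2: "40 \<le> a2" using 23 a jl jK K4 by linarith
    show "wp w (?c2 ;; ?c3 ;; ?c4 ;; ?c5 ;; ?c6) F s2 a2"
    proof (cases "K < p")
      case True
      then have "j = K" "K + p - K = K + (p - K)" by (simp_all add: j_def)
      with W show ?thesis using True p2 K2 w1(9) a2 word unfolding s4_def wp_Seq_fun by simp
    next
      case False
      then have "j = p" "K + p - p = K + (p - K)" by (simp_all add: j_def)
      with W show ?thesis using False p2 K2 w1(9) a2 word unfolding s4_def wp_Seq_fun by simp
    qed
  qed simp_all
  then show ?thesis
    unfolding undo_com_def s1_def wp_Seq_fun using params' R1 w1 word a K4 by (cases f) simp_all
qed


section \<open>The complete decoding of a codeword\<close>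

lemma wp_flush_com:
  assumes st: "stacks s Q B" and len: "length (Q @ B) \<le> N" and e: "scal s ''e'' \<le> N * K"
    and a: "30 * length B + 10 \<le> a"
    and F: "\<And>s' a'. same {''r'', ''c''} {''P''} s s' \<Longrightarrow> pbits s' (V @ Q @ B) \<Longrightarrow> F s' a'"
  shows "wp w flush_com F s a"
proof -
  note [simp] = of_bool_mod_exp[OF w_pos] wp_iffs one_le_diff_iff
  note word = word_2 w_pos
  let ?e = "Var ''e'' \<lessdot> Var ''r''"
  let ?b = "(''r'' ::= Var ''r'' \<ominus> Const 1) ;; Store ''P'' (Var ''c'') (Get ''R'' (Var ''r'')) ;;
    (''c'' ::= Var ''c'' \<oplus> Const 1)"
  define I where "I = (\<lambda>s' a'. same {''r'', ''c''} {''P''} s s' \<and>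
    (\<exists>Q' B'. stacks s' Q' B' \<and> Q' @ B' = Q @ B \<and> 30 * length B' + 10 \<le> a'))"
  have "I s a" unfolding I_def using st a same_refl by blast
  then show ?thesis
    unfolding flush_com_def
  proof (rule wp_While)
    fix s' a' assume I: "I s' a'" and c: "val w ?e s' \<noteq> 0"
    then obtain Q' B' where i: "same {''r'', ''c''} {''P''} s s'" "stacks s' Q' B'" "Q' @ B' = Q @ B"
      "30 * length B' + 10 \<le> a'" unfolding I_def by blast
    have "B' \<noteq> []" using c i(2) by (cases B') (auto simp: stacks_def)
    then obtain b B2 where B2: "B' = b # B2" by (cases B') auto
    define e0 where "e0 = scal s ''e''"
    have sc: "scal s' ''e'' = e0" "scal s' ''c'' = K + length Q'" "scal s' ''r'' = e0 + length B2 + 1"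
      using i(1,2) unfolding stacks_def same_def e0_def B2 by simp_all
    have "arr s' ''R'' (e0 + length B2) = of_bool (rev B' ! length B2)"
      using i(2) sc(1) unfolding stacks_def B2 by simp
    also have "rev B' ! length B2 = b" unfolding B2 by (simp add: nth_append)
    finally have R: "arr s' ''R'' (e0 + length B2) = of_bool b" .
    have lens: "length Q' + length B2 + 1 = length (Q @ B)" using arg_cong[OF i(3), of length] by (simp add: B2)
    have w1: "K + length Q' + 1 < 2 ^ w" "e0 + length B2 + 1 < 2 ^ w" "e0 + length B2 < 2 ^ w"
      using lens len e word_N unfolding e0_def by linarith+
    define s2 where "s2 = s'\<lparr>arr := (arr s')(''P'' := (arr s' ''P'')(K + length Q' := of_bool b)),
      scal := (scal s')(''r'' := e0 + length B2, ''c'' := K + length Q' + 1)\<rparr>"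
    have "stacks s2 (Q' @ [b]) B2"
      unfolding stacks_def
    proof (intro conjI allI impI)
      have "pbits s' (V @ Q')" using i(2) by (simp add: stacks_def)
      then show "pbits s2 (V @ Q' @ [b])"
        unfolding pbits_def
      proof (intro allI impI)
        fix q assume *: "\<forall>i<length (V @ Q'). arr s' ''P'' i = of_bool ((V @ Q') ! i)" and q: "q < length (V @ Q' @ [b])"
        have "(V @ Q' @ [b]) ! q = ((V @ Q') @ [b]) ! q" by simp
        also have "\<dots> = (if q < length (V @ Q') then (V @ Q') ! q else b)" using q by (subst nth_append) auto
        finally show "arr s2 ''P'' q = of_bool ((V @ Q' @ [b]) ! q)"
          using * q by (cases "q = K + length Q'") (auto simp: s2_def)
      qed
      fix q assume q: "q < length B2"
      then have "arr s' ''R'' (e0 + q) = of_bool (rev B' ! q)" using i(2) sc(1) unfolding stacks_def B2 by simp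
      then show "arr s2 ''R'' (scal s2 ''e'' + q) = of_bool (rev B2 ! q)"
        using q sc(1) unfolding B2 s2_def by (simp add: nth_append)
    qed (use sc in \<open>simp_all add: s2_def\<close>)
    moreover have "(Q' @ [b]) @ B2 = Q @ B" using i(3) by (simp add: B2)
    moreover have "same {''r'', ''c''} {''P''} s s2" using i(1) by (simp add: same_def s2_def)
    ultimately have "I s2 a2" if "a' \<le> a2 + 30" for a2
      unfolding I_def using that i(4) B2 by fastforce
    moreover have "40 \<le> a'" using i(4) B2 by simp
    ultimately show "1 + cost ?e \<le> a' \<and> wp w ?b I s' (a' - (1 + cost ?e))"
      using sc R w1 word by (simp add: s2_def)
  next
    fix s' a' assume I: "I s' a'" and c: "val w ?e s' = 0"
    then obtain Q' B' where i: "same {''r'', ''c''} {''P''} s s'" "stacks s' Q' B'" "Q' @ B' = Q @ B"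
      "30 * length B' + 10 \<le> a'" unfolding I_def by blast
    have "B' = []" using c i(2) word by (cases B') (auto simp: stacks_def split: if_splits)
    then show "1 + cost ?e \<le> a' \<and> F s' (a' - (1 + cost ?e))"
      using i by (auto intro!: F simp: stacks_def)
  qed
qed

text \<open>The loop counts down the replacements without knowing their number: the last bit of the
  current sequence is the flag 1 of a code as long as one is left, and the appended 0 afterwards.
  Each round is paid by the \<open>X * g\<close> credits of the bits that it restores.\<close>

lemma wp_recover_com:
  assumes env: "env s" and x: "length x + 1 = N" and reach: "reach x r P []" "0 < r"
    and A: "padded P A" "pbits s (V @ A)"
    and a: "X * N + 200 * N + 100 \<le> a"
    and F: "\<And>s' a'. env s' \<Longrightarrow> pbits s' (V @ x @ [False]) \<Longrightarrow> F s' a'"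
  shows "wp w recover_com F s a"
proof -
  note [simp] = of_bool_mod_exp[OF w_pos]
  have "1 * g \<le> r * g" using reach(2) by (intro mult_le_mono1) simp
  then have gr: "g \<le> g * r" by (simp add: mult.commute)
  have lenP: "length P + g * r = N" using reach_length[OF reach(1)] x by simp
  then have P2: "length P + 2 \<le> N" using gr g_ge_2 by linarith
  have rN: "r \<le> N"
  proof -
    have "1 * r \<le> g * r" using g_ge_2 by (intro mult_le_mono1) simp
    then show ?thesis using lenP by linarith
  qed
  \<comment> \<open>After at least one replacement the final sequence ends in a code, so the bits to
    be exposed exist.\<close>
  have PL: "L + 3 \<le> length P"
  proof -
    obtain P0 b R' f where "P @ [] = take (length (P0 @ [b]) - K) (P0 @ [b]) @ R' @ code f (P0 @ [b])"
      using reach_last[OF reach] by blast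
    then have "length P = length (take (length (P0 @ [b]) - K) (P0 @ [b]) @ R' @ code f (P0 @ [b]))" by simp
    then show ?thesis by (simp add: code_def)
  qed
  define I where "I = (\<lambda>s' a'. env s' \<and> (\<exists>r P R Q B. reach x r P R \<and> stacks s' Q B \<and> Q @ B = P @ R \<and>
    L + 3 \<le> length B \<and> (length P \<le> length Q \<or> length B = L + 3) \<and> scal s' ''e'' + r * K \<le> N * K \<and>
    30 * N + 20 + 30 * length Q + X * (g * r) \<le> a'))"
  have loop: "wp w (While (Get ''R'' (Var ''e'')) undo_com) (wp w flush_com F) s' a'" if "I s' a'" for s' a'
    using that
  proof (rule wp_While)
    fix s' a' assume I: "I s' a'" and c: "val w (Get ''R'' (Var ''e'')) s' \<noteq> 0"
    then obtain r P R Q B where env': "env s'" and i: "reach x r P R" "stacks s' Q B" "Q @ B = P @ R"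
      "L + 3 \<le> length B" "length P \<le> length Q \<or> length B = L + 3" "scal s' ''e'' + r * K \<le> N * K"
      "30 * N + 20 + 30 * length Q + X * (g * r) \<le> a'"
      unfolding I_def by blast
    have "0 < r"
    proof (rule ccontr)
      assume "\<not> 0 < r"
      then have "Q @ B = x @ rev [False]" using reach_0[OF i(1)] i(3) by simp
      moreover have "B \<noteq> []" using i(4) by auto
      ultimately have "arr s' ''R'' (scal s' ''e'') = 0" using stacks_nth[OF i(2), of x "[False]" 0] by simp
      then show False using c by simp
    qed
    then have X: "X * (g * r) = X * (g * (r - 1)) + X * g"
      by (cases r) (simp_all add: add_mult_distrib2)
    have cost: "1 + cost (Get ''R'' (Var ''e'')) = 3" by simp
    have "wp w undo_com I s' (a' - 3)"
    proof (rule wp_undo_com[OF env' x i(1) \<open>0 < r\<close> i(2-6)])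
      show "30 * length Q + 250 * K \<le> a' - 3" using i(7) X K_le by linarith
      fix s2 a2 P' R' Q' B' assume 2: "env s2" "reach x (r - 1) P' R'" "stacks s2 Q' B'" "Q' @ B' = P' @ R'"
        "L + 3 \<le> length B'" "length P' \<le> length Q' \<or> length B' = L + 3" "scal s2 ''e'' + (r - 1) * K \<le> N * K"
        "a' - 3 + 30 * length Q' \<le> a2 + 30 * length Q + 250 * K"
      have "30 * N + 20 + 30 * length Q' + X * (g * (r - 1)) \<le> a2"
        using 2(8) i(7) X K_le K_pos by linarith
      then show "I s2 a2" unfolding I_def using 2 by blast
    qed
    then show "1 + cost (Get ''R'' (Var ''e'')) \<le> a' \<and> wp w undo_com I s' (a' - (1 + cost (Get ''R'' (Var ''e''))))"
      unfolding cost using i(7) by simp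
  next
    fix s' a' assume I: "I s' a'" and c: "val w (Get ''R'' (Var ''e'')) s' = 0"
    then obtain r P R Q B where env': "env s'" and i: "reach x r P R" "stacks s' Q B" "Q @ B = P @ R"
      "L + 3 \<le> length B" "scal s' ''e'' + r * K \<le> N * K" "30 * N + 20 + 30 * length Q + X * (g * r) \<le> a'"
      unfolding I_def by blast
    have "r = 0"
    proof (rule ccontr)
      assume "r \<noteq> 0"
      then obtain P0 b R' f where PR: "P @ R = take (length (P0 @ [b]) - K) (P0 @ [b]) @ R' @ code f (P0 @ [b])"
        using reach_last[OF i(1)] by blast
      define cs where "cs = rev (code f (P0 @ [b]))"
      have "Q @ B = (take (length (P0 @ [b]) - K) (P0 @ [b]) @ R') @ rev cs" using PR i(3) by (simp add: cs_def)
      moreover have "B \<noteq> []" using i(4) by auto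
      ultimately have "arr s' ''R'' (scal s' ''e'') = of_bool (cs ! 0)"
        using stacks_nth[OF i(2), of _ cs 0] by (simp add: cs_def code_def)
      moreover have "cs ! 0" by (simp add: cs_def code_def)
      ultimately show False using c by simp
    qed
    then have QB: "Q @ B = x @ [False]" using reach_0[OF i(1)] i(3) by simp
    have lens: "length Q + length B = N" using arg_cong[OF QB, of length] x by simp
    have cost: "1 + cost (Get ''R'' (Var ''e'')) = 3" by simp
    have "wp w flush_com F s' (a' - 3)"
    proof (rule wp_flush_com[OF i(2)])
      show "length (Q @ B) \<le> N" using lens by simp
      show "scal s' ''e'' \<le> N * K" using i(5) by linarith
      show "30 * length B + 10 \<le> a' - 3" using i(6) lens by linarith
      fix s2 a2 assume 2: "same {''r'', ''c''} {''P''} s' s2" "pbits s2 (V @ Q @ B)"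
      show "F s2 a2"
      proof (rule F)
        show "env s2" by (rule env_same[OF 2(1) env']) simp_all
        show "pbits s2 (V @ x @ [False])" using 2(2) unfolding QB .
      qed
    qed
    then show "1 + cost (Get ''R'' (Var ''e'')) \<le> a' \<and> wp w flush_com F s' (a' - (1 + cost (Get ''R'' (Var ''e''))))"
      unfolding cost using i(6) by simp
  qed
  show ?thesis
    unfolding recover_com_def wp_Seq_iff
  proof (rule wp_find_com[OF env A P2])
    show "20 * N + 30 \<le> a" using a by linarith
    fix s2 a2 assume 2: "same {''c'', ''r'', ''e''} {} s s2" "stacks s2 P []" "scal s2 ''e'' = 0" "a \<le> a2 + (20 * N + 30)"
    have env2: "env s2" by (rule env_same[OF 2(1) env]) simp_all
    have L_N: "L + 3 \<le> N" using PL P2 by linarith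
    show "wp w expose_com (wp w (While (Get ''R'' (Var ''e'')) undo_com) (wp w flush_com F)) s2 a2"
    proof (rule wp_expose_com[OF env2 2(2)])
      show "L + 3 \<le> length (P @ [])" "length (P @ []) \<le> N" using PL P2 by simp_all
      show "scal s2 ''e'' \<le> N * K" using 2(3) by simp
      have "30 * (L + 3 - length ([] :: bool list)) \<le> 30 * N" using L_N by (intro mult_le_mono2) simp
      then show e: "30 * (L + 3 - length ([] :: bool list)) + 20 \<le> a2" using 2(4) a by linarith
      fix s3 a3 Q B assume 3: "same {''c'', ''r''} {''R''} s2 s3" "stacks s3 Q B" "Q @ B = P @ []"
        "length B = max (length ([] :: bool list)) (L + 3)" "a2 \<le> a3 + (30 * (L + 3 - length ([] :: bool list)) + 20)"
      have e3: "scal s3 ''e'' = 0" using 2(3) 3(1) by (simp add: same_def)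
      have "length Q \<le> N" using arg_cong[OF 3(3), of length] P2 by simp
      moreover have "X * (g * r) \<le> X * N" using lenP by (intro mult_le_mono2) simp
      moreover have "30 * (L + 3 - length ([] :: bool list)) \<le> 30 * N" using L_N by (intro mult_le_mono2) simp
      ultimately have cr: "30 * N + 20 + 30 * length Q + X * (g * r) \<le> a3"
        using 3(5) 2(4) a by linarith
      have env3: "env s3" by (rule env_same[OF 3(1) env2]) simp_all
      have rK: "scal s3 ''e'' + r * K \<le> N * K" using e3 rN by simp
      have B3: "length B = L + 3" using 3(4) by simp
      have "I s3 a3" unfolding I_def using env3 reach(1) 3(2,3) B3 rK cr by (metis order.refl)
      then show "wp w (While (Get ''R'' (Var ''e'')) undo_com) (wp w flush_com F) s3 a3" by (rule loop)
    qed
  qed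
qed

lemma wp_decoder_core:
  assumes x: "length x + 1 = N" and A: "encodes x A"
  shows "wp w (decoder_core al be u v)
    (\<lambda>s a. scal s ''K'' = K \<and> (\<forall>i<length x. arr s ''P'' (K + i) = of_bool (x ! i))) (init n m A) ((X + 1400) * N)"
proof -
  note [simp] = of_bool_mod_exp[OF w_pos] wp_iffs one_le_diff_iff
  note word = word_2 w_pos
  have tot: "(X + 1400) * N = X * N + 1400 * N" by (rule add_mult_distrib)
  obtain r P where reach: "reach x r P []" and pad: "padded P A" using A unfolding encodes_def by blast
  have lenA: "length A = N" using pad by (simp add: padded_def)
  have N1: "2 \<le> N" using K_le_N half_le_h h_less_K by linarith
  let ?F = "\<lambda>s (a::nat). scal s ''K'' = K \<and> (\<forall>i<length x. arr s ''P'' (K + i) = of_bool (x ! i))"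
  have fin: "?F s a" if "env s" "pbits s (V @ x @ [False])" for s a
  proof -
    have "arr s ''P'' (K + i) = of_bool (x ! i)" if "i < length x" for i
      using \<open>pbits s (V @ x @ [False])\<close> that unfolding pbits_def by (auto simp: nth_append)
    then show ?thesis using \<open>env s\<close> by (simp add: env_def)
  qed
  show ?thesis
    unfolding decoder_core_def wp_Seq_iff
  proof (rule wp_prepare)
    show "scal (init n m A) ''n'' = n" "scal (init n m A) ''m'' = m" "arr (init n m A) ''T'' i = 0" for i
      by (simp_all add: init_def)
    show "1000 * N \<le> (X + 1400) * N" unfolding tot by simp
    fix s1 a1 assume 1: "env s1"
      "same {''N'', ''B'', ''L'', ''K'', ''h'', ''g'', ''Z'', ''i''} {''T''} (init n m A) s1"
      "(X + 1400) * N \<le> a1 + 1000 * N"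
    have inA: "arr s1 ''in'' i = of_bool (A ! i)" if "i < N" for i
      using 1(2) that lenA by (simp add: same_def init_def)
    show "wp w load_com (wp w (If (Get ''in'' (Var ''N'' \<ominus> Const 1)) recover_com Skip) ?F) s1 a1"
    proof (rule wp_load_com[OF 1(1) lenA inA])
      show "60 * N + 20 \<le> a1" using 1(3) N1 unfolding tot by linarith
      fix s2 a2 assume 2: "same {''i''} {''P''} s1 s2" "pbits s2 (V @ A)" "a1 \<le> a2 + (60 * N + 20)"
      have env2: "env s2" by (rule env_same[OF 2(1) 1(1)]) simp_all
      have "scal s2 ''N'' = N" using env2 by (simp add: env_def)
      moreover have "N - 1 < 2 ^ w" using word_N by linarith
      moreover have "arr s2 ''in'' (N - 1) = of_bool (A ! (N - 1))" using inA[of "N - 1"] 2(1) N1 by (simp add: same_def)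
      ultimately have v: "val w (Get ''in'' (Var ''N'' \<ominus> Const 1)) s2 = of_bool (A ! (N - 1))"
        using word by simp
      have c: "1 + cost (Get ''in'' (Var ''N'' \<ominus> Const 1)) = 5" by simp
      have a2: "X * N + 200 * N + 100 \<le> a2 - 5" "6 \<le> a2" using 1(3) 2(3) N1 unfolding tot by linarith+
      show "wp w (If (Get ''in'' (Var ''N'' \<ominus> Const 1)) recover_com Skip) ?F s2 a2"
      \<comment> \<open>Without replacements the stack is full and ends in the appended 0; otherwise
        there is padding and it ends in 1. The last bit thus tells the two cases apart.\<close>
      proof (cases r)
        case 0
        then have P: "P = x @ [False]" using reach_0[OF reach] by simp
        then have "A = x @ [False]" using pad x lenA unfolding padded_def by auto
        moreover from this have "A ! (N - 1) = False" using x by (auto simp: nth_append)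
        ultimately show ?thesis
          unfolding wp_If_iff v c using a2 fin[OF env2] 2(2) by simp
      next
        case (Suc r')
        then have "0 < r" by simp
        have "length P + g * r = N" using reach_length[OF reach] x by simp
        then have "length P < N" using Suc g_ge_2 by simp
        then have "A ! (N - 1)" using pad by (simp add: padded_def)
        moreover have "wp w recover_com ?F s2 (a2 - 5)"
          by (rule wp_recover_com[OF env2 x reach \<open>0 < r\<close> pad 2(2) a2(1) fin])
        ultimately show ?thesis
          unfolding wp_If_iff v c using a2 by simp
      qed
    qed
  qed
qed

end

section \<open>Halting and output on arbitrary arrays\<close>

definition decoder_output :: com where
  "decoder_output = (''i'' ::= Const 0) ;;
    While (Var ''i'' \<lessdot> Var ''n'' \<otimes> Var ''n'' \<ominus> Const 1)
      (Store ''out'' (Var ''i'') (Const 0 \<lessdot> Get ''P'' (Var ''K'' \<oplus> Var ''i'')) ;;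
      (''i'' ::= Var ''i'' \<oplus> Const 1))"

text \<open>
  Arrays that are no codewords may drive the core into a loop; the fuel bounds its running time,
  and \<open>decoder_output\<close> turns whatever it has left into bits.
\<close>

definition decoder :: "nat \<Rightarrow> nat \<Rightarrow> nat \<Rightarrow> nat \<Rightarrow> nat \<Rightarrow> com" where
  "decoder D al be u v = (''fuel'' ::= Const D \<otimes> (Var ''n'' \<otimes> Var ''n'')) ;;
    fueled (decoder_core al be u v) ;; decoder_output"

lemma decoder_core_vars:
  "''fuel'' \<notin> cvars (decoder_core al be u v)" "''n'' \<notin> assigned (fueled (decoder_core al be u v))"
  by (simp_all add: decoder_core_def prepare_def find_log_def fill_table_def load_com_def recover_com_def
      find_com_def expose_com_def move_com_def undo_com_def read_com_def unrank_com_def flush_com_def)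

lemma unit_cost_decoder_core: "unit_cost (decoder_core al be u v) = unit_cost (decoder_core 0 0 0 0)"
  by (simp add: decoder_core_def prepare_def)

context machine
begin

lemma wp_decoder_output:
  assumes s: "scal s ''n'' = n" and a: "40 * N + 10 \<le> a"
    and F: "\<And>s' a'. (\<And>i. i < N - 1 \<Longrightarrow> arr s' ''out'' i = of_bool (0 < arr s ''P'' ((scal s ''K'' + i) mod 2 ^ w))) \<Longrightarrow> F s' a'"
  shows "wp w decoder_output F s a"
proof -
  note [simp] = of_bool_mod_exp[OF w_pos] wp_iffs one_le_diff_iff
  note word = word_2 w_pos
  have N1: "1 \<le> N" using L_least by linarith
  have nw: "n * n < 2 ^ w" "n * n - 1 < 2 ^ w" "n * n = N" using word_N N_def by linarith+
  let ?e = "Var ''i'' \<lessdot> Var ''n'' \<otimes> Var ''n'' \<ominus> Const 1"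
  let ?g = "Const 0 \<lessdot> Get ''P'' (Var ''K'' \<oplus> Var ''i'')"
  let ?b = "Store ''out'' (Var ''i'') ?g ;; (''i'' ::= Var ''i'' \<oplus> Const 1)"
  let ?y = "\<lambda>i. of_bool (0 < arr s ''P'' ((scal s ''K'' + i) mod 2 ^ w)) :: nat"
  define I where "I = (\<lambda>s' a'. same {''i''} {''out''} s s' \<and>
    (\<exists>i\<le>N - 1. scal s' ''i'' = i \<and> (\<forall>q<i. arr s' ''out'' q = ?y q) \<and> 40 * (N - 1 - i) + 8 \<le> a'))"
  have e: "val w ?e s' = of_bool (scal s' ''i'' < N - 1)" if "same {''i''} {''out''} s s'" for s'
    using that s nw word by (simp add: same_def)
  have c: "1 + cost ?e = 8" by simp
  have "wp w (While ?e ?b) F s' a'" if "I s' a'" for s' a'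
    using that
  proof (rule wp_While)
    fix s' a' assume I: "I s' a'" and v: "val w ?e s' \<noteq> 0"
    then obtain i where i: "same {''i''} {''out''} s s'" "i \<le> N - 1" "scal s' ''i'' = i"
      "\<forall>q<i. arr s' ''out'' q = ?y q" "40 * (N - 1 - i) + 8 \<le> a'" unfolding I_def by blast
    have lt: "i < N - 1" using v i(3) unfolding e[OF i(1)] by simp
    have vg: "val w ?g s' = ?y i" using i(1,3) by (simp add: same_def)
    have iw: "i + 1 < 2 ^ w" using lt word_N by linarith
    have "N - 1 - i = N - 1 - (i + 1) + 1" using lt by linarith
    then have a': "40 * (N - 1 - (i + 1)) + 48 \<le> a'" using i(5) by simp
    define s2 where "s2 = s'\<lparr>arr := (arr s')(''out'' := (arr s' ''out'')(i := ?y i)), scal := (scal s')(''i'' := i + 1)\<rparr>"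
    have "I s2 a2" if "a' \<le> a2 + 40" for a2
      unfolding I_def
    proof (intro conjI exI[of _ "i + 1"])
      show "same {''i''} {''out''} s s2" using i(1) by (simp add: same_def s2_def)
      show "\<forall>q<i + 1. arr s2 ''out'' q = ?y q" using i(4) by (auto simp: s2_def less_add_one_iff)
    qed (use that a' lt in \<open>simp_all add: s2_def\<close>)
    moreover have "48 \<le> a'" using a' by linarith
    ultimately show "1 + cost ?e \<le> a' \<and> wp w ?b I s' (a' - (1 + cost ?e))"
      unfolding c wp_Seq_iff wp_Store_iff vg using i(3) iw word by (simp add: s2_def)
  next
    fix s' a' assume I: "I s' a'" and v: "val w ?e s' = 0"
    then obtain i where i: "same {''i''} {''out''} s s'" "i \<le> N - 1" "scal s' ''i'' = i"
      "\<forall>q<i. arr s' ''out'' q = ?y q" "40 * (N - 1 - i) + 8 \<le> a'" unfolding I_def by blast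
    have "i = N - 1" using v i(2,3) unfolding e[OF i(1)] by simp
    then show "1 + cost ?e \<le> a' \<and> F s' (a' - (1 + cost ?e))"
      unfolding c using i(4,5) by (auto intro!: F)
  qed
  moreover have "I (s\<lparr>scal := (scal s)(''i'' := 0)\<rparr>) (a - 2)"
  proof -
    have "40 * (N - 1 - 0) \<le> 40 * N" by simp
    then have "40 * (N - 1 - 0) + 8 \<le> a - 2" using a by linarith
    then show ?thesis unfolding I_def by (intro conjI exI[of _ 0]) (simp_all add: same_def)
  qed
  ultimately show ?thesis unfolding decoder_output_def using a by simp
qed

text \<open>The time bound comes from the fuel and holds for every array. On a codeword the core
  would halt within \<open>D * N\<close> steps anyway, so the fuel never cuts it off, and by
  determinism the fueled run ends in the same state up to the fuel.\<close>

theorem decoder_correct: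
  assumes D: "X + 1400 \<le> D" "D * N < 2 ^ w" "D < 2 ^ w" and lenA: "length A = N"
  defines "T \<equiv> (unit_cost (decoder_core 0 0 0 0) * (D + 1) + 60) * N"
  shows "\<exists>y. length y + 1 = N \<and> outputs w T (decoder D al be u v) n m A y \<and>
    (\<forall>x. length x + 1 = N \<longrightarrow> encodes x A \<longrightarrow> y = x)"
proof -
  have N1: "1 \<le> N" using L_least by linarith
  define c where "c = decoder_core al be u v"
  define U where "U = unit_cost c"
  have U: "U = unit_cost (decoder_core 0 0 0 0)" unfolding U_def c_def by (rule unit_cost_decoder_core)
  define s0 where "s0 = init n m A"
  define s1 where "s1 = s0\<lparr>scal := (scal s0)(''fuel'' := D * N)\<rparr>"
  have w1: "1 \<le> w" using w_pos by linarith
  have nn: "n * n = N" "n * n < 2 ^ w" using N_def word_N by linarith+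
  have fuel: "exec w (''fuel'' ::= Const D \<otimes> (Var ''n'' \<otimes> Var ''n'')) s0 6 s1"
  proof -
    have "val w (Const D \<otimes> (Var ''n'' \<otimes> Var ''n'')) s0 = D * N"
      using D nn by (simp add: s0_def init_def)
    moreover have "1 + cost (Const D \<otimes> (Var ''n'' \<otimes> Var ''n'')) = 6" by simp
    ultimately show ?thesis
      using exec.Assign[of w "''fuel''" "Const D \<otimes> (Var ''n'' \<otimes> Var ''n'')" s0] unfolding s1_def by metis
  qed
  have "''fuel'' \<notin> cvars c" unfolding c_def by (rule decoder_core_vars)
  moreover have "scal s1 ''fuel'' < 2 ^ w" using D by (simp add: s1_def)
  ultimately obtain t2 s2 where 2: "exec w (fueled c) s1 t2 s2" "t2 \<le> U * (1 + scal s1 ''fuel'' - scal s2 ''fuel'')"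
    using fueled_terminates[OF w1] unfolding U_def by blast
  \<comment> \<open>At most \<open>D * N\<close> units are spent, each worth one pass through the
    program; the additional pass is absorbed by \<open>N \<ge> 1\<close>.\<close>
  have "t2 \<le> U * (1 + D * N)"
    by (rule order.trans[OF 2(2)]) (simp add: s1_def)
  also have "\<dots> \<le> U * ((D + 1) * N)"
    using N1 by (intro mult_le_mono2) (simp add: add_mult_distrib)
  finally have t2: "t2 \<le> U * (D + 1) * N" by (simp add: mult.assoc)
  have n2: "scal s2 ''n'' = n"
    using exec_not_assigned[OF 2(1)] decoder_core_vars(2) unfolding c_def by (simp add: s1_def s0_def init_def)
  define yf where "yf = (\<lambda>i. 0 < arr s2 ''P'' ((scal s2 ''K'' + i) mod 2 ^ w))"
  have "wp w decoder_output (\<lambda>s a. \<forall>i<N - 1. arr s ''out'' i = of_bool (yf i)) s2 (40 * N + 10)"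
    by (rule wp_decoder_output[OF n2]) (simp_all add: yf_def)
  then obtain t3 s3 where 3: "exec w decoder_output s2 t3 s3" "t3 \<le> 40 * N + 10" "\<forall>i<N - 1. arr s3 ''out'' i = of_bool (yf i)"
    unfolding wp_def by blast
  define y where "y = map yf [0..<N - 1]"
  have "exec w (decoder D al be u v) s0 (6 + (t2 + t3)) s3"
    unfolding decoder_def c_def[symmetric] by (intro exec.Seq[OF fuel] exec.Seq[OF 2(1) 3(1)])
  moreover have "6 + (t2 + t3) \<le> T"
  proof -
    have "T = U * (D + 1) * N + 60 * N" unfolding T_def U by (rule add_mult_distrib)
    then show ?thesis using t2 3(2) N1 by linarith
  qed
  moreover have "\<forall>i<length y. arr s3 ''out'' i = of_bool (y ! i)"
    using 3(3) by (simp add: y_def)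
  ultimately have "outputs w T (decoder D al be u v) n m A y"
    unfolding outputs_def s0_def by blast
  moreover have "length y + 1 = N" using N1 by (simp add: y_def)
  moreover have "y = x" if x: "length x + 1 = N" "encodes x A" for x
  proof -
    from wp_decoder_core[OF x] obtain t s where
      4: "exec w c s0 t s" "t \<le> (X + 1400) * N" "scal s ''K'' = K" "\<forall>i<length x. arr s ''P'' (K + i) = of_bool (x ! i)"
      unfolding wp_def c_def s0_def by blast
    have "t \<le> D * N" using 4(2) mult_le_mono1[OF D(1), of N] by linarith
    from fueled_simulates[OF 4(1) w1 _ this D(2)] obtain t' f' where
      "exec w (fueled c) s1 t' (s\<lparr>scal := (scal s)(''fuel'' := f')\<rparr>)"
      using decoder_core_vars(1) unfolding c_def s1_def by blast
    with 2(1) have s2: "s2 = s\<lparr>scal := (scal s)(''fuel'' := f')\<rparr>"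
      using exec_deterministic by blast
    have "yf i = x ! i" if "i < length x" for i
    proof -
      have "K + i < 2 ^ w" using that x(1) word_N by linarith
      then show ?thesis using 4(3,4) that unfolding yf_def s2 by simp
    qed
    then show "y = x" using x(1) unfolding y_def by (intro nth_equalityI) auto
  qed
  ultimately show ?thesis by blast
qed

end

declare One_nat_def [simp] add_2_eq_Suc [simp] add_2_eq_Suc' [simp]

section \<open>Choice of the parameters\<close>

lemma log_ceiling_bounds:
  assumes "2 \<le> N"
  defines "L \<equiv> nat \<lceil>log 2 (real N)\<rceil>"
  shows "N \<le> 2 ^ L" "2 ^ (L - 1) < N" "0 < L"
proof -
  have N: "0 < real N" "1 \<le> log 2 (real N)" using assms(1) by (simp_all add: one_le_log_cancel_iff)
  then show "0 < L" by (simp add: L_def)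
  have "log 2 (real N) \<le> real L" unfolding L_def by linarith
  then have "real N \<le> 2 powr real L" using N by (simp add: log_le_iff)
  then show "N \<le> 2 ^ L" by (simp add: powr_realpow)
  have "real (L - 1) < log 2 (real N)" using \<open>0 < L\<close> unfolding L_def by linarith
  then have "2 powr real (L - 1) < real N" using N by (simp add: less_log_iff)
  then show "2 ^ (L - 1) < N" by (simp add: powr_realpow)
qed

text \<open>Programs contain only natural constants, so real factors are replaced by fractions with
  some slack.\<close>

lemma nat_ratio_between:
  fixes x y :: real
  assumes "0 < x" "x < y"
  obtains a b :: nat where "0 < a" "0 < b" "x * real b < real a" "real a < y * real b"
proof -
  obtain q where q: "q \<in> \<rat>" "x < q" "q < y" using Rats_dense_in_real[OF assms(2)] by blast
  obtain a b :: nat where "b \<noteq> 0" "\<bar>q\<bar> = real a / real b" using q(1) by (rule Rats_abs_nat_div_natE)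
  then have b: "0 < real b" "q = real a / real b" using q assms(1) by simp_all
  with q have ab: "x * real b < real a" "real a < y * real b" by (simp_all add: field_simps)
  moreover have "0 < a" using ab(1) b(1) assms(1) by (metis less_trans mult_pos_pos of_nat_0_less_iff)
  ultimately show ?thesis using that b(1) by simp
qed

lemma real_div_bounds:
  assumes "0 < d"
  shows "real (a div d) * real d \<le> real a" "real a < (real (a div d) + 1) * real d"
proof -
  have "a div d * d \<le> a" by simp
  then show "real (a div d) * real d \<le> real a" by (simp flip: of_nat_mult)
  have "a < (a div d + 1) * d" using assms dividend_less_div_times[of d a] by (simp add: add_mult_distrib add.commute)
  then have "real a < real ((a div d + 1) * d)" by (simp only: of_nat_less_iff)
  then show "real a < (real (a div d) + 1) * real d" by (simp add: distrib_right)
qed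

text \<open>The factors 0.85 and 0.95 leave room for rounding on either side:
  \<open>2 * 0.9^2 * 0.85 = 1.377\<close> bounds the saved bits per unit of \<open>L\<close> from
  below, and the gain of about \<open>9/8 * L + 5\<close> stays below \<open>1.37 * L\<close> once
  \<open>L \<ge> 100\<close>.\<close>

lemma machine_exists:
  fixes \<epsilon> :: real
  assumes "0 < \<epsilon>" "\<epsilon> < 1/2"
  shows "\<exists>al be u v n0 X k0. \<forall>n m w. n0 \<le> n \<longrightarrow> 1 \<le> m \<longrightarrow> m \<le> n \<longrightarrow>
    1 / \<epsilon>\<^sup>2 * ln (real (n\<^sup>2)) \<le> real m \<longrightarrow> k0 * nat \<lceil>log 2 (real (n\<^sup>2))\<rceil> \<le> w \<longrightarrow>
    (\<exists>K h L g q. machine (n\<^sup>2) K h L g w n m al be u v X \<and> 0 < q \<and> K = m div q + 1 \<and>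
      real (h + 2) \<le> (1/2 + \<epsilon>) * real (m div q))"
proof -
  define lam where "lam = ln 2 / \<epsilon>\<^sup>2"
  have lam: "0 < lam" using assms(1) by (simp add: lam_def)
  \<comment> \<open>Below 1, so that the target length does not exceed \<open>m\<close>; above
    \<open>0.85\<close>, so that Hoeffding's bound is strong enough.\<close>
  obtain al be :: nat where ab: "0 < al" "0 < be" "85/100 * lam * real be < real al" "real al < 95/100 * lam * real be"
    using nat_ratio_between[of "85/100 * lam" "95/100 * lam"] lam by auto
  obtain u v :: nat where uv: "0 < u" "0 < v" "(1/2 + 95/100 * \<epsilon>) * real v < real u" "real u < (1/2 + \<epsilon>) * real v"
    using nat_ratio_between[of "1/2 + 95/100 * \<epsilon>" "1/2 + \<epsilon>"] assms(1) by auto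
  \<comment> \<open>From \<open>K \<le> 2 * al * L\<close> and \<open>L \<le> 8 * g\<close>:
    \<open>400 * 2 * 8 = 6400\<close>.\<close>
  define X where "X = 6400 * al"
  define k0 where "k0 = 2 * al + be + u + v + 20"
  \<comment> \<open>100 absorbs additive constants; \<open>be \<le> L\<close> makes the target
    length positive.\<close>
  define L0 where "L0 = 100 + be"
  have main: "\<exists>K h L g q. machine (n\<^sup>2) K h L g w n m al be u v X \<and> 0 < q \<and> K = m div q + 1 \<and>
      real (h + 2) \<le> (1/2 + \<epsilon>) * real (m div q)"
    if n: "2 ^ L0 \<le> n" and m: "1 \<le> m" "m \<le> n" "1 / \<epsilon>\<^sup>2 * ln (real (n\<^sup>2)) \<le> real m"
      and w: "k0 * nat \<lceil>log 2 (real (n\<^sup>2))\<rceil> \<le> w" for n m w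
  proof -
    define N where "N = n\<^sup>2"
    define L where "L = nat \<lceil>log 2 (real N)\<rceil>"
    define c where "c = al * L div be"
    define q where "q = m div c"
    define b where "b = m div q"
    define K where "K = b + 1"
    define g where "g = L div 8 + 2"
    define h where "h = u * b div v - 2"
    have "(2::nat) ^ 1 \<le> 2 ^ L0" by (intro power_increasing) (auto simp: L0_def)
    with n have n2: "2 \<le> n" by simp
    then have nN: "n * 2 \<le> N" unfolding N_def power2_eq_square by (intro mult_le_mono2)
    have N2: "2 \<le> N" using nN n2 by linarith
    note L = log_ceiling_bounds[OF N2, folded L_def]
    have "(2::nat) ^ L0 \<le> 2 ^ L" using n nN L(1) by linarith
    then have L0: "L0 \<le> L" by simp
    then have L100: "100 \<le> real L" and beL: "be \<le> L" by (simp_all add: L0_def)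
    have c: "real c < 95/100 * lam * real L" "85/100 * lam * real L < real c + 1"
    proof -
      have "real c * real be \<le> real al * real L" "real al * real L < (real c + 1) * real be"
        using real_div_bounds[OF ab(2), of "al * L"] by (simp_all add: c_def)
      moreover have "real al * real L < 95/100 * lam * real be * real L" "85/100 * lam * real be * real L < real al * real L"
        using ab L(3) by simp_all
      ultimately have "real c * real be < (95/100 * lam * real L) * real be"
        "(85/100 * lam * real L) * real be < (real c + 1) * real be"
        unfolding mult.assoc mult.commute[of "real L" "real be"] by linarith+
      then show "real c < 95/100 * lam * real L" "85/100 * lam * real L < real c + 1"
        using ab(2) by (simp_all only: mult_less_cancel_right_pos of_nat_0_less_iff)
    qed
    have c0: "0 < c"
    proof -
      have "1 * be \<le> al * L" using ab(1) beL by (intro mult_le_mono) auto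
      then show ?thesis using ab(2) by (simp add: c_def div_greater_zero_iff)
    qed
    \<comment> \<open>The assumption on \<open>m\<close> involves \<open>log N\<close>, not its
      ceiling; \<open>0.95 * L \<le> L - 1\<close> bridges the difference.\<close>
    have "c \<le> m"
    proof -
      have "real (L - 1) * ln 2 = ln (2 ^ (L - 1))" by (simp add: ln_realpow)
      also have "\<dots> \<le> ln (real N)"
        using L(2) by (metis ln_mono of_nat_numeral of_nat_power of_nat_less_iff less_imp_le of_nat_0_less_iff zero_less_power zero_less_numeral)
      finally have "(real L - 1) * ln 2 / \<epsilon>\<^sup>2 \<le> ln (real N) / \<epsilon>\<^sup>2"
        using L(3) by (intro divide_right_mono) (simp_all add: of_nat_diff)
      then have "lam * (real L - 1) \<le> 1 / \<epsilon>\<^sup>2 * ln (real N)"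
        by (simp add: lam_def mult.commute)
      with m(3) have "lam * (real L - 1) \<le> real m" by (simp add: N_def)
      moreover have "95/100 * lam * real L \<le> lam * (real L - 1)"
        using mult_left_mono[of "95/100 * real L" "real L - 1" lam] L100 lam by simp
      ultimately show ?thesis using c(1) by linarith
    qed
    then have q0: "0 < q" using c0 by (simp add: q_def div_greater_zero_iff)
    have "q * c \<le> m" by (simp add: q_def)
    then have cb: "c \<le> b" using q0 by (simp add: b_def less_eq_div_iff_mult_less_eq mult.commute)
    have "m < (q + 1) * c" using c0 dividend_less_div_times[of c m] by (simp add: q_def add_mult_distrib add.commute)
    also have "\<dots> \<le> 2 * c * q"
    proof -
      have "1 * c \<le> q * c" using q0 by (intro mult_le_mono1) simp
      then show ?thesis by (simp add: add_mult_distrib mult.commute mult.left_commute)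
    qed
    finally have b2c: "b < 2 * c" using q0 by (simp add: b_def div_less_iff_less_mult)
    have "c \<le> al * L" by (simp add: c_def)
    then have KL: "K \<le> 2 * al * L" using b2c by (simp add: K_def)
    have b0: "0 < b" using c0 cb by simp
    have bm: "b \<le> m" by (simp add: b_def)
    have Kn: "K \<le> n + 1" using bm m(2) by (simp add: K_def)
    define E where "E = \<epsilon> * real K"
    have K_gt: "85/100 * lam * real L < real K" using c(2) cb by (simp add: K_def)
    have e2K: "85/100 * ln 2 * real L < \<epsilon>\<^sup>2 * real K"
      using K_gt assms(1) by (simp add: lam_def field_simps)
    \<comment> \<open>The absolute deviation \<open>\<epsilon> * K\<close> is large, so a twentieth
      of it covers all rounding losses: those in \<open>h\<close>, the 2 taken off, and the halves
      of odd lengths.\<close>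
    have E: "80 \<le> E"
    proof -
      have "ln (1/2) \<le> 1/2 - (1::real)" by (rule ln_le_minus_one) simp
      then have "1/2 \<le> ln (2::real)" by (simp add: ln_div)
      then have "1/2 * 100 \<le> ln 2 * real L" using L100 by (intro mult_mono) auto
      moreover have "2 * (\<epsilon>\<^sup>2 * real K) \<le> E"
        using mult_right_mono[of "2 * \<epsilon>" 1 "\<epsilon> * real K"] assms by (simp add: E_def power2_eq_square)
      ultimately show ?thesis using e2K by linarith
    qed
    define H where "H = u * b div v"
    have H: "(1/2 + 95/100 * \<epsilon>) * real b < real H + 1" "real H < (1/2 + \<epsilon>) * real b"
    proof -
      have "real H * real v \<le> real u * real b" "real u * real b < (real H + 1) * real v"
        using real_div_bounds[OF uv(2), of "u * b"] by (simp_all add: H_def)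
      moreover have "real u * real b < (1/2 + \<epsilon>) * real v * real b" "(1/2 + 95/100 * \<epsilon>) * real v * real b < real u * real b"
        using uv b0 by simp_all
      ultimately have "real H * real v < ((1/2 + \<epsilon>) * real b) * real v"
        "((1/2 + 95/100 * \<epsilon>) * real b) * real v < (real H + 1) * real v"
        unfolding mult.assoc mult.commute[of "real b" "real v"] by linarith+
      then show "(1/2 + 95/100 * \<epsilon>) * real b < real H + 1" "real H < (1/2 + \<epsilon>) * real b"
        using uv(2) by (simp_all only: mult_less_cancel_right_pos of_nat_0_less_iff)
    qed
    have rb: "real b = real K - 1" by (simp add: K_def)
    have K_pos: "0 < real K" by (simp add: K_def)
    have "(1/2 + 95/100 * \<epsilon>) * real b = real K / 2 + 95/100 * E - 1/2 - 95/100 * \<epsilon>"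
      unfolding rb E_def by (simp add: field_simps)
    then have H_lo: "real K / 2 + 95/100 * E - 2 < real H" using H(1) assms(2) by linarith
    have "2 < real H" using H_lo E K_pos by linarith
    then have hH: "h + 2 = H" by (simp add: h_def H_def)
    then have h: "real h = real H - 2" by linarith
    have "(1/2 + \<epsilon>) * real b \<le> 1 * real b" using assms(2) by (intro mult_right_mono) auto
    then have "h < K" using H(2) h rb by linarith
    have half: "(K + 1) div 2 \<le> h"
    proof -
      have "real ((K + 1) div 2) * 2 \<le> real K + 1" using real_div_bounds(1)[of 2 "K + 1"] by simp
      then show ?thesis using h H_lo E by linarith
    qed
    have tails: "tails j t * 2 ^ (L + 3 + g) \<le> 2 ^ j" if "j \<le> K" "h + 1 \<le> t + (K - j + 1) div 2" for j t
    proof -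
      have "real ((K - j + 1) div 2) * 2 \<le> real K - real j + 1"
        using real_div_bounds(1)[of 2 "K - j + 1"] that(1) by (simp add: of_nat_diff)
      moreover have "real h + 1 \<le> real t + real ((K - j + 1) div 2)"
        using that(2) by (metis of_nat_1 of_nat_add of_nat_le_iff)
      \<comment> \<open>Of the deviation \<open>0.95 * E\<close> in the threshold
        \<open>0.9 * E\<close> survives; this is the \<open>9/10\<close> used in Hoeffding's bound
        below.\<close>
      ultimately have "real j / 2 + 9/10 * E \<le> real t" using h H_lo E by linarith
      then have "real j / 2 + 9/10 * \<epsilon> * real K \<le> real t" by (simp add: E_def)
      then have T: "real (tails j t) \<le> 2 ^ j * exp (- 2 * (9/10 * \<epsilon>)\<^sup>2 * real K)"
        using assms(1) that(1) by (intro tails_Hoeffding) auto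
      have "real (L + 3 + g) \<le> 137/100 * real L"
        using real_div_bounds(1)[of 8 L] L100 by (simp add: g_def)
      then have "real (L + 3 + g) * ln 2 \<le> 137/100 * real L * ln 2" by (intro mult_right_mono) auto
      also have "\<dots> \<le> 162/100 * (\<epsilon>\<^sup>2 * real K)"
      proof -
        have "0 \<le> ln 2 * real L" by simp
        then show ?thesis using e2K by (simp only: mult.assoc mult.commute[of "real L" "ln 2"])
      qed
      also have "\<dots> = 2 * (9/10 * \<epsilon>)\<^sup>2 * real K"
        by (simp add: power_mult_distrib power_divide)
      finally have "exp (- 2 * (9/10 * \<epsilon>)\<^sup>2 * real K) \<le> exp (- (real (L + 3 + g) * ln 2))" by simp
      also have "\<dots> = 1 / 2 ^ (L + 3 + g)"
        by (simp only: exp_minus exp_of_nat_mult) (simp add: inverse_eq_divide)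
      finally have "real (tails j t) \<le> 2 ^ j * (1 / 2 ^ (L + 3 + g))"
        using T by (meson mult_left_mono order.trans zero_le_numeral zero_le_power)
      then have "real (tails j t * 2 ^ (L + 3 + g)) \<le> real (2 ^ j)" by (simp add: field_simps)
      then show ?thesis by (simp only: of_nat_le_iff)
    qed
    have pow: "(2::nat) ^ e \<le> 2 ^ w" if "e \<le> k0 * L" for e
      using that w by (intro power_increasing) (simp_all add: L_def N_def)
    have pw: "x < 2 ^ w" if "x \<le> k0" for x
    proof -
      have "k0 * 1 \<le> k0 * L" using L(3) by (intro mult_le_mono2) simp
      with pow[of x] that less_exp[of x] show ?thesis by linarith
    qed
    have pwL: "x * y < 2 ^ w" if "x + 1 \<le> k0" "y \<le> 2 ^ L" for x y
    proof -
      have "x * y \<le> x * 2 ^ L" using that(2) by (intro mult_le_mono2)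
      also have "\<dots> < 2 ^ x * 2 ^ L" using less_exp[of x] by (intro mult_strict_right_mono) auto
      also have "\<dots> = 2 ^ (x + L)" by (simp add: power_add)
      also have "\<dots> \<le> 2 ^ w"
      proof (rule pow)
        have "x * 1 \<le> x * L" using L(3) by (intro mult_le_mono2) simp
        then have "x + L \<le> (x + 1) * L" by (simp add: add_mult_distrib)
        also have "\<dots> \<le> k0 * L" using that(1) by (rule mult_le_mono1)
        finally show "x + L \<le> k0 * L" .
      qed
      finally show ?thesis .
    qed
    \<comment> \<open>\<open>N\<close> and \<open>K\<close> are at most \<open>y\<close>, so the
      bounds polynomial in them reduce to \<open>y ^ 3 \<le> 2 ^ w\<close>; the exponential bound in
      \<open>K\<close> is treated separately.\<close>
    define y where "y = (2::nat) ^ L"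
    have "(2::nat) ^ 4 \<le> y" unfolding y_def using L100 by (intro power_increasing) auto
    then have y16: "16 \<le> y" by simp
    have yy: "16 * y \<le> y * y" "16 * (y * y) \<le> y * (y * y)" using y16 by (auto intro: mult_le_mono)
    have "3 * L \<le> k0 * L" by (intro mult_le_mono1) (simp add: k0_def)
    from pow[OF this] have "2 ^ (L + (L + L)) \<le> (2::nat) ^ w" by (simp add: mult.commute[of 3] numeral_3_eq_3)
    then have y3: "y * (y * y) \<le> 2 ^ w" unfolding y_def power_add .
    have Ny: "N \<le> y" using L(1) by (simp add: y_def)
    have KN: "K \<le> N" using Kn nN n2 by linarith
    have Ky: "K \<le> y" using KN Ny by linarith
    have KK: "(K + 1) * (K + 2) \<le> 10 * N"
    proof -
      have "(K + 1) * (K + 2) \<le> (n + 2) * (n + 3)" using Kn by (intro mult_le_mono) auto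
      also have "\<dots> \<le> (2 * n) * (3 * n)" using n2 by (intro mult_le_mono) auto
      also have "\<dots> \<le> 10 * N" by (simp add: N_def power2_eq_square)
      finally show ?thesis .
    qed
    \<comment> \<open>Case 7 is the counting condition, 16 the pay rate of replacements, and 22 to
      27 are the bounds on the word size.\<close>
    have "machine N K h L g w n m al be u v X"
    proof (unfold_locales, goal_cases)
      case 7 then show ?case by (rule tails)
    next
      case 8
      have "20 * 1 \<le> k0 * L" using L(3) by (intro mult_le_mono) (auto simp: k0_def)
      then show ?case using w by (simp add: L_def N_def)
    next
      case 16
      have "L \<le> 8 * g" by (simp add: g_def)
      then have "2 * al * L \<le> 2 * al * (8 * g)" by (rule mult_le_mono2)
      with KL have "400 * K \<le> 400 * (2 * al * (8 * g))" by (intro mult_le_mono2) linarith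
      then show ?case by (simp add: X_def)
    next
      case 22 show ?case by (rule pwL) (use less_exp[of L] in \<open>auto simp: k0_def\<close>)
    next
      case 23 show ?case by (rule pwL) (use Ky in \<open>auto simp: k0_def y_def\<close>)
    next
      case 24
      have "m < y * y" using m(2) nN Ny yy y16 n2 by linarith
      then show ?case using yy y3 by linarith
    next
      case 25
      have "N * K \<le> y * y" using Ny Ky by (rule mult_le_mono)
      then show ?case using Ny Ky y16 yy y3 by linarith
    next
      case 26
      then show ?case using KK Ny Ky y16 yy y3 by linarith
    next
      case 27
      have "K + 3 \<le> k0 * L"
      proof -
        have "2 * al * L + 3 * L \<le> k0 * L"
          unfolding add_mult_distrib[symmetric] by (intro mult_le_mono1) (simp add: k0_def)
        then show ?thesis using KL L(3) by linarith
      qed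
      from pow[OF this] have "2 ^ K * 8 \<le> (2::nat) ^ w" by (simp add: power_add)
      moreover have "0 < (2::nat) ^ K" by simp
      ultimately show ?case by linarith
    qed (use KN L half \<open>h < K\<close> m(1) KK in
      \<open>simp_all add: K_def b_def q_def c_def h_def g_def N_def power2_eq_square pw k0_def\<close>)
    moreover have "real (h + 2) \<le> (1/2 + \<epsilon>) * real (m div q)"
      using H(2) unfolding hH b_def by simp
    ultimately show ?thesis
      using q0 unfolding N_def K_def b_def by blast
  qed
  show ?thesis
    by (rule exI[of _ al], rule exI[of _ be], rule exI[of _ u], rule exI[of _ v], rule exI[of _ "2 ^ L0"],
        rule exI[of _ X], rule exI[of _ k0]) (use main in blast)
qed


section \<open>Small sizes by lookup, and the assembly of both cases\<close>

lemma computes_within_iff: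
  "computes_within w T p n m D f \<longleftrightarrow> (\<forall>x\<in>D. outputs w T p n m x (f x))"
  by (simp add: computes_within_def outputs_def)

lemma outputs_mono: "outputs w T p n m x y \<Longrightarrow> T \<le> T' \<Longrightarrow> outputs w T' p n m x y"
  unfolding outputs_def by (meson order.trans)

lemma outputs_If:
  assumes "n0 < 2 ^ w" "0 < w" "outputs w T (if n < n0 then p else q) n m x y"
  shows "outputs w (T + 4) (If (Var ''n'' \<lessdot> Const n0) p q) n m x y"
proof -
  obtain t s where 1: "t \<le> T" "exec w (if n < n0 then p else q) (init n m x) t s"
    "\<forall>i<length y. arr s ''out'' i = of_bool (y ! i)"
    using assms(3) unfolding outputs_def by blast
  have v: "val w (Var ''n'' \<lessdot> Const n0) (init n m x) = of_bool (n < n0)"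
    using assms(1,2) by (simp add: init_def of_bool_mod_exp)
  have c: "1 + cost (Var ''n'' \<lessdot> Const n0) = 4" by simp
  have "exec w (If (Var ''n'' \<lessdot> Const n0) p q) (init n m x) (4 + t) s"
  proof (cases "n < n0")
    case True
    then show ?thesis
      using exec.IfTrue[of w "Var ''n'' \<lessdot> Const n0" "init n m x" p t s q] v 1(2) unfolding c by simp
  next
    case False
    then show ?thesis
      using exec.IfFalse[of w "Var ''n'' \<lessdot> Const n0" "init n m x" q t s p] v 1(2) unfolding c by simp
  qed
  then show ?thesis
    using 1 unfolding outputs_def by (intro exI[of _ "4 + t"] exI[of _ s]) auto
qed

text \<open>The interface shared by the counting argument and the algorithms; both decode every
  sequence of length \<open>n^2\<close> to something and bound all windows of the row-by-row
  sequence.\<close>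

definition good_code :: "real \<Rightarrow> nat \<Rightarrow> nat \<Rightarrow> (bool list \<Rightarrow> bool list) \<Rightarrow> (bool list \<Rightarrow> bool list) \<Rightarrow> bool" where
  "good_code \<epsilon> n m Enc Dec \<longleftrightarrow> Enc \<in> bits (n\<^sup>2 - 1) \<rightarrow> bits (n\<^sup>2) \<and> Dec \<in> bits (n\<^sup>2) \<rightarrow> bits (n\<^sup>2 - 1) \<and>
    (\<forall>x\<in>bits (n\<^sup>2 - 1). windows_le m ((1/2 + \<epsilon>) * real m) (Enc x) \<and> Dec (Enc x) = x)"

text \<open>At least half of all sequences have balanced windows, as many as there are inputs, so
  any injection is an encoder.\<close>

lemma good_code_exists:
  fixes \<epsilon> :: real
  assumes "0 < \<epsilon>" "n \<ge> 2" "m \<le> n" "1 \<le> m" "1 / \<epsilon>\<^sup>2 * ln (real (n\<^sup>2)) \<le> real m"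
  shows "\<exists>Enc Dec. good_code \<epsilon> n m Enc Dec"
proof -
  let ?G = "{x \<in> bits (n\<^sup>2). windows_le m ((1/2 + \<epsilon>) * real m) x}"
  have "n * 1 \<le> n\<^sup>2" unfolding power2_eq_square using assms(2) by (intro mult_le_mono2) simp
  then have "m \<le> n\<^sup>2" using assms(3) by simp
  from card_windows_le[OF assms(1,2) this assms(4,5)]
  have "card (bits (n\<^sup>2 - 1)) \<le> card ?G" unfolding card_bits .
  then obtain f where f: "f ` bits (n\<^sup>2 - 1) \<subseteq> ?G" "inj_on f (bits (n\<^sup>2 - 1))"
    using card_le_inj[of "bits (n\<^sup>2 - 1)" ?G] by auto
  define Dec where "Dec y = (if y \<in> f ` bits (n\<^sup>2 - 1) then inv_into (bits (n\<^sup>2 - 1)) f y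
    else replicate (n\<^sup>2 - 1) False)" for y
  have "good_code \<epsilon> n m f Dec"
    unfolding good_code_def
  proof (intro conjI ballI)
    show "f \<in> bits (n\<^sup>2 - 1) \<rightarrow> bits (n\<^sup>2)" using f(1) by auto
    show "Dec \<in> bits (n\<^sup>2) \<rightarrow> bits (n\<^sup>2 - 1)"
    proof
      fix y
      have "replicate (n\<^sup>2 - 1) False \<in> bits (n\<^sup>2 - 1)" by (simp add: bits_def)
      then show "Dec y \<in> bits (n\<^sup>2 - 1)" unfolding Dec_def using inv_into_into[of y f] by simp
    qed
    fix x assume x: "x \<in> bits (n\<^sup>2 - 1)"
    then show "windows_le m ((1/2 + \<epsilon>) * real m) (f x)" using f(1) by auto
    show "Dec (f x) = x" using x f(2) by (simp add: Dec_def)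
  qed
  then show ?thesis by blast
qed

theorem theorem8:
  fixes \<epsilon> :: real
  assumes "0 < \<epsilon>" and "\<epsilon> < 1/2"
  shows "\<exists>(enc :: com) (dec :: com) (k :: nat) (C :: nat). k \<ge> 1 \<and>
    (\<forall>n m :: nat. n \<ge> 2 \<longrightarrow> m \<ge> 1 \<longrightarrow> 1 / \<epsilon>\<^sup>2 * ln (real (n\<^sup>2)) \<le> real m \<longrightarrow> m \<le> n \<longrightarrow>
      (\<exists>Enc \<in> bits (n\<^sup>2 - 1) \<rightarrow> bits (n\<^sup>2). \<exists>Dec \<in> Bal_S n m \<epsilon> \<rightarrow> bits (n\<^sup>2 - 1).
        computes_within (word_len k (n\<^sup>2)) (C * n\<^sup>2) enc n m (bits (n\<^sup>2 - 1)) Enc \<and>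
        computes_within (word_len k (n\<^sup>2)) (C * n\<^sup>2) dec n m (Bal_S n m \<epsilon>) Dec \<and>
        (\<forall>x \<in> bits (n\<^sup>2 - 1).
          (\<forall>i < n. \<forall>j. j + m \<le> n \<longrightarrow>
            real (wt (window m (row n (Enc x) i) j))
              \<in> {(1/2 - \<epsilon>) * real m .. (1/2 + \<epsilon>) * real m}) \<and>
          Enc x \<in> Bal_S n m \<epsilon> \<and>
          Dec (Enc x) = x)))"
proof -
  obtain al be u v n0 X k0 where mach: "\<And>n m w. n0 \<le> n \<Longrightarrow> 1 \<le> m \<Longrightarrow> m \<le> n \<Longrightarrow>
    1 / \<epsilon>\<^sup>2 * ln (real (n\<^sup>2)) \<le> real m \<Longrightarrow> k0 * nat \<lceil>log 2 (real (n\<^sup>2))\<rceil> \<le> w \<Longrightarrow>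
    \<exists>K h L g q. machine (n\<^sup>2) K h L g w n m al be u v X \<and> 0 < q \<and> K = m div q + 1 \<and>
      real (h + 2) \<le> (1/2 + \<epsilon>) * real (m div q)"
    using machine_exists[OF assms] by blast
  define D where "D = X + 1400"
  define valid where "valid n m \<longleftrightarrow> n \<ge> 2 \<and> m \<ge> 1 \<and> 1 / \<epsilon>\<^sup>2 * ln (real (n\<^sup>2)) \<le> real m \<and> m \<le> n" for n m
  obtain cE cD where code: "\<And>n m. valid n m \<Longrightarrow> good_code \<epsilon> n m (cE n m) (cD n m)"
    using good_code_exists[OF assms(1)] unfolding valid_def by metis
  \<comment> \<open>All inputs with \<open>n < n0\<close>; finite because \<open>m\<close> is at
    most \<open>n\<close>.\<close>
  define S where "S len = (SIGMA n:{..<n0}. SIGMA m:{..n}. bits (len n))" for len :: "nat \<Rightarrow> nat"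
  have S: "finite (S len)" "\<And>n m x. (n, m, x) \<in> S len \<Longrightarrow> length x = len n" for len
    by (auto simp: S_def bits_def[symmetric]) (simp add: bits_def)
  have "\<exists>p T W. \<forall>w\<ge>W. \<forall>(n, m, x)\<in>S (\<lambda>n. n\<^sup>2 - 1). outputs w T p n m x (cE n m x)"
    by (rule finite_lookup_program[where len = "\<lambda>n. n\<^sup>2 - 1"]) (rule S, rule S)
  then obtain pE TE WE where pE: "\<forall>w\<ge>WE. \<forall>(n, m, x)\<in>S (\<lambda>n. n\<^sup>2 - 1). outputs w TE pE n m x (cE n m x)"
    by blast
  have "\<exists>p T W. \<forall>w\<ge>W. \<forall>(n, m, x)\<in>S (\<lambda>n. n\<^sup>2). outputs w T p n m x (cD n m x)"
    by (rule finite_lookup_program[where len = "\<lambda>n. n\<^sup>2"]) (rule S, rule S)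
  then obtain pD TD WD where pD: "\<forall>w\<ge>WD. \<forall>(n, m, x)\<in>S (\<lambda>n. n\<^sup>2). outputs w TD pD n m x (cD n m x)"
    by blast
  define enc where "enc = If (Var ''n'' \<lessdot> Const n0) pE (encoder al be u v)"
  define dec where "dec = If (Var ''n'' \<lessdot> Const n0) pD (decoder D al be u v)"
  \<comment> \<open>Large enough for the machine, for the lookup programs, and for \<open>n0\<close>
    and the initial fuel to fit into a word.\<close>
  define k where "k = k0 + WE + WD + n0 + D + 1"
  define C where "C = TE + TD + D + (unit_cost (decoder_core 0 0 0 0) * (D + 1) + 60) + 4"
  have "\<exists>Enc \<in> bits (n\<^sup>2 - 1) \<rightarrow> bits (n\<^sup>2). \<exists>Dec \<in> Bal_S n m \<epsilon> \<rightarrow> bits (n\<^sup>2 - 1).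
        computes_within (word_len k (n\<^sup>2)) (C * n\<^sup>2) enc n m (bits (n\<^sup>2 - 1)) Enc \<and>
        computes_within (word_len k (n\<^sup>2)) (C * n\<^sup>2) dec n m (Bal_S n m \<epsilon>) Dec \<and>
        (\<forall>x \<in> bits (n\<^sup>2 - 1).
          (\<forall>i < n. \<forall>j. j + m \<le> n \<longrightarrow>
            real (wt (window m (row n (Enc x) i) j))
              \<in> {(1/2 - \<epsilon>) * real m .. (1/2 + \<epsilon>) * real m}) \<and>
          Enc x \<in> Bal_S n m \<epsilon> \<and> Dec (Enc x) = x)"
    if valid: "valid n m" for n m
  proof -
    define N where N_eq: "N = n\<^sup>2"
    define L where "L = nat \<lceil>log 2 (real N)\<rceil>"
    define w where "w = word_len k N"
    have w: "w = k * L" by (simp add: w_def word_len_def L_def)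
    have "n * 2 \<le> N" unfolding N_eq power2_eq_square using valid by (intro mult_le_mono2) (simp add: valid_def)
    then have N2: "2 \<le> N" using valid by (simp add: valid_def)
    note L = log_ceiling_bounds[OF N2, folded L_def]
    have "k * 1 \<le> w" unfolding w using L(3) by (intro mult_le_mono2) simp
    then have kw: "k \<le> w" by simp
    have w0: "0 < w" and n0w: "n0 < 2 ^ w" and WEw: "WE \<le> w" and WDw: "WD \<le> w" and k0w: "k0 * L \<le> w"
    proof -
      show "0 < w" "WE \<le> w" "WD \<le> w" using kw by (simp_all add: k_def)
      have "n0 \<le> w" using kw by (simp add: k_def)
      then show "n0 < 2 ^ w" by (rule le_less_trans[OF _ less_exp])
      show "k0 * L \<le> w" unfolding w by (intro mult_le_mono1) (simp add: k_def)
    qed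
    have T: "a * N + 4 \<le> C * N" if "a + 4 \<le> C" for a
    proof -
      have "(a + 4) * N \<le> C * N" using that by (rule mult_le_mono1)
      moreover have "4 * 1 \<le> 4 * N" using N2 by (intro mult_le_mono2) simp
      ultimately show ?thesis by (simp add: add_mult_distrib)
    qed
    have T1: "a \<le> a * N" for a using N2 by simp
    have "\<exists>Enc Dec. good_code \<epsilon> n m Enc Dec \<and> (\<forall>x\<in>bits (N - 1). outputs w (C * N) enc n m x (Enc x)) \<and>
        (\<forall>A\<in>bits N. outputs w (C * N) dec n m A (Dec A))"
    proof (cases "n < n0")
      case True
      have mem: "(n, m, x) \<in> S len" if "x \<in> bits (len n)" for x len
        using True valid that by (simp add: S_def valid_def)
      have "outputs w (C * N) enc n m x (cE n m x)" if "x \<in> bits (N - 1)" for x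
        unfolding enc_def
      proof (rule outputs_mono[OF outputs_If[OF n0w w0]])
        show "outputs w TE (if n < n0 then pE else encoder al be u v) n m x (cE n m x)"
          using pE WEw mem[of x "\<lambda>n. n\<^sup>2 - 1"] that True unfolding N_eq by auto
        have "TE + 4 \<le> C" by (simp add: C_def)
        from T[OF this] T1[of TE] show "TE + 4 \<le> C * N" by linarith
      qed
      moreover have "outputs w (C * N) dec n m x (cD n m x)" if "x \<in> bits N" for x
        unfolding dec_def
      proof (rule outputs_mono[OF outputs_If[OF n0w w0]])
        show "outputs w TD (if n < n0 then pD else decoder D al be u v) n m x (cD n m x)"
          using pD WDw mem[of x "\<lambda>n. n\<^sup>2"] that True unfolding N_eq by auto
        have "TD + 4 \<le> C" by (simp add: C_def)
        from T[OF this] T1[of TD] show "TD + 4 \<le> C * N" by linarith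
      qed
      ultimately show ?thesis using code[OF valid] by blast
    next
      case False
      obtain K h L' g q where M: "machine N K h L' g w n m al be u v X" and q: "0 < q" "K = m div q + 1"
        "real (h + 2) \<le> (1/2 + \<epsilon>) * real (m div q)"
        using mach[of n m w] False valid k0w unfolding valid_def N_eq L_def by (auto simp: not_less)
      interpret machine N K h L' g w n m al be u v X by (rule M)
      have lenx: "length x + 1 = N" if "x \<in> bits (N - 1)" for x using that N2 by (simp add: bits_def)
      \<comment> \<open>Only the relation \<open>encodes\<close> is known of the output; choosing
        one output per input turns it into the function \<open>Enc\<close>.\<close>
      have "\<exists>A. outputs w (C * N) enc n m x A \<and> encodes x A" if x: "x \<in> bits (N - 1)" for x
      proof -
        obtain t s A where 1: "exec w (encoder al be u v) (init n m x) t s" "t \<le> (X + 1400) * N" "encodes x A"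
          "\<forall>i<N. arr s ''out'' i = of_bool (A ! i)"
          using wp_encoder[OF lenx[OF x]] unfolding wp_def by blast
        have "length A = N" using encodes_windows[OF 1(3) lenx[OF x]] by simp
        with 1 have "outputs w (D * N) (encoder al be u v) n m x A"
          unfolding outputs_def D_def by blast
        with False have "outputs w (D * N) (if n < n0 then pE else encoder al be u v) n m x A" by simp
        from outputs_If[OF n0w w0 this] have "outputs w (C * N) enc n m x A"
          unfolding enc_def by (rule outputs_mono) (intro T, simp add: C_def)
        with 1(3) show ?thesis by blast
      qed
      then obtain Enc where Enc: "\<And>x. x \<in> bits (N - 1) \<Longrightarrow> outputs w (C * N) enc n m x (Enc x) \<and> encodes x (Enc x)"
        by metis
      have DN: "D * N < 2 ^ w" "D < 2 ^ w"
      proof -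
        have "D \<le> w" using kw by (simp add: k_def)
        then show "D < 2 ^ w" by (rule le_less_trans[OF _ less_exp])
        have "D * N \<le> D * 2 ^ L" using L(1) by (intro mult_le_mono2)
        also have "\<dots> < 2 ^ D * 2 ^ L" using less_exp[of D] by (intro mult_strict_right_mono) auto
        also have "\<dots> = 2 ^ (D + L)" by (simp add: power_add)
        also have "\<dots> \<le> 2 ^ w"
        proof (intro power_increasing)
          have "D * 1 \<le> D * L" using L(3) by (intro mult_le_mono2) simp
          then have "D + L \<le> (D + 1) * L" by (simp add: add_mult_distrib)
          also have "\<dots> \<le> w" unfolding w by (intro mult_le_mono1) (simp add: k_def)
          finally show "D + L \<le> w" .
        qed simp
        finally show "D * N < 2 ^ w" .
      qed
      \<comment> \<open>The decoder halts on every sequence, so its output defines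
        \<open>Dec\<close> also outside the codewords.\<close>
      have "\<exists>y. y \<in> bits (N - 1) \<and> outputs w (C * N) dec n m A y \<and> (\<forall>x\<in>bits (N - 1). encodes x A \<longrightarrow> y = x)"
        if "A \<in> bits N" for A
      proof -
        have lenA: "length A = N" using that by (simp add: bits_def)
        obtain y where y: "length y + 1 = N"
          "outputs w ((unit_cost (decoder_core 0 0 0 0) * (D + 1) + 60) * N) (decoder D al be u v) n m A y"
          "\<forall>x. length x + 1 = N \<longrightarrow> encodes x A \<longrightarrow> y = x"
          using decoder_correct[OF _ DN lenA] unfolding D_def by blast
        have "outputs w (C * N) dec n m A y"
          unfolding dec_def
        proof (rule outputs_mono[OF outputs_If[OF n0w w0]])
          show "outputs w ((unit_cost (decoder_core 0 0 0 0) * (D + 1) + 60) * N)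
              (if n < n0 then pD else decoder D al be u v) n m A y"
            using y(2) False by simp
        qed (intro T, simp add: C_def)
        then show ?thesis using y lenx by (intro exI[of _ y]) (auto simp: bits_def)
      qed
      then obtain Dec where Dec: "\<And>A. A \<in> bits N \<Longrightarrow> Dec A \<in> bits (N - 1) \<and> outputs w (C * N) dec n m A (Dec A) \<and>
          (\<forall>x\<in>bits (N - 1). encodes x A \<longrightarrow> Dec A = x)"
        by metis
      have EncN: "Enc x \<in> bits N" if "x \<in> bits (N - 1)" for x
        using encodes_windows(1)[OF _ lenx[OF that]] Enc[OF that] by (simp add: bits_def)
      have "windows_le m ((1/2 + \<epsilon>) * real m) (Enc x)" if x: "x \<in> bits (N - 1)" for x
      proof (rule windows_le_of_div[OF _ _ q(1)])
        have "windows_le K (real (h + 2)) (Enc x)"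
          using encodes_windows(2)[OF _ lenx[OF x]] Enc[OF x] by blast
        then show "windows_le (m div q + 1) ((1/2 + \<epsilon>) * real (m div q)) (Enc x)"
          using q(3) unfolding windows_le_def q(2)[symmetric] by (meson order.trans)
        show "0 \<le> 1/2 + \<epsilon>" using assms(1) by simp
        show "m div q + 1 \<le> length (Enc x)" using K_le_N EncN[OF x] unfolding q(2)[symmetric] by (simp add: bits_def)
      qed
      then have "good_code \<epsilon> n m Enc Dec"
        unfolding good_code_def N_eq[symmetric] using EncN Enc Dec by (simp add: Pi_iff)
      then show ?thesis using Enc Dec by blast
    qed
    then obtain Enc Dec where ED: "good_code \<epsilon> n m Enc Dec"
      "\<forall>x\<in>bits (N - 1). outputs w (C * N) enc n m x (Enc x)" "\<forall>A\<in>bits N. outputs w (C * N) dec n m A (Dec A)"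
      by blast
    have Bal: "Bal_S n m \<epsilon> \<subseteq> bits N" by (auto simp: Bal_S_def N_eq)
    have EncN: "Enc \<in> bits (N - 1) \<rightarrow> bits N" and DecN: "Dec \<in> bits N \<rightarrow> bits (N - 1)"
      and win: "\<And>x. x \<in> bits (N - 1) \<Longrightarrow> windows_le m ((1/2 + \<epsilon>) * real m) (Enc x) \<and> Dec (Enc x) = x"
      using ED(1) unfolding good_code_def N_eq by blast+
    have DecB: "Dec \<in> Bal_S n m \<epsilon> \<rightarrow> bits (N - 1)" using DecN Bal by blast
    have run: "computes_within w (C * N) enc n m (bits (N - 1)) Enc"
      "computes_within w (C * N) dec n m (Bal_S n m \<epsilon>) Dec"
      unfolding computes_within_iff using ED(2,3) Bal by blast+
    have props: "(\<forall>i < n. \<forall>j. j + m \<le> n \<longrightarrow> real (wt (window m (row n (Enc x) i) j))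
              \<in> {(1/2 - \<epsilon>) * real m .. (1/2 + \<epsilon>) * real m}) \<and> Enc x \<in> Bal_S n m \<epsilon> \<and> Dec (Enc x) = x"
      if "x \<in> bits (N - 1)" for x
      using windows_le_balanced[of "Enc x" n m \<epsilon>] win[OF that] funcset_mem[OF EncN that] unfolding N_eq by blast
    show ?thesis
      unfolding N_eq[symmetric] w_def[symmetric]
      by (rule bexI[OF _ EncN], rule bexI[OF _ DecB]) (intro conjI run ballI props)
  qed
  note main = this
  show ?thesis
  proof (rule exI[of _ enc], rule exI[of _ dec], rule exI[of _ k], rule exI[of _ C], intro conjI allI impI)
    show "1 \<le> k" by (simp add: k_def)
  qed (rule main, simp add: valid_def)
qed

end
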